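(* Let $n>4$, let $a<T$ be real numbers and let $X\in\mathbb{R}^n$. Suppose the smooth one-parameter family of pairs $\{(A(\cdot,t),u(\cdot,t))\}_{t\in[a,T)}$ on $\mathbb{R}^n$ evolves by the Yang-Mills-Higgs flow with potential $W$, and that $$e(A,u)\in L^{1}\left(B_{2c_{n}r_{0}}(X)\times\left(T-\tfrac{r_{0}^{2}}{4\pi},T\right)\right)$$ for some $r_0$ with $0<r_{0}\leq\sqrt{4\pi(T-a)}$. Then for every $r\in(0,r_0)$, $$\begin{aligned} &\frac{d}{dr}\Bigg(\frac{1}{r^{n-4}}\iint_{E_{r}(X,T)}\Bigg[e(A,u)(x,t)\cdot\frac{n-4}{2(T-t)} - \sum_{j=1}^{n}\left\langle\sum_{i=1}^{n}\frac{(x-X)^{i}}{2(t-T)}F_{ij},\mathcal{S}^{A}_{j}\right\rangle(x,t)\\ &\qquad\qquad - \left\langle\sum_{i=1}^{n}\frac{(x-X)^{i}}{2(t-T)}D_{i}u,\mathcal{J}^{u}\right\rangle(x,t)\Bigg]\,dx\,dt\Bigg)\\ &=\frac{n-4}{r^{n-3}}\iint_{E_{r}(X,T)}\left(\frac{\sum_{i=1}^{n}|D_{i}u|^{2} + 4W(|u|^{2})}{2(T-t)} + \sum_{j=1}^{n}|\mathcal{S}^{A}_{j}|^{2} + |\mathcal{J}^{u}|^{2}\right)(x,t)\,dx\,dt. \end{aligned}$$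
   Context: Setting. $G$ is a connected compact finite-dimensional semisimple Lie group with Lie algebra $(\mathfrak{g},[\cdot,\cdot])$, equipped with the $\mathrm{Ad}$-invariant inner product $\langle A,B\rangle=-\mathrm{tr}(\mathrm{ad}_A\circ\mathrm{ad}_B)$ (negative Killing form). $\rho:G\to \mathrm{GL}(V)$ is a smooth representation on a finite-dimensional real inner product space $(V,\langle\cdot,\cdot\rangle)$ whose inner product is $\rho$-invariant; $Z\cdot v$ (for $Z\in\mathfrak{g}$, $v\in V$) is the action of $\mathfrak{g}$ on $V$ obtained by differentiating $\rho$ at the identity. $W\in C^1(\mathbb{R},\mathbb{R}^+)$ is a given potential, where $\mathbb{R}^+=[0,\infty)$. All norms $|\cdot|$ on $\mathfrak{g}$ and $V$ are those of the inner products. Superscripts denote components of vectors, so $(x-X)^i$ is the $i$th component of $x-X\in\mathbb{R}^n$. $B_R(X)$ is the open Euclidean ball of radius $R$ about $X$. Pairs. A pair $(A,u)$ consists of a gauge field $A=\sum_i A_i\otimes dx^i$ with $A_i:\mathbb{R}^n\to\mathfrak{g}$ smooth, and a scalar field $u:\mathbb{R}^n\to V$, smooth. The curvature is $F_{ij}=\partial_iA_j-\partial_jA_i+[A_i,A_j]$. The covariant derivatives are $\nabla_i Z=\partial_i Z+[A_i,Z]$ for $\mathfrak{g}$-valued functions $Z$, and $D_i v=\partial_i v+A_i\cdot v$ for $V$-valued functions $v$. The bilinear form $\odot:V\times V\to\mathfrak{g}$ is uniquely determined by $\langle Z,u_1\odot u_2\rangle=\langle Z\cdot u_1,u_2\rangle$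 for all $Z\in\mathfrak{g}$, $u_1,u_2\in V$. The energy density is $$e(A,u)=\frac12\Big(\sum_{i<j}|F_{ij}|^2+\sum_i|D_iu|^2\Big)+W(|u|^2).$$ Flow. A smooth one-parameter family of pairs $\{(A(\cdot,t),u(\cdot,t))\}_{t\in[a,b)}$ evolves by the Yang-Mills-Higgs flow (with potential $W$) if on $\mathbb{R}^n\times(a,b)$ $$\partial_tA_j=\sum_{i=1}^n\nabla_iF_{ij}-u\odot D_ju\quad(j=1,\dots,n),\qquad \partial_tu=\sum_{i=1}^nD_i^2u-2W'(|u|^2)u.$$ Quantities attached to $(X,T)$. For $t<T$, $$\mathcal{S}^A_i(x,t)=\partial_tA_i(x,t)+\sum_{k=1}^n\frac{(x-X)^k}{2(t-T)}F_{ki}(x,t),\qquad \mathcal{J}^u(x,t)=\partial_tu(x,t)+\sum_{k=1}^n\frac{(x-X)^k}{2(t-T)}D_ku(x,t).$$ Heat balls. For $(x,t)\in\mathbb{R}^n\times(-\infty,T)$, $$\Phi_{(X,T)}(x,t)=\frac{1}{(4\pi(T-t))^{\frac{n-4}{2}}}\exp\left(\frac{|x-X|^2}{4(t-T)}\right),$$ and for $r>0$, $E_r(X,T)=\{(x,t)\in\mathbb{R}^n\times(-\infty,T):\Phi_{(X,T)}(x,t)>r^{-(n-4)}\}$. The constant $c_n$ is $c_n=\sqrt{\frac{n-4}{2\pi e}}$. *)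

theory Defs
  imports "HOL-Analysis.Analysis"
begin

section \<open>Smooth maps\<close>

primrec Ck_on :: "nat \<Rightarrow> 'a::euclidean_space set \<Rightarrow> ('a \<Rightarrow> 'b::real_normed_vector) \<Rightarrow> bool" where
  "Ck_on 0 U f \<longleftrightarrow> continuous_on U f"
| "Ck_on (Suc k) U f \<longleftrightarrow>
     (\<forall>x\<in>U. f differentiable (at x)) \<and>
     (\<forall>v. Ck_on k U (\<lambda>x. frechet_derivative f (at x) v))"

text \<open>Smoothness on an arbitrary set means locally having a smooth extension; on open sets this
  is the usual notion, and on \<open>UNIV \<times> {a..<b}\<close> it is smoothness up to the initial time.\<close>

definition smooth_on :: "'a::euclidean_space set \<Rightarrow> ('a \<Rightarrow> 'b::real_normed_vector) \<Rightarrow> bool" where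
  "smooth_on S f \<longleftrightarrow>
     (\<forall>x\<in>S. \<exists>U g. open U \<and> x \<in> U \<and> (\<forall>k. Ck_on k U g) \<and> (\<forall>y\<in>S \<inter> U. g y = f y))"

section \<open>Lie groups and their Lie algebras\<close>

type_synonym ('g, 'm) chart = "'g set \<times> ('g \<Rightarrow> 'm)"

definition smooth_atlas ::
  "('g::{t2_space,second_countable_topology}, 'm::euclidean_space) chart set \<Rightarrow> bool" where
  "smooth_atlas \<A> \<longleftrightarrow>
     (\<Union>(U, \<phi>)\<in>\<A>. U) = UNIV \<and>
     (\<forall>(U, \<phi>)\<in>\<A>. open U \<and> open (\<phi> ` U) \<and> homeomorphism U (\<phi> ` U) \<phi> (inv_into U \<phi>)) \<and>
     (\<forall>(U, \<phi>)\<in>\<A>. \<forall>(V, \<psi>)\<in>\<A>. smooth_on (\<phi> ` (U \<inter> V)) (\<psi> \<circ> inv_into U \<phi>))"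

definition smooth_map ::
  "('g, 'm::euclidean_space) chart set \<Rightarrow> ('g \<Rightarrow> 'b::real_normed_vector) \<Rightarrow> bool" where
  "smooth_map \<A> f \<longleftrightarrow> (\<forall>(U, \<phi>)\<in>\<A>. smooth_on (\<phi> ` U) (f \<circ> inv_into U \<phi>))"

locale lie_group = group gmult gunit ginv
  for gmult :: "'g::{t2_space,second_countable_topology} \<Rightarrow> 'g \<Rightarrow> 'g"
    and gunit :: 'g
    and ginv :: "'g \<Rightarrow> 'g" +
  fixes \<A> :: "('g, 'm::euclidean_space) chart set"
  assumes atlas: "smooth_atlas \<A>"
    and continuous_mult: "continuous_on UNIV (\<lambda>(g, h). gmult g h)"
    and smooth_mult:
      "\<And>U \<phi> V \<psi> Y \<theta>. \<lbrakk>(U, \<phi>) \<in> \<A>; (V, \<psi>) \<in> \<A>; (Y, \<theta>) \<in> \<A>\<rbrakk> \<Longrightarrow>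
         smooth_on {(\<phi> g, \<psi> h) | g h. g \<in> U \<and> h \<in> V \<and> gmult g h \<in> Y}
           (\<lambda>(p, q). \<theta> (gmult (inv_into U \<phi> p) (inv_into V \<psi> q)))"
    and continuous_ginv: "continuous_on UNIV ginv"
    and smooth_ginv:
      "\<And>U \<phi> Y \<theta>. \<lbrakk>(U, \<phi>) \<in> \<A>; (Y, \<theta>) \<in> \<A>\<rbrakk> \<Longrightarrow>
         smooth_on {\<phi> g | g. g \<in> U \<and> ginv g \<in> Y} (\<lambda>p. \<theta> (ginv (inv_into U \<phi> p)))"

text \<open>Left-invariant vector fields, as derivations of the algebra of smooth real functions.
  Operators are taken in \<^const>\<open>extensional\<close> so that they are determined by their values on smooth
  functions.\<close>

definition left_invariant_fields ::
  "('g \<Rightarrow> 'g \<Rightarrow> 'g) \<Rightarrow> ('g, 'm::euclidean_space) chart set \<Rightarrow> (('g \<Rightarrow> real) \<Rightarrow> 'g \<Rightarrow> real) set" where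
  "left_invariant_fields gmult \<A> =
     {D \<in> extensional {f. smooth_map \<A> f}.
        (\<forall>f. smooth_map \<A> f \<longrightarrow> smooth_map \<A> (D f)) \<and>
        (\<forall>f h c d. smooth_map \<A> f \<longrightarrow> smooth_map \<A> h \<longrightarrow>
           D (\<lambda>g. c * f g + d * h g) = (\<lambda>g. c * D f g + d * D h g)) \<and>
        (\<forall>f h. smooth_map \<A> f \<longrightarrow> smooth_map \<A> h \<longrightarrow>
           D (\<lambda>g. f g * h g) = (\<lambda>g. D f g * h g + f g * D h g)) \<and>
        (\<forall>f a. smooth_map \<A> f \<longrightarrow> D (\<lambda>g. f (gmult a g)) = (\<lambda>g. D f (gmult a g)))}"

text \<open>\<open>(\<gg>, br)\<close>, carried by the type \<open>'l\<close>, is the Lie algebra of the group: \<open>L\<close> is a linear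
  isomorphism from \<open>'l\<close> onto the left-invariant vector fields that takes \<open>br\<close> to the commutator.\<close>

definition is_lie_algebra_of ::
  "('g \<Rightarrow> 'g \<Rightarrow> 'g) \<Rightarrow> ('g, 'm::euclidean_space) chart set \<Rightarrow>
   ('l::euclidean_space \<Rightarrow> ('g \<Rightarrow> real) \<Rightarrow> 'g \<Rightarrow> real) \<Rightarrow> ('l \<Rightarrow> 'l \<Rightarrow> 'l) \<Rightarrow> bool" where
  "is_lie_algebra_of gmult \<A> L br \<longleftrightarrow>
     bij_betw L UNIV (left_invariant_fields gmult \<A>) \<and>
     (\<forall>Y Z c d f. smooth_map \<A> f \<longrightarrow>
        L (c *\<^sub>R Y + d *\<^sub>R Z) f = (\<lambda>g. c * L Y f g + d * L Z f g)) \<and>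
     (\<forall>Y Z f. smooth_map \<A> f \<longrightarrow>
        L (br Y Z) f = (\<lambda>g. L Y (L Z f) g - L Z (L Y f) g))"

definition lie_ideal :: "('l::real_vector \<Rightarrow> 'l \<Rightarrow> 'l) \<Rightarrow> 'l set \<Rightarrow> bool" where
  "lie_ideal br I \<longleftrightarrow> subspace I \<and> (\<forall>Y. \<forall>Z\<in>I. br Y Z \<in> I)"

primrec derived_series :: "('l::real_vector \<Rightarrow> 'l \<Rightarrow> 'l) \<Rightarrow> 'l set \<Rightarrow> nat \<Rightarrow> 'l set" where
  "derived_series br I 0 = I"
| "derived_series br I (Suc k) =
     span {br Y Z | Y Z. Y \<in> derived_series br I k \<and> Z \<in> derived_series br I k}"

definition semisimple :: "('l::real_vector \<Rightarrow> 'l \<Rightarrow> 'l) \<Rightarrow> bool" where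
  "semisimple br \<longleftrightarrow> (\<forall>I. lie_ideal br I \<and> (\<exists>k. derived_series br I k = {0}) \<longrightarrow> I = {0})"

definition lin_trace :: "('l::euclidean_space \<Rightarrow> 'l) \<Rightarrow> real" where
  "lin_trace f = (\<Sum>b\<in>Basis. f b \<bullet> b)"

definition killing_form :: "('l::euclidean_space \<Rightarrow> 'l \<Rightarrow> 'l) \<Rightarrow> 'l \<Rightarrow> 'l \<Rightarrow> real" where
  "killing_form br Y Z = lin_trace (br Y \<circ> br Z)"

text \<open>Smoothness of \<open>\<rho>\<close> refers to the normed space of endomorphisms of \<open>'v\<close>; its values are
  automatically invertible.\<close>

definition orthogonal_representation ::
  "('g \<Rightarrow> 'g \<Rightarrow> 'g) \<Rightarrow> 'g \<Rightarrow> ('g, 'm::euclidean_space) chart set \<Rightarrow>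
   ('g \<Rightarrow> 'v::euclidean_space \<Rightarrow>\<^sub>L 'v) \<Rightarrow> bool" where
  "orthogonal_representation gmult gunit \<A> \<rho> \<longleftrightarrow>
     \<rho> gunit = id_blinfun \<and> (\<forall>g h. \<rho> (gmult g h) = \<rho> g o\<^sub>L \<rho> h) \<and>
     smooth_map \<A> \<rho> \<and>
     (\<forall>g v w. blinfun_apply (\<rho> g) v \<bullet> blinfun_apply (\<rho> g) w = v \<bullet> w)"

text \<open>\<open>Z \<cdot> v\<close> is the derivative at the identity, in the direction of the tangent vector
  \<open>f \<mapsto> L Z f gunit\<close>, of the map \<open>g \<mapsto> \<rho> g v\<close>, taken coordinatewise in an orthonormal basis.\<close>

definition derived_action ::
  "('l \<Rightarrow> ('g \<Rightarrow> real) \<Rightarrow> 'g \<Rightarrow> real) \<Rightarrow> 'g \<Rightarrow> ('g \<Rightarrow> 'v::euclidean_space \<Rightarrow>\<^sub>L 'v) \<Rightarrow> 'l \<Rightarrow> 'v \<Rightarrow> 'v"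
  where
  "derived_action L gunit \<rho> Z v = (\<Sum>b\<in>Basis. L Z (\<lambda>g. blinfun_apply (\<rho> g) v \<bullet> b) gunit *\<^sub>R b)"

section \<open>Pairs\<close>

text \<open>In the following, \<open>br\<close> is the bracket of the Lie algebra and \<open>act\<close> its action on \<open>'v\<close>.\<close>

type_synonym ('n, 'l) gauge_field = "'n \<Rightarrow> real^'n \<Rightarrow> 'l"
type_synonym ('n, 'v) scalar_field = "real^'n \<Rightarrow> 'v"

definition pd :: "'n::finite \<Rightarrow> (real^'n \<Rightarrow> 'b::real_normed_vector) \<Rightarrow> real^'n \<Rightarrow> 'b" where
  "pd i f x = frechet_derivative f (at x) (axis i 1)"

definition curv :: "('l::euclidean_space \<Rightarrow> 'l \<Rightarrow> 'l) \<Rightarrow> ('n::finite, 'l) gauge_field \<Rightarrow>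
    'n \<Rightarrow> 'n \<Rightarrow> real^'n \<Rightarrow> 'l" where
  "curv br A i j x = pd i (A j) x - pd j (A i) x + br (A i x) (A j x)"

definition nabla :: "('l::euclidean_space \<Rightarrow> 'l \<Rightarrow> 'l) \<Rightarrow> ('n::finite, 'l) gauge_field \<Rightarrow>
    'n \<Rightarrow> (real^'n \<Rightarrow> 'l) \<Rightarrow> real^'n \<Rightarrow> 'l" where
  "nabla br A i Z x = pd i Z x + br (A i x) (Z x)"

definition covD :: "('l::euclidean_space \<Rightarrow> 'v::euclidean_space \<Rightarrow> 'v) \<Rightarrow>
    ('n::finite, 'l) gauge_field \<Rightarrow> 'n \<Rightarrow> ('n, 'v) scalar_field \<Rightarrow> real^'n \<Rightarrow> 'v" where
  "covD act A i v x = pd i v x + act (A i x) (v x)"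

definition odot :: "('l::euclidean_space \<Rightarrow> 'v::euclidean_space \<Rightarrow> 'v) \<Rightarrow> 'v \<Rightarrow> 'v \<Rightarrow> 'l" where
  "odot act u\<^sub>1 u\<^sub>2 = (THE Y. \<forall>Z. Z \<bullet> Y = act Z u\<^sub>1 \<bullet> u\<^sub>2)"

text \<open>The linear order on the index type only serves to write the sum over \<open>i < j\<close>.\<close>

definition energy_density :: "('l::euclidean_space \<Rightarrow> 'l \<Rightarrow> 'l) \<Rightarrow>
    ('l \<Rightarrow> 'v::euclidean_space \<Rightarrow> 'v) \<Rightarrow> (real \<Rightarrow> real) \<Rightarrow>
    ('n::{finite,linorder}, 'l) gauge_field \<Rightarrow> ('n, 'v) scalar_field \<Rightarrow> (real, 'n) vec \<Rightarrow> real" where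
  "energy_density br act W A u x =
     1/2 * ((\<Sum>i\<in>UNIV. \<Sum>j\<in>{i<..}. (norm (curv br A i j x))\<^sup>2) +
            (\<Sum>i\<in>UNIV. (norm (covD act A i u x))\<^sup>2)) +
     W ((norm (u x))\<^sup>2)"

section \<open>The Yang--Mills--Higgs flow\<close>

text \<open>Families of pairs take the time as their first argument.\<close>

definition smooth_family :: "real \<Rightarrow> real \<Rightarrow> (real \<Rightarrow> ('n::finite, 'l::euclidean_space) gauge_field) \<Rightarrow>
    (real \<Rightarrow> ('n, 'v::euclidean_space) scalar_field) \<Rightarrow> bool" where
  "smooth_family a b A u \<longleftrightarrow>
     (\<forall>i. smooth_on (UNIV \<times> {a..<b}) (\<lambda>(x, t). A t i x)) \<and>
     smooth_on (UNIV \<times> {a..<b}) (\<lambda>(x, t). u t x)"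

definition YMH_flow :: "('l::euclidean_space \<Rightarrow> 'l \<Rightarrow> 'l) \<Rightarrow>
    ('l \<Rightarrow> 'v::euclidean_space \<Rightarrow> 'v) \<Rightarrow> (real \<Rightarrow> real) \<Rightarrow> real \<Rightarrow> real \<Rightarrow>
    (real \<Rightarrow> ('n::finite, 'l) gauge_field) \<Rightarrow> (real \<Rightarrow> ('n, 'v) scalar_field) \<Rightarrow> bool" where
  "YMH_flow br act W a b A u \<longleftrightarrow>
     (\<forall>x. \<forall>t\<in>{a<..<b}.
        (\<forall>j. vector_derivative (\<lambda>s. A s j x) (at t) =
               (\<Sum>i\<in>UNIV. nabla br (A t) i (curv br (A t) i j) x)
               - odot act (u t x) (covD act (A t) j (u t) x)) \<and>
        vector_derivative (\<lambda>s. u s x) (at t) =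
          (\<Sum>i\<in>UNIV. covD act (A t) i (covD act (A t) i (u t)) x)
          - (2 * deriv W ((norm (u t x))\<^sup>2)) *\<^sub>R u t x)"

definition contr_F :: "('l::euclidean_space \<Rightarrow> 'l \<Rightarrow> 'l) \<Rightarrow> real^'n \<Rightarrow> real \<Rightarrow>
    (real \<Rightarrow> ('n::finite, 'l) gauge_field) \<Rightarrow> 'n \<Rightarrow> real^'n \<Rightarrow> real \<Rightarrow> 'l" where
  "contr_F br X T A j x t =
     (\<Sum>i\<in>UNIV. ((x - X) $ i / (2 * (t - T))) *\<^sub>R curv br (A t) i j x)"

definition contr_D :: "('l::euclidean_space \<Rightarrow> 'v::euclidean_space \<Rightarrow> 'v) \<Rightarrow> real^'n \<Rightarrow> real \<Rightarrow>
    (real \<Rightarrow> ('n::finite, 'l) gauge_field) \<Rightarrow> (real \<Rightarrow> ('n, 'v) scalar_field) \<Rightarrow>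
    real^'n \<Rightarrow> real \<Rightarrow> 'v" where
  "contr_D act X T A u x t =
     (\<Sum>i\<in>UNIV. ((x - X) $ i / (2 * (t - T))) *\<^sub>R covD act (A t) i (u t) x)"

definition S_A :: "('l::euclidean_space \<Rightarrow> 'l \<Rightarrow> 'l) \<Rightarrow> real^'n \<Rightarrow> real \<Rightarrow>
    (real \<Rightarrow> ('n::finite, 'l) gauge_field) \<Rightarrow> 'n \<Rightarrow> real^'n \<Rightarrow> real \<Rightarrow> 'l" where
  "S_A br X T A i x t = vector_derivative (\<lambda>s. A s i x) (at t) + contr_F br X T A i x t"

definition J_u :: "('l::euclidean_space \<Rightarrow> 'v::euclidean_space \<Rightarrow> 'v) \<Rightarrow> real^'n \<Rightarrow> real \<Rightarrow>
    (real \<Rightarrow> ('n::finite, 'l) gauge_field) \<Rightarrow> (real \<Rightarrow> ('n, 'v) scalar_field) \<Rightarrow>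
    real^'n \<Rightarrow> real \<Rightarrow> 'v" where
  "J_u act X T A u x t = vector_derivative (\<lambda>s. u s x) (at t) + contr_D act X T A u x t"

section \<open>Heat balls\<close>

definition heat_Phi :: "real^'n \<Rightarrow> real \<Rightarrow> real^'n::finite \<Rightarrow> real \<Rightarrow> real" where
  "heat_Phi X T x t =
     1 / (4 * pi * (T - t)) powr ((real CARD('n) - 4) / 2) * exp ((norm (x - X))\<^sup>2 / (4 * (t - T)))"

definition heat_ball :: "real^'n \<Rightarrow> real \<Rightarrow> real \<Rightarrow> ((real^'n::finite) \<times> real) set" where
  "heat_ball X T r =
     {(x, t). t < T \<and> heat_Phi X T x t > r powr (- (real CARD('n) - 4))}"

definition heat_const :: "nat \<Rightarrow> real" where
  "heat_const n = sqrt ((real n - 4) / (2 * pi * exp 1))"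

end

theory Submission
  imports Defs "HOL-Real_Asymp.Real_Asymp"
begin

text \<open>
  Write \<open>\<tau> = T - t\<close>, let \<open>\<psi> = ln \<Phi>\<close> be the logarithm of the heat ball density and \<open>\<xi> = \<nabla>\<psi> = -(x - X) / (2 \<tau>)\<close>, and
  let \<open>P\<close> and \<open>Q\<close> be the integrands on the left and on the right of the formula. The formula comes from one
  vector field on space-time, the flux field \<open>N = (\<xi> e - Y, e)\<close>, where \<open>Y\<close> is the contraction of the
  stress tensor of the pair with the space-time direction \<open>(\<xi>, 1)\<close>. It satisfies
  \<open>N \<cdot> (\<nabla>\<psi>, \<partial>\<^sub>t \<psi>) = P\<close> and \<open>div N = -(P + Q)\<close> (\<open>divergence_flux\<close>). The heat balls are the superlevel sets
  of \<open>\<psi>\<close>, namely \<open>\<psi> > -s\<close> with \<open>s = (n - 4) ln r\<close>. By the coarea formula and the divergence theorem the integral \<open>I\<close>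
  of \<open>P\<close> over the heat ball therefore has the derivative \<open>dI/ds = \<integral> (P + Q)\<close>, that is
  \<open>d/ds (exp (- s) I) = exp (- s) \<integral> Q\<close>, which is the assertion.

  The divergence of \<open>N\<close> is a Noether identity. In the temporal gauge \<open>A\<^sub>t = 0\<close> one has \<open>\<partial>\<^sub>t A\<^sub>j = F\<^sub>t\<^sub>j\<close> and
  \<open>\<partial>\<^sub>t u = D\<^sub>t u\<close>, so that the energy identity and the divergence of the spatial stress tensor are the cases
  \<open>\<alpha> = t\<close> and \<open>\<alpha> = k\<close> of one computation (\<open>divergence_stress\<close>), which uses the Bianchi and Ricci identities.
  The laws of the Lie bracket and of its representation, and the invariance of the inner products, are derived
  from the group in \<open>derived_action_lie_action\<close>.

  The analytic difficulty is the tip \<open>(X, T)\<close> of the heat ball, where the flow may become singular and where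
  only the integrability of \<open>e\<close> is known. Three estimates settle it.

  \<^item> Testing the flux field with the heat kernel times a spatial cut-off gives Struwe's monotonicity
    (\<open>monotonicity\<close>), since for the weight \<open>exp \<psi>\<close> the terms in \<open>P\<close> cancel. With centre \<open>(X, T)\<close> it bounds the
    integral of \<open>\<Phi> Q\<close>, and \<open>\<Phi>\<close> is bounded below on the heat ball (\<open>weighted_Q_integrable\<close>).

  \<^item> With centre \<open>(X, t + \<rho>\<^sup>2)\<close> it bounds the energy at time \<open>t\<close> in the ball of radius \<open>\<rho>\<close> by \<open>C \<rho>\<^bsup>n-4\<^esup>\<close>, uniformly in
    \<open>t < T\<close> (\<open>morrey_bound\<close>).

  \<^item> The slices of the heat ball have squared radius of order \<open>\<tau> ln (1/\<tau>)\<close>, so by the Morrey bound \<open>e / \<tau>\<close> is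
    integrable on the heat ball, even after multiplication by powers of \<open>ln (1/\<tau>)\<close>
    (\<open>weighted_energy_integrable\<close>). This makes \<open>P\<close>, \<open>Q\<close> and their products with \<open>\<psi>\<close> integrable.

  Instead of the coarea formula, the flux field is tested with \<open>H(\<psi> + s)\<close> for functions \<open>H\<close> that increase to the
  positive part. In the limit the integral of \<open>P\<close> over the heat ball equals the integral of
  \<open>(\<psi> + s)\<^sub>+ (P + Q)\<close> (\<open>heat_ball_identity\<close>), and this is differentiated under the integral sign
  (\<open>heat_ball_derivative\<close>); level sets of \<open>\<psi>\<close> are null sets, so the derivative exists at every \<open>r\<close>.
\<close>

section \<open>Calculus of smooth maps\<close>

lemma Ck_on_subset: "Ck_on k U f \<Longrightarrow> V \<subseteq> U \<Longrightarrow> Ck_on k V f"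
  by (induction k arbitrary: f) (auto intro: continuous_on_subset)

lemma Ck_on_SucD: "Ck_on (Suc k) U f \<Longrightarrow> Ck_on k U f"
proof (induction k arbitrary: f)
  case 0
  then show ?case
    by (auto intro!: continuous_at_imp_continuous_on differentiable_imp_continuous_within)
next
  case (Suc k)
  then show ?case by auto
qed

lemma Ck_on_mono: "Ck_on k U f \<Longrightarrow> j \<le> k \<Longrightarrow> Ck_on j U f"
  by (induction k) (use Ck_on_SucD le_Suc_eq in \<open>blast+\<close>)

lemma Ck_on_imp_continuous: "Ck_on k U f \<Longrightarrow> continuous_on U f"
  using Ck_on_mono[of k U f 0] by simp

lemma Ck_on_has_derivative:
  "Ck_on (Suc k) U f \<Longrightarrow> x \<in> U \<Longrightarrow> (f has_derivative frechet_derivative f (at x)) (at x)"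
  by (auto simp: frechet_derivative_works)

lemma Ck_on_deriv: "Ck_on (Suc k) U f \<Longrightarrow> Ck_on k U (\<lambda>x. frechet_derivative f (at x) v)"
  by auto

lemma frechet_derivative_cong_open:
  assumes "open U" "\<And>x. x \<in> U \<Longrightarrow> f x = g x" "x \<in> U"
  shows "frechet_derivative f (at x) = frechet_derivative g (at x)"
proof -
  have "(f has_derivative D) (at x) \<longleftrightarrow> (g has_derivative D) (at x)" for D
    using assms by (metis has_derivative_transform_within_open)
  then show ?thesis unfolding frechet_derivative_def by simp
qed

lemma Ck_on_cong:
  assumes "open U" "\<And>x. x \<in> U \<Longrightarrow> f x = g x"
  shows "Ck_on k U f \<longleftrightarrow> Ck_on k U g"
  using assms(2)
proof (induction k arbitrary: f g)
  case 0
  then show ?case by (simp cong: continuous_on_cong)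
next
  case (Suc k)
  have d: "f differentiable at x \<longleftrightarrow> g differentiable at x" if "x \<in> U" for x
    unfolding differentiable_def using that assms(1) Suc.prems
    by (metis has_derivative_transform_within_open)
  have "Ck_on k U (\<lambda>x. frechet_derivative f (at x) v) \<longleftrightarrow>
        Ck_on k U (\<lambda>x. frechet_derivative g (at x) v)" for v
    by (rule Suc.IH) (simp add: frechet_derivative_cong_open[OF assms(1) Suc.prems])
  with d show ?case by simp
qed

lemma Ck_on_SucI:
  assumes "open U" "\<And>x. x \<in> U \<Longrightarrow> (f has_derivative f' x) (at x)"
    and "\<And>v. Ck_on k U (\<lambda>x. f' x v)"
  shows "Ck_on (Suc k) U f"
proof -
  have "frechet_derivative f (at x) = f' x" if "x \<in> U" for x
    by (rule frechet_derivative_at[OF assms(2)[OF that], symmetric])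
  then have "Ck_on k U (\<lambda>x. frechet_derivative f (at x) v)" for v
    using Ck_on_cong[OF assms(1), of "\<lambda>x. frechet_derivative f (at x) v" "\<lambda>x. f' x v" k] assms(3)[of v]
    by simp
  then show ?thesis using assms(2) by (auto simp: differentiable_def)
qed

lemma Ck_on_const: "open U \<Longrightarrow> Ck_on k U (\<lambda>x. c)"
proof (induction k arbitrary: c)
  case (Suc k)
  show ?case by (rule Ck_on_SucI[where f'="\<lambda>x v. 0"]) (use Suc in auto)
qed auto

lemma Ck_on_add:
  "open U \<Longrightarrow> Ck_on k U f \<Longrightarrow> Ck_on k U g \<Longrightarrow> Ck_on k U (\<lambda>x. f x + g x)"
proof (induction k arbitrary: f g)
  case 0
  then show ?case by (auto intro: continuous_intros)
next
  case (Suc k)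
  show ?case
    by (rule Ck_on_SucI[OF Suc.prems(1) has_derivative_add[OF
        Ck_on_has_derivative[OF Suc.prems(2)] Ck_on_has_derivative[OF Suc.prems(3)]]])
      (use Suc in auto)
qed

lemma Ck_on_sum:
  assumes "open U" "\<And>i. i \<in> I \<Longrightarrow> Ck_on k U (f i)"
  shows "Ck_on k U (\<lambda>x. \<Sum>i\<in>I. f i x)"
  using assms(2)
  by (induction I rule: infinite_finite_induct)
    (auto intro!: Ck_on_const Ck_on_add assms(1))

lemma (in bounded_linear) Ck_on_compose:
  "open U \<Longrightarrow> Ck_on k U g \<Longrightarrow> Ck_on k U (\<lambda>x. f (g x))"
proof (induction k arbitrary: g)
  case 0
  then show ?case by (auto intro: continuous_on)
next
  case (Suc k)
  show ?case
    by (rule Ck_on_SucI[OF Suc.prems(1) has_derivative[OF Ck_on_has_derivative[OF Suc.prems(2)]]])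
      (use Suc in auto)
qed

lemma (in bounded_bilinear) Ck_on_compose:
  "open U \<Longrightarrow> Ck_on k U f \<Longrightarrow> Ck_on k U g \<Longrightarrow> Ck_on k U (\<lambda>x. prod (f x) (g x))"
proof (induction k arbitrary: f g)
  case 0
  then show ?case by (auto intro: continuous_on)
next
  case (Suc k)
  show ?case
  proof (rule Ck_on_SucI[OF Suc.prems(1) FDERIV[OF
        Ck_on_has_derivative[OF Suc.prems(2)] Ck_on_has_derivative[OF Suc.prems(3)]]])
    fix v show "Ck_on k U (\<lambda>x. prod (f x) (frechet_derivative g (at x) v)
        + prod (frechet_derivative f (at x) v) (g x))"
      by (intro Ck_on_add Suc.IH Suc.prems(1) Ck_on_SucD[OF Suc.prems(2)]
          Ck_on_SucD[OF Suc.prems(3)] Ck_on_deriv[OF Suc.prems(2)] Ck_on_deriv[OF Suc.prems(3)])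
  qed auto
qed

lemmas Ck_on_mult = bounded_bilinear.Ck_on_compose[OF bounded_bilinear_mult]
lemmas Ck_on_inner = bounded_bilinear.Ck_on_compose[OF bounded_bilinear_inner]

lemma Ck_on_local:
  assumes "\<And>x. x \<in> U \<Longrightarrow> \<exists>V. open V \<and> x \<in> V \<and> Ck_on k (V \<inter> U) f" "open U"
  shows "Ck_on k U f"
  using assms(1)
proof (induction k arbitrary: f)
  case 0
  have "isCont f x" if "x \<in> U" for x
    using 0[OF that] that assms(2)
    by (metis Ck_on.simps(1) IntI continuous_on_eq_continuous_at open_Int)
  then show ?case by (simp add: continuous_at_imp_continuous_on)
next
  case (Suc k)
  have "f differentiable at x" if "x \<in> U" for x
    using Suc.prems[OF that] that by auto
  moreover have "Ck_on k U (\<lambda>x. frechet_derivative f (at x) v)" for v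
    by (rule Suc.IH) (use Suc.prems in \<open>metis Ck_on.simps(2)\<close>)
  ultimately show ?case by simp
qed

lemma smooth_on_open_imp_Ck_on:
  assumes "smooth_on S f" "open U" "U \<subseteq> S"
  shows "Ck_on k U f"
proof (rule Ck_on_local[OF _ assms(2)])
  fix x assume "x \<in> U"
  then obtain V g where V: "open V" "x \<in> V" "\<forall>k. Ck_on k V g" "\<forall>y\<in>S \<inter> V. g y = f y"
    using assms unfolding smooth_on_def by (meson subsetD)
  have "Ck_on k (V \<inter> U) g" using V(3) Ck_on_subset by blast
  then have "Ck_on k (V \<inter> U) f"
    using Ck_on_cong[of "V \<inter> U" g f k] V assms by blast
  with V show "\<exists>V. open V \<and> x \<in> V \<and> Ck_on k (V \<inter> U) f" by blast
qed

lemma smooth_on_binary: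
  fixes S :: "'a::euclidean_space set"
  assumes p: "\<And>(U :: 'a set) k f g. open U \<Longrightarrow> Ck_on k U f \<Longrightarrow> Ck_on k U g \<Longrightarrow> Ck_on k U (\<lambda>x. p (f x) (g x))"
    and f: "smooth_on S f" and g: "smooth_on S g"
  shows "smooth_on S (\<lambda>x. p (f x) (g x))"
  unfolding smooth_on_def
proof
  fix x assume "x \<in> S"
  then obtain V h V' h' where
    V: "open V" "x \<in> V" "\<forall>k. Ck_on k V h" "\<forall>y\<in>S \<inter> V. h y = f y" and
    V': "open V'" "x \<in> V'" "\<forall>k. Ck_on k V' h'" "\<forall>y\<in>S \<inter> V'. h' y = g y"
    using f g unfolding smooth_on_def by meson
  have "Ck_on k (V \<inter> V') (\<lambda>x. p (h x) (h' x))" for k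
    by (rule p) (use V V' in \<open>auto intro: Ck_on_subset\<close>)
  with V V' show "\<exists>U h. open U \<and> x \<in> U \<and> (\<forall>k. Ck_on k U h) \<and> (\<forall>y\<in>S \<inter> U. h y = p (f y) (g y))"
    by (intro exI[of _ "V \<inter> V'"] exI[of _ "\<lambda>x. p (h x) (h' x)"]) auto
qed

lemmas smooth_on_add = smooth_on_binary[where p="(+)", OF Ck_on_add]
lemmas smooth_on_mult = smooth_on_binary[where p="(*)", OF Ck_on_mult]

lemma (in bounded_linear) smooth_on_compose: "smooth_on S g \<Longrightarrow> smooth_on S (\<lambda>x. f (g x))"
  by (rule smooth_on_binary[where p="\<lambda>x y. f x" and g=g]) (rule Ck_on_compose)

lemma smooth_on_const: "smooth_on S (\<lambda>x. c)"
  unfolding smooth_on_def by (auto intro!: exI[of _ UNIV] exI[of _ "\<lambda>x. c"] Ck_on_const)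

subsection \<open>Symmetry of second derivatives\<close>

lemma vector_diff_chain_at_derivative:
  assumes "(g has_vector_derivative v) (at s)" "(f has_derivative D) (at (g s))"
  shows "(f \<circ> g has_vector_derivative D v) (at s)"
proof -
  have "(f \<circ> g has_derivative D \<circ> (\<lambda>h. h *\<^sub>R v)) (at s)"
    using diff_chain_at[of g "\<lambda>h. h *\<^sub>R v" s f D] assms
    unfolding has_vector_derivative_def by blast
  moreover have "D \<circ> (\<lambda>h. h *\<^sub>R v) = (\<lambda>h. h *\<^sub>R D v)"
    using linear_scale[OF has_derivative_linear[OF assms(2)]] by (simp add: fun_eq_iff)
  ultimately show ?thesis unfolding has_vector_derivative_def by simp
qed

text \<open>The second difference of \<open>f\<close> over the parallelogram spanned by \<open>h v\<close> and \<open>h w\<close> is, by the mean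
  value theorem applied in each direction, \<open>h\<^sup>2\<close> times a mixed derivative at a nearby point.\<close>

lemma second_difference_mean_value:
  fixes f :: "'a::euclidean_space \<Rightarrow> real"
  assumes f: "Ck_on 2 U f" and B: "ball x e \<subseteq> U" and h: "0 < h" "h * (norm v + norm w) < e"
  obtains s t where "0 < s" "s < h" "0 < t" "t < h"
    "f (x + h *\<^sub>R v + h *\<^sub>R w) - f (x + h *\<^sub>R v) - f (x + h *\<^sub>R w) + f x
      = h\<^sup>2 * frechet_derivative (\<lambda>y. frechet_derivative f (at y) v) (at (x + s *\<^sub>R v + t *\<^sub>R w)) w"
proof -
  let ?d = "\<lambda>y. frechet_derivative f (at y) v"
  have mem: "x + s *\<^sub>R v + t *\<^sub>R w \<in> U" if "0 \<le> s" "s \<le> h" "0 \<le> t" "t \<le> h" for s t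
  proof -
    have "norm (s *\<^sub>R v + t *\<^sub>R w) \<le> s * norm v + t * norm w"
      using norm_triangle_ineq[of "s *\<^sub>R v" "t *\<^sub>R w"] that by simp
    also have "\<dots> \<le> h * norm v + h * norm w"
      using that by (intro add_mono mult_right_mono) auto
    finally have "norm (s *\<^sub>R v + t *\<^sub>R w) < e" using h by (simp add: algebra_simps)
    moreover have "dist x (x + s *\<^sub>R v + t *\<^sub>R w) = norm (s *\<^sub>R v + t *\<^sub>R w)"
      by (metis add.assoc add_diff_cancel_left' dist_commute dist_norm)
    ultimately show ?thesis using B by auto
  qed
  have f1: "(f has_derivative frechet_derivative f (at y)) (at y)" if "y \<in> U" for y
    using f that Ck_on_has_derivative[of 1 U f] by (simp add: numeral_2_eq_2)
  have f2: "(?d has_derivative frechet_derivative ?d (at y)) (at y)" if "y \<in> U" for y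
    using f that Ck_on_has_derivative[of 0 U ?d] by (simp add: numeral_2_eq_2)
  have dv: "((\<lambda>s. f (x + s *\<^sub>R v + t *\<^sub>R w)) has_real_derivative ?d (x + s *\<^sub>R v + t *\<^sub>R w)) (at s)"
    if "x + s *\<^sub>R v + t *\<^sub>R w \<in> U" for s t
  proof -
    have line: "((\<lambda>s. x + s *\<^sub>R v + t *\<^sub>R w) has_vector_derivative v) (at s)"
      unfolding has_vector_derivative_def
      by (rule has_derivative_eq_rhs, (rule derivative_intros)+) simp
    show ?thesis
      using vector_diff_chain_at_derivative[OF line f1[OF that]]
      by (simp add: o_def has_real_derivative_iff_has_vector_derivative)
  qed
  have dw: "((\<lambda>t. ?d (x + s *\<^sub>R v + t *\<^sub>R w)) has_real_derivative
      frechet_derivative ?d (at (x + s *\<^sub>R v + t *\<^sub>R w)) w) (at t)"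
    if "x + s *\<^sub>R v + t *\<^sub>R w \<in> U" for s t
  proof -
    have line: "((\<lambda>t. x + s *\<^sub>R v + t *\<^sub>R w) has_vector_derivative w) (at t)"
      unfolding has_vector_derivative_def
      by (rule has_derivative_eq_rhs, (rule derivative_intros)+) simp
    show ?thesis
      using vector_diff_chain_at_derivative[OF line f2[OF that]]
      by (simp add: o_def has_real_derivative_iff_has_vector_derivative)
  qed
  let ?g = "\<lambda>s. f (x + s *\<^sub>R v + h *\<^sub>R w) - f (x + s *\<^sub>R v + 0 *\<^sub>R w)"
  have "\<exists>s. 0 < s \<and> s < h \<and> ?g h - ?g 0 =
      (h - 0) * (?d (x + s *\<^sub>R v + h *\<^sub>R w) - ?d (x + s *\<^sub>R v + 0 *\<^sub>R w))"
    by (rule MVT2) (use h(1) in \<open>auto intro!: DERIV_diff dv mem simp del: scaleR_zero_left\<close>)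
  then obtain s where s: "0 < s" "s < h"
    "?g h - ?g 0 = h * (?d (x + s *\<^sub>R v + h *\<^sub>R w) - ?d (x + s *\<^sub>R v + 0 *\<^sub>R w))" by auto
  have "\<exists>t. 0 < t \<and> t < h \<and> ?d (x + s *\<^sub>R v + h *\<^sub>R w) - ?d (x + s *\<^sub>R v + 0 *\<^sub>R w) =
      (h - 0) * frechet_derivative ?d (at (x + s *\<^sub>R v + t *\<^sub>R w)) w"
    by (rule MVT2) (use h(1) s in \<open>auto intro!: dw mem\<close>)
  then obtain t where t: "0 < t" "t < h" "?d (x + s *\<^sub>R v + h *\<^sub>R w) - ?d (x + s *\<^sub>R v + 0 *\<^sub>R w) =
      h * frechet_derivative ?d (at (x + s *\<^sub>R v + t *\<^sub>R w)) w" by auto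
  show ?thesis
    by (rule that[OF s(1,2) t(1,2)]) (use s(3) t(3) in \<open>simp add: power2_eq_square\<close>)
qed

text \<open>The second difference is symmetric in the two directions, so the mixed derivatives in either order
  agree at points that both tend to \<open>x\<close>.\<close>

lemma symmetric_second_derivative_real:
  fixes f :: "'a::euclidean_space \<Rightarrow> real"
  assumes f: "Ck_on 2 U f" and U: "open U" "x \<in> U"
  shows "frechet_derivative (\<lambda>y. frechet_derivative f (at y) v) (at x) w
       = frechet_derivative (\<lambda>y. frechet_derivative f (at y) w) (at x) v"
proof -
  define D where "D v w y = frechet_derivative (\<lambda>y. frechet_derivative f (at y) v) (at y) w" for v w y
  have contD: "continuous_on U (D v w)" for v w
    using f unfolding D_def by (simp add: numeral_2_eq_2)
  obtain e where e: "e > 0" "ball x e \<subseteq> U" using U open_contains_ball by meson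
  define h where "h n = e / (norm v + norm w + 1) / (real n + 2)" for n :: nat
  have pos: "norm v + norm w + 1 > 0" by (simp add: add_nonneg_pos)
  have h0: "h n > 0" for n unfolding h_def using e pos by simp
  have hlim: "h \<longlonglongrightarrow> 0" unfolding h_def by real_asymp
  have hsm: "h n * (norm v + norm w) < e" for n
  proof -
    have "h n * (norm v + norm w) \<le> h n * (norm v + norm w + 1)"
      using h0[of n] by (intro mult_left_mono) auto
    also have "\<dots> = e / (real n + 2)" unfolding h_def using pos by simp
    also have "\<dots> < e" using e(1) by (simp add: field_simps add_pos_nonneg)
    finally show ?thesis .
  qed
  have "\<exists>s t. 0 < s \<and> s < h n \<and> 0 < t \<and> t < h n \<and>
      f (x + h n *\<^sub>R v + h n *\<^sub>R w) - f (x + h n *\<^sub>R v) - f (x + h n *\<^sub>R w) + f x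
      = (h n)\<^sup>2 * D v w (x + s *\<^sub>R v + t *\<^sub>R w)" for n
    using second_difference_mean_value[OF f e(2) h0 hsm] unfolding D_def by metis
  then obtain s t where st: "\<And>n. 0 < s n" "\<And>n. s n < h n" "\<And>n. 0 < t n" "\<And>n. t n < h n"
    "\<And>n. f (x + h n *\<^sub>R v + h n *\<^sub>R w) - f (x + h n *\<^sub>R v) - f (x + h n *\<^sub>R w) + f x
      = (h n)\<^sup>2 * D v w (x + s n *\<^sub>R v + t n *\<^sub>R w)" by metis
  have "\<exists>s t. 0 < s \<and> s < h n \<and> 0 < t \<and> t < h n \<and>
      f (x + h n *\<^sub>R w + h n *\<^sub>R v) - f (x + h n *\<^sub>R w) - f (x + h n *\<^sub>R v) + f x
      = (h n)\<^sup>2 * D w v (x + s *\<^sub>R w + t *\<^sub>R v)" for n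
    using second_difference_mean_value[OF f e(2) h0, of n w v] hsm[of n] unfolding D_def
    by (metis add.commute)
  then obtain s' t' where st': "\<And>n. 0 < s' n" "\<And>n. s' n < h n" "\<And>n. 0 < t' n" "\<And>n. t' n < h n"
    "\<And>n. f (x + h n *\<^sub>R w + h n *\<^sub>R v) - f (x + h n *\<^sub>R w) - f (x + h n *\<^sub>R v) + f x
      = (h n)\<^sup>2 * D w v (x + s' n *\<^sub>R w + t' n *\<^sub>R v)" by metis
  have lim0: "a \<longlonglongrightarrow> 0" if "\<And>n. 0 < a n" "\<And>n. a n < h n" for a :: "nat \<Rightarrow> real"
    by (rule tendsto_sandwich[OF _ _ tendsto_const hlim]) (simp_all add: that less_imp_le)
  have eq: "D v w (x + s n *\<^sub>R v + t n *\<^sub>R w) = D w v (x + s' n *\<^sub>R w + t' n *\<^sub>R v)" for n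
  proof -
    have "f (x + h n *\<^sub>R w + h n *\<^sub>R v) = f (x + h n *\<^sub>R v + h n *\<^sub>R w)"
      by (simp add: algebra_simps)
    then have "(h n)\<^sup>2 * D v w (x + s n *\<^sub>R v + t n *\<^sub>R w) = (h n)\<^sup>2 * D w v (x + s' n *\<^sub>R w + t' n *\<^sub>R v)"
      using st(5)[of n] st'(5)[of n] by linarith
    then show ?thesis using h0[of n] by simp
  qed
  have tt: "(\<lambda>n. x + a n *\<^sub>R v' + b n *\<^sub>R w') \<longlonglongrightarrow> x" if "a \<longlonglongrightarrow> 0" "b \<longlonglongrightarrow> 0"
    for a b :: "nat \<Rightarrow> real" and v' w'
    using tendsto_add[OF tendsto_add[OF tendsto_const tendsto_scaleR[OF that(1) tendsto_const]]
        tendsto_scaleR[OF that(2) tendsto_const], of x v' w'] by simp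
  have c: "isCont (D a b) x" for a b
    using contD U continuous_on_eq_continuous_at by blast
  have "(\<lambda>n. D v w (x + s n *\<^sub>R v + t n *\<^sub>R w)) \<longlonglongrightarrow> D v w x"
    by (rule isCont_tendsto_compose[OF c tt]) (use lim0 st in auto)
  moreover have "(\<lambda>n. D w v (x + s' n *\<^sub>R w + t' n *\<^sub>R v)) \<longlonglongrightarrow> D w v x"
    by (rule isCont_tendsto_compose[OF c tt]) (use lim0 st' in auto)
  ultimately show ?thesis unfolding eq D_def[symmetric] by (rule LIMSEQ_unique)
qed

lemma symmetric_second_derivative:
  fixes f :: "'a::euclidean_space \<Rightarrow> 'b::euclidean_space"
  assumes f: "Ck_on 2 U f" and U: "open U" "x \<in> U"
  shows "frechet_derivative (\<lambda>y. frechet_derivative f (at y) v) (at x) w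
       = frechet_derivative (\<lambda>y. frechet_derivative f (at y) w) (at x) v"
proof (rule euclidean_eqI)
  fix b :: 'b
  have comp: "frechet_derivative (\<lambda>y. g y \<bullet> b) (at y) a = frechet_derivative g (at y) a \<bullet> b"
    if "Ck_on 1 U g" "y \<in> U" for g :: "'a \<Rightarrow> 'b" and y a
    using has_derivative_inner_left[OF Ck_on_has_derivative[of 0 U g y], of b] that
    by (simp add: frechet_derivative_at[symmetric])
  have f1: "Ck_on 1 U f" by (rule Ck_on_mono[OF f]) simp
  have f1': "Ck_on 1 U (\<lambda>y. frechet_derivative f (at y) a)" for a
    using f by (simp add: numeral_2_eq_2)
  have *: "frechet_derivative (\<lambda>y. frechet_derivative (\<lambda>y. f y \<bullet> b) (at y) v) (at x) w
     = frechet_derivative (\<lambda>y. frechet_derivative f (at y) v) (at x) w \<bullet> b" for v w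
  proof -
    have "frechet_derivative (\<lambda>y. frechet_derivative (\<lambda>y. f y \<bullet> b) (at y) v) (at x)
        = frechet_derivative (\<lambda>y. frechet_derivative f (at y) v \<bullet> b) (at x)"
      by (rule frechet_derivative_cong_open[OF U(1) _ U(2)]) (rule comp[OF f1])
    then show ?thesis by (simp only: comp[OF f1' U(2)])
  qed
  have "Ck_on 2 U (\<lambda>y. f y \<bullet> b)"
    by (rule bounded_linear.Ck_on_compose[OF bounded_linear_inner_left U(1) f])
  from symmetric_second_derivative_real[OF this U, where v=v and w=w] *
  show "frechet_derivative (\<lambda>y. frechet_derivative f (at y) v) (at x) w \<bullet> b
      = frechet_derivative (\<lambda>y. frechet_derivative f (at y) w) (at x) v \<bullet> b" by simp
qed

section \<open>The Lie algebra and its representation\<close>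

lemma lin_trace_compose_commute:
  fixes f g :: "'l::euclidean_space \<Rightarrow> 'l"
  assumes "linear f" "linear g"
  shows "lin_trace (f \<circ> g) = lin_trace (g \<circ> f)"
proof -
  have expand: "lin_trace (h \<circ> k) = (\<Sum>b\<in>Basis. \<Sum>c\<in>Basis. (k b \<bullet> c) * (h c \<bullet> b))"
    if "linear h" for h k :: "'l \<Rightarrow> 'l"
  proof -
    have "h (k b) \<bullet> b = (\<Sum>c\<in>Basis. (k b \<bullet> c) * (h c \<bullet> b))" for b
    proof -
      have "h (k b) = h (\<Sum>c\<in>Basis. (k b \<bullet> c) *\<^sub>R c)" by (simp add: euclidean_representation)
      also have "\<dots> = (\<Sum>c\<in>Basis. (k b \<bullet> c) *\<^sub>R h c)"
        using that by (simp add: linear_sum linear_scale)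
      finally show ?thesis by (simp add: inner_sum_left)
    qed
    then show ?thesis by (simp add: lin_trace_def)
  qed
  show ?thesis
    unfolding expand[OF assms(1)] expand[OF assms(2)]
    by (subst sum.swap) (simp add: mult.commute)
qed

text \<open>What the flow uses of the structure group: the bracket is a bilinear Lie bracket for which the
  inner product is invariant, and the action is a skew representation of it.\<close>

locale lie_action =
  fixes br :: "'l::euclidean_space \<Rightarrow> 'l \<Rightarrow> 'l"
    and act :: "'l \<Rightarrow> 'v::euclidean_space \<Rightarrow> 'v"
  assumes bilinear_br: "bounded_bilinear br"
    and br_antisym: "br Y Z = - br Z Y"
    and jacobi: "br (br Y Z) V = br Y (br Z V) - br Z (br Y V)"
    and br_skew: "br Z Y \<bullet> V = - (Y \<bullet> br Z V)"
    and bilinear_act: "bounded_bilinear act"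
    and act_br: "act (br Y Z) v = act Y (act Z v) - act Z (act Y v)"
    and act_skew: "act Z v \<bullet> w = - (v \<bullet> act Z w)"

context
  fixes gmult :: "'g::{t2_space,second_countable_topology} \<Rightarrow> 'g \<Rightarrow> 'g"
    and \<A> :: "('g, 'm::euclidean_space) chart set"
    and L :: "'l::euclidean_space \<Rightarrow> ('g \<Rightarrow> real) \<Rightarrow> 'g \<Rightarrow> real"
    and br :: "'l \<Rightarrow> 'l \<Rightarrow> 'l"
  assumes alg: "is_lie_algebra_of gmult \<A> L br"
begin

lemma lie_field: "L Y \<in> left_invariant_fields gmult \<A>"
  using alg unfolding is_lie_algebra_of_def bij_betw_def by auto

text \<open>An element of the Lie algebra is determined by its derivation, so identities between elements are
  checked on smooth functions.\<close>

lemma lie_field_eqI: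
  assumes "\<And>f. smooth_map \<A> f \<Longrightarrow> L Y f = L Z f"
  shows "Y = Z"
proof -
  have "L Y = L Z"
  proof (rule extensionalityI)
    show "L Y \<in> extensional {f. smooth_map \<A> f}" "L Z \<in> extensional {f. smooth_map \<A> f}"
      using lie_field[of Y] lie_field[of Z] unfolding left_invariant_fields_def by blast+
  qed (simp add: assms)
  moreover have "inj L"
    using alg unfolding is_lie_algebra_of_def bij_betw_def by blast
  ultimately show ?thesis by (rule injD[rotated])
qed

lemma lie_field_smooth: "smooth_map \<A> f \<Longrightarrow> smooth_map \<A> (L Y f)"
  using lie_field[of Y] unfolding left_invariant_fields_def by blast

lemma lie_field_linear: "smooth_map \<A> f \<Longrightarrow> smooth_map \<A> h \<Longrightarrow>
    L Y (\<lambda>g. c * f g + d * h g) = (\<lambda>g. c * L Y f g + d * L Y h g)"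
  using lie_field[of Y] unfolding left_invariant_fields_def by blast

lemma lie_field_mult: "smooth_map \<A> f \<Longrightarrow> smooth_map \<A> h \<Longrightarrow>
    L Y (\<lambda>g. f g * h g) = (\<lambda>g. L Y f g * h g + f g * L Y h g)"
  using lie_field[of Y] unfolding left_invariant_fields_def by blast

lemma lie_field_translate: "smooth_map \<A> f \<Longrightarrow> L Y (\<lambda>g. f (gmult a g)) = (\<lambda>g. L Y f (gmult a g))"
  using lie_field[of Y] unfolding left_invariant_fields_def by blast

lemma lie_field_comb: "smooth_map \<A> f \<Longrightarrow> L (c *\<^sub>R Y + d *\<^sub>R Z) f = (\<lambda>g. c * L Y f g + d * L Z f g)"
  using alg unfolding is_lie_algebra_of_def by blast

lemma lie_field_br: "smooth_map \<A> f \<Longrightarrow> L (br Y Z) f = (\<lambda>g. L Y (L Z f) g - L Z (L Y f) g)"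
  using alg unfolding is_lie_algebra_of_def by blast

lemma lie_bracket_antisym: "br Y Z = - br Z Y"
proof -
  have "br Y Z = (-1) *\<^sub>R br Z Y + 0 *\<^sub>R 0"
    by (rule lie_field_eqI) (simp only: lie_field_comb, simp add: lie_field_br)
  then show ?thesis by simp
qed

lemma lie_bracket_comb: "br (c *\<^sub>R Y + d *\<^sub>R Z) V = c *\<^sub>R br Y V + d *\<^sub>R br Z V"
proof (rule lie_field_eqI)
  fix f :: "'g \<Rightarrow> real" assume f: "smooth_map \<A> f"
  have "L V (L (c *\<^sub>R Y + d *\<^sub>R Z) f) = (\<lambda>g. c * L V (L Y f) g + d * L V (L Z f) g)"
    using f by (simp add: lie_field_comb lie_field_linear lie_field_smooth)
  then show "L (br (c *\<^sub>R Y + d *\<^sub>R Z) V) f = L (c *\<^sub>R br Y V + d *\<^sub>R br Z V) f"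
    using f by (simp add: lie_field_br lie_field_comb lie_field_smooth algebra_simps)
qed

lemma lie_bracket_bilinear: "bounded_bilinear br"
proof -
  have l: "linear (\<lambda>Y. br Y Z)" for Z
  proof (rule linearI)
    show "br (x + y) Z = br x Z + br y Z" for x y using lie_bracket_comb[of 1 x 1 y Z] by simp
    show "br (c *\<^sub>R x) Z = c *\<^sub>R br x Z" for c x using lie_bracket_comb[of c x 0 x Z] by simp
  qed
  have r: "linear (\<lambda>Z. br Y Z)" for Y
    unfolding lie_bracket_antisym[of Y] using linear_compose_neg[OF l[of Y]] by simp
  show ?thesis
    unfolding bilinear_conv_bounded_bilinear[symmetric] bilinear_def using l r by blast
qed

lemma lie_bracket_jacobi: "br (br Y Z) V = br Y (br Z V) - br Z (br Y V)"
proof -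
  have "br (br Y Z) V = 1 *\<^sub>R br Y (br Z V) + (-1) *\<^sub>R br Z (br Y V)"
  proof (rule lie_field_eqI)
    fix f :: "'g \<Rightarrow> real" assume f: "smooth_map \<A> f"
    have diff: "L X (\<lambda>g. h g - k g) = (\<lambda>g. L X h g - L X k g)"
      if "smooth_map \<A> h" "smooth_map \<A> k" for X and h k :: "'g \<Rightarrow> real"
      using lie_field_linear[OF that, of X 1 "-1"] by simp
    show "L (br (br Y Z) V) f = L (1 *\<^sub>R br Y (br Z V) + (-1) *\<^sub>R br Z (br Y V)) f"
      using f by (simp only: lie_field_comb) (simp add: lie_field_br diff lie_field_smooth algebra_simps)
  qed
  then show ?thesis by simp
qed

text \<open>\<open>ad\<close> is a Lie algebra homomorphism and the trace is cyclic.\<close>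

lemma killing_form_invariant:
  "killing_form br (br Z Y) V = - killing_form br Y (br Z V)"
proof -
  have lin: "linear (br Y)" for Y
    using lie_bracket_bilinear unfolding bilinear_conv_bounded_bilinear[symmetric] bilinear_def by blast
  have tr_diff: "lin_trace (\<lambda>x. f x - g x) = lin_trace f - lin_trace g" for f g :: "'l \<Rightarrow> 'l"
    by (simp add: lin_trace_def inner_diff_left sum_subtractf)
  have "killing_form br (br Z Y) V = lin_trace (br Z \<circ> (br Y \<circ> br V)) - lin_trace (br Y \<circ> (br Z \<circ> br V))"
    unfolding killing_form_def by (simp add: tr_diff[symmetric] comp_def lie_bracket_jacobi)
  moreover have "killing_form br Y (br Z V)
      = lin_trace (br Y \<circ> (br Z \<circ> br V)) - lin_trace ((br Y \<circ> br V) \<circ> br Z)"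
    unfolding killing_form_def
    by (simp add: tr_diff[symmetric] comp_def lie_bracket_jacobi[of Z V] linear_diff[OF lin])
  moreover have "lin_trace ((br Y \<circ> br V) \<circ> br Z) = lin_trace (br Z \<circ> (br Y \<circ> br V))"
    by (rule lin_trace_compose_commute) (simp_all add: lin linear_compose)
  ultimately show ?thesis by simp
qed

text \<open>A derivation kills constants; applied to the matrix coefficients of \<open>\<rho>\<close>, the derivation laws
  become the rules for the derived action. Left invariance turns differentiation at \<open>g\<close> into
  differentiation at the identity, which gives the representation property.\<close>

lemma derived_action_lie_action:
  fixes gunit :: 'g and ginv and \<rho> :: "'g \<Rightarrow> 'v::euclidean_space \<Rightarrow>\<^sub>L 'v"
  assumes G: "lie_group gmult gunit ginv \<A>"
    and rep: "orthogonal_representation gmult gunit \<A> \<rho>"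
    and ip: "\<And>Y Z. Y \<bullet> Z = - killing_form br Y Z"
  shows "lie_action br (derived_action L gunit \<rho>)"
proof -
  interpret lie_group gmult gunit ginv \<A> by (rule G)
  let ?act = "derived_action L gunit \<rho>"
  have unit: "blinfun_apply (\<rho> gunit) v = v" for v
    using rep unfolding orthogonal_representation_def by simp
  have hom: "blinfun_apply (\<rho> (gmult g h)) v = blinfun_apply (\<rho> g) (blinfun_apply (\<rho> h) v)" for g h v
    using rep unfolding orthogonal_representation_def by simp
  have orth: "blinfun_apply (\<rho> g) v \<bullet> blinfun_apply (\<rho> g) w = v \<bullet> w" for g v w
    using rep unfolding orthogonal_representation_def by blast
  define coe where "coe v w g = blinfun_apply (\<rho> g) v \<bullet> w" for v w g
  have coe_smooth: "smooth_map \<A> (coe v w)" for v w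
  proof -
    have bl: "bounded_linear (\<lambda>B :: 'v \<Rightarrow>\<^sub>L 'v. blinfun_apply B v \<bullet> w)"
      using bounded_linear_compose[OF bounded_linear_inner_left blinfun.bounded_linear_left] .
    show ?thesis
      using rep bounded_linear.smooth_on_compose[OF bl]
      unfolding orthogonal_representation_def smooth_map_def coe_def comp_def by fast
  qed
  have sm_mult: "smooth_map \<A> (\<lambda>g. f g * h g)" if "smooth_map \<A> f" "smooth_map \<A> h"
    for f h :: "'g \<Rightarrow> real"
    using that smooth_on_mult unfolding smooth_map_def comp_def by fast
  have sm_add: "smooth_map \<A> (\<lambda>g. f g + h g)" if "smooth_map \<A> f" "smooth_map \<A> h"
    for f h :: "'g \<Rightarrow> real"
    using that smooth_on_add unfolding smooth_map_def comp_def by fast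
  have sm_const: "smooth_map \<A> (\<lambda>g. c)" for c :: real
    unfolding smooth_map_def comp_def by (simp add: smooth_on_const split_beta)
  have L_const: "L Z (\<lambda>g. c) = (\<lambda>g. 0)" for Z c
  proof -
    have "L Z (\<lambda>g. 1 * 1) = (\<lambda>g. L Z (\<lambda>g. 1) g * 1 + 1 * L Z (\<lambda>g. 1) g)"
      by (rule lie_field_mult) (rule sm_const)+
    then have one: "L Z (\<lambda>g. 1) = (\<lambda>g. 0)" by (auto simp: fun_eq_iff)
    have "L Z (\<lambda>g. c * 1 + 0 * 1) = (\<lambda>g. c * L Z (\<lambda>g. 1) g + 0 * L Z (\<lambda>g. 1) g)"
      by (rule lie_field_linear) (rule sm_const)+
    then show ?thesis by (simp add: one)
  qed
  have L_add: "L Z (\<lambda>g. f g + h g) = (\<lambda>g. L Z f g + L Z h g)"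
    if "smooth_map \<A> f" "smooth_map \<A> h" for Z f h
    using lie_field_linear[OF that, of Z 1 1] by simp
  have L_sum: "L Z (\<lambda>g. \<Sum>b\<in>I. f b g) = (\<lambda>g. \<Sum>b\<in>I. L Z (f b) g) \<and> smooth_map \<A> (\<lambda>g. \<Sum>b\<in>I. f b g)"
    if "finite I" "\<And>b. smooth_map \<A> (f b)" for Z f and I :: "'v set"
    using that(1) by induction (simp_all add: L_const L_add sm_const sm_add that(2))
  have act_coe: "?act Z v \<bullet> b = L Z (coe v b) gunit" if "b \<in> Basis" for Z v b
    using that unfolding derived_action_def coe_def
    by (simp add: inner_sum_left inner_Basis if_distrib sum.delta cong: if_cong)
  have act_coe': "L Z (coe v w) gunit = ?act Z v \<bullet> w" for Z v w
  proof -
    have "coe v w = (\<lambda>g. \<Sum>b\<in>Basis. (w \<bullet> b) * coe v b g + 0 * coe v b g)"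
      unfolding coe_def by (simp add: euclidean_inner[of _ w] mult.commute)
    then have "L Z (coe v w) gunit = (\<Sum>b\<in>Basis. L Z (\<lambda>g. (w \<bullet> b) * coe v b g + 0 * coe v b g) gunit)"
      using L_sum[of Basis "\<lambda>b g. (w \<bullet> b) * coe v b g + 0 * coe v b g" Z]
      by (simp add: sm_mult sm_const coe_smooth)
    also have "\<dots> = (\<Sum>b\<in>Basis. (w \<bullet> b) * (?act Z v \<bullet> b))"
      by (intro sum.cong refl, subst lie_field_linear) (simp_all add: coe_smooth act_coe)
    also have "\<dots> = ?act Z v \<bullet> w" by (simp add: euclidean_inner[of _ w] mult.commute)
    finally show ?thesis .
  qed
  have linl: "?act (c *\<^sub>R Y + d *\<^sub>R Z) v = c *\<^sub>R ?act Y v + d *\<^sub>R ?act Z v" for c d Y Z v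
    by (rule euclidean_eqI) (simp add: inner_add_left act_coe lie_field_comb coe_smooth)
  have linr: "?act Z (c *\<^sub>R v + d *\<^sub>R w) = c *\<^sub>R ?act Z v + d *\<^sub>R ?act Z w" for c d Z v w
  proof (rule euclidean_eqI)
    fix b :: 'v assume b: "b \<in> Basis"
    have "coe (c *\<^sub>R v + d *\<^sub>R w) b = (\<lambda>g. c * coe v b g + d * coe w b g)"
      unfolding coe_def by (simp add: blinfun.bilinear_simps inner_add_left)
    then show "?act Z (c *\<^sub>R v + d *\<^sub>R w) \<bullet> b = (c *\<^sub>R ?act Z v + d *\<^sub>R ?act Z w) \<bullet> b"
      using b by (simp add: inner_add_left act_coe lie_field_linear coe_smooth)
  qed
  have "linear (\<lambda>Z. ?act Z v)" for v
  proof (rule linearI)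
    show "?act (x + y) v = ?act x v + ?act y v" for x y using linl[of 1 x 1 y v] by simp
    show "?act (c *\<^sub>R x) v = c *\<^sub>R ?act x v" for c x using linl[of c x 0 x v] by simp
  qed
  moreover have linr': "linear (?act Z)" for Z
  proof (rule linearI)
    show "?act Z (x + y) = ?act Z x + ?act Z y" for x y using linr[of Z 1 x 1 y] by simp
    show "?act Z (c *\<^sub>R x) = c *\<^sub>R ?act Z x" for c x using linr[of Z c x 0 x] by simp
  qed
  ultimately have bil: "bounded_bilinear ?act"
    unfolding bilinear_conv_bounded_bilinear[symmetric] bilinear_def by blast
  have skew: "?act Z v \<bullet> w = - (v \<bullet> ?act Z w)" for Z v w
  proof -
    have prod: "smooth_map \<A> (\<lambda>g. coe v b g * coe w b g)" for b
      by (simp add: sm_mult coe_smooth)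
    have "(\<lambda>g. \<Sum>b\<in>Basis. coe v b g * coe w b g) = (\<lambda>g. v \<bullet> w)"
      unfolding coe_def using orth by (simp add: euclidean_inner[symmetric])
    then have "(\<lambda>g. \<Sum>b\<in>Basis. L Z (\<lambda>g. coe v b g * coe w b g) g) = (\<lambda>g. 0)"
      using L_sum[of Basis "\<lambda>b g. coe v b g * coe w b g" Z] prod L_const[of Z "v \<bullet> w"] by simp
    then have "(\<Sum>b\<in>Basis. L Z (\<lambda>g. coe v b g * coe w b g) gunit) = 0"
      by (rule fun_cong)
    moreover have "L Z (\<lambda>g. coe v b g * coe w b g) gunit
        = (?act Z v \<bullet> b) * (w \<bullet> b) + (v \<bullet> b) * (?act Z w \<bullet> b)" for b
      by (simp add: lie_field_mult coe_smooth act_coe') (simp add: coe_def unit)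
    ultimately have "(\<Sum>b\<in>Basis. (?act Z v \<bullet> b) * (w \<bullet> b)) + (\<Sum>b\<in>Basis. (v \<bullet> b) * (?act Z w \<bullet> b)) = 0"
      by (simp add: sum.distrib)
    then show ?thesis
      unfolding euclidean_inner[of "?act Z v" w, symmetric] euclidean_inner[of v "?act Z w", symmetric]
      by simp
  qed
  have L_coe: "L Z (coe v w) = coe (?act Z v) w" for Z v w
  proof
    fix g
    obtain w' where w': "\<And>h. coe v w (gmult g h) = coe v w' h" "\<And>v. blinfun_apply (\<rho> g) v \<bullet> w = v \<bullet> w'"
    proof
      have ad: "blinfun_apply (\<rho> g) x \<bullet> w = x \<bullet> adjoint (blinfun_apply (\<rho> g)) w" for x
        using adjoint_works[OF bounded_linear.linear[OF blinfun.bounded_linear_right[of "\<rho> g"]]]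
        by simp
      then show "coe v w (gmult g h) = coe v (adjoint (blinfun_apply (\<rho> g)) w) h" for h
        unfolding coe_def hom by simp
      show "blinfun_apply (\<rho> g) x \<bullet> w = x \<bullet> adjoint (blinfun_apply (\<rho> g)) w" for x by (rule ad)
    qed
    have "gmult g gunit = g" by simp
    then have "L Z (coe v w) g = L Z (\<lambda>h. coe v w (gmult g h)) gunit"
      by (simp add: lie_field_translate coe_smooth)
    also have "\<dots> = ?act Z v \<bullet> w'" by (simp add: w'(1) act_coe')
    finally show "L Z (coe v w) g = coe (?act Z v) w g" by (simp add: coe_def w'(2))
  qed
  have rep_br: "?act (br Y Z) v = ?act Y (?act Z v) - ?act Z (?act Y v)" for Y Z v
    by (rule euclidean_eqI)
      (simp add: inner_diff_left act_coe'[symmetric] lie_field_br coe_smooth, simp add: L_coe)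
  show ?thesis
    by (rule lie_action.intro)
      (rule lie_bracket_bilinear lie_bracket_antisym lie_bracket_jacobi bil rep_br skew
        | simp add: ip killing_form_invariant)+
qed

end

context lie_action
begin

text \<open>Riesz representation turns the description of \<open>\<odot>\<close> into its defining property.\<close>

lemma odot: "Z \<bullet> odot act v w = act Z v \<bullet> w"
proof -
  interpret A: bounded_bilinear act by (rule bilinear_act)
  let ?Y = "\<Sum>b\<in>Basis. (act b v \<bullet> w) *\<^sub>R b"
  have *: "Z \<bullet> ?Y = act Z v \<bullet> w" for Z
  proof -
    have "act Z v = act (\<Sum>b\<in>Basis. (Z \<bullet> b) *\<^sub>R b) v" by (simp add: euclidean_representation)
    also have "\<dots> = (\<Sum>b\<in>Basis. (Z \<bullet> b) *\<^sub>R act b v)" by (simp add: A.sum_left A.scaleR_left)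
    finally show ?thesis by (simp add: inner_sum_left inner_sum_right mult.commute)
  qed
  have "odot act v w = ?Y"
    unfolding odot_def
  proof (rule the_equality)
    fix Y assume "\<forall>Z. Z \<bullet> Y = act Z v \<bullet> w"
    then have "Z \<bullet> Y = Z \<bullet> ?Y" for Z using *[of Z] by metis
    then show "Y = ?Y" using vector_eq_ldot[of Y ?Y] by blast
  qed (intro allI *)
  with * show ?thesis by simp
qed

end

section \<open>The flow on space-time\<close>

text \<open>Space and time directions are treated alike, the direction \<open>None\<close> being time. The connection
  is extended by \<open>A\<^sub>t = 0\<close>, so that \<open>\<partial>\<^sub>t A\<^sub>j\<close> and \<open>\<partial>\<^sub>t u\<close> become the curvature \<open>F\<^sub>t\<^sub>j\<close> and the covariant
  derivative \<open>D\<^sub>t u\<close>, and the variation of the energy in time and in space follows from the same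
  Bianchi and Ricci identities.\<close>

fun dir :: "'n option \<Rightarrow> (real^'n::finite) \<times> real" where
  "dir None = (0, 1)"
| "dir (Some i) = (axis i 1, 0)"

definition pdir :: "'n option \<Rightarrow> ((real^'n::finite) \<times> real \<Rightarrow> 'b::real_normed_vector)
    \<Rightarrow> (real^'n) \<times> real \<Rightarrow> 'b" where
  "pdir \<alpha> f z = frechet_derivative f (at z) (dir \<alpha>)"

locale ymh_flow = lie_action br act
  for br :: "'l::euclidean_space \<Rightarrow> 'l \<Rightarrow> 'l"
    and act :: "'l \<Rightarrow> 'v::euclidean_space \<Rightarrow> 'v" +
  fixes W :: "real \<Rightarrow> real" and a b :: real
    and A :: "real \<Rightarrow> ('n::finite, 'l) gauge_field"
    and u :: "real \<Rightarrow> ('n, 'v) scalar_field"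
  assumes smooth: "smooth_family a b A u"
    and flow: "YMH_flow br act W a b A u"
    and W_C1: "W C1_differentiable_on UNIV"
    and W_nonneg: "W s \<ge> 0"
begin

interpretation B: bounded_bilinear br by (rule bilinear_br)
interpretation V: bounded_bilinear act by (rule bilinear_act)

definition spacetime :: "((real^'n) \<times> real) set" where "spacetime = UNIV \<times> {a<..<b}"

definition conn :: "'n option \<Rightarrow> (real^'n) \<times> real \<Rightarrow> 'l" where
  "conn \<alpha> z = (case \<alpha> of None \<Rightarrow> 0 | Some i \<Rightarrow> A (snd z) i (fst z))"

definition field :: "(real^'n) \<times> real \<Rightarrow> 'v" where "field z = u (snd z) (fst z)"

definition F :: "'n option \<Rightarrow> 'n option \<Rightarrow> (real^'n) \<times> real \<Rightarrow> 'l" where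
  "F \<alpha> \<beta> z = pdir \<alpha> (conn \<beta>) z - pdir \<beta> (conn \<alpha>) z + br (conn \<alpha> z) (conn \<beta> z)"

definition adcov :: "'n option \<Rightarrow> ((real^'n) \<times> real \<Rightarrow> 'l) \<Rightarrow> (real^'n) \<times> real \<Rightarrow> 'l" where
  "adcov \<alpha> Z z = pdir \<alpha> Z z + br (conn \<alpha> z) (Z z)"

definition cov :: "'n option \<Rightarrow> ((real^'n) \<times> real \<Rightarrow> 'v) \<Rightarrow> (real^'n) \<times> real \<Rightarrow> 'v" where
  "cov \<alpha> v z = pdir \<alpha> v z + act (conn \<alpha> z) (v z)"

abbreviation Du :: "'n option \<Rightarrow> (real^'n) \<times> real \<Rightarrow> 'v" where "Du \<alpha> \<equiv> cov \<alpha> field"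

lemma open_spacetime: "open spacetime"
  unfolding spacetime_def by (intro open_Times) auto

subsection \<open>Differentiation on space-time\<close>

lemma has_derivative_pdir:
  "Ck_on 1 spacetime f \<Longrightarrow> z \<in> spacetime \<Longrightarrow> (f has_derivative frechet_derivative f (at z)) (at z)"
  by (rule Ck_on_has_derivative[of 0 spacetime]) auto

lemma pdir_eq: "(f has_derivative f') (at z) \<Longrightarrow> pdir \<alpha> f z = f' (dir \<alpha>)"
  unfolding pdir_def by (simp add: frechet_derivative_at[symmetric])

lemma pdir_add: "Ck_on 1 spacetime f \<Longrightarrow> Ck_on 1 spacetime g \<Longrightarrow> z \<in> spacetime \<Longrightarrow>
    pdir \<alpha> (\<lambda>z. f z + g z) z = pdir \<alpha> f z + pdir \<alpha> g z"
  using pdir_eq[OF has_derivative_add[OF has_derivative_pdir has_derivative_pdir]]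
  by (simp add: pdir_def)

lemma pdir_diff: "Ck_on 1 spacetime f \<Longrightarrow> Ck_on 1 spacetime g \<Longrightarrow> z \<in> spacetime \<Longrightarrow>
    pdir \<alpha> (\<lambda>z. f z - g z) z = pdir \<alpha> f z - pdir \<alpha> g z"
  using pdir_eq[OF has_derivative_diff[OF has_derivative_pdir has_derivative_pdir]]
  by (simp add: pdir_def)

lemma pdir_minus: "Ck_on 1 spacetime f \<Longrightarrow> z \<in> spacetime \<Longrightarrow> pdir \<alpha> (\<lambda>z. - f z) z = - pdir \<alpha> f z"
  using pdir_eq[OF has_derivative_minus[OF has_derivative_pdir]] by (simp add: pdir_def)

lemma pdir_sum: "(\<And>i. i \<in> I \<Longrightarrow> Ck_on 1 spacetime (f i)) \<Longrightarrow> z \<in> spacetime \<Longrightarrow>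
    pdir \<alpha> (\<lambda>z. \<Sum>i\<in>I. f i z) z = (\<Sum>i\<in>I. pdir \<alpha> (f i) z)"
  using pdir_eq[OF has_derivative_sum[of I f "\<lambda>i. frechet_derivative (f i) (at z)" "at z"]]
    has_derivative_pdir[of "f _" z] by (simp add: pdir_def)

lemma pdir_bilinear:
  assumes "bounded_bilinear p" "Ck_on 1 spacetime f" "Ck_on 1 spacetime g" "z \<in> spacetime"
  shows "pdir \<alpha> (\<lambda>z. p (f z) (g z)) z = p (f z) (pdir \<alpha> g z) + p (pdir \<alpha> f z) (g z)"
  using pdir_eq[OF bounded_bilinear.FDERIV[OF assms(1) has_derivative_pdir has_derivative_pdir]] assms
  by (simp add: pdir_def)

lemmas pdir_mult = pdir_bilinear[OF bounded_bilinear_mult]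
lemmas pdir_inner = pdir_bilinear[OF bounded_bilinear_inner]

lemma pdir_commute:
  fixes f :: "(real^'n) \<times> real \<Rightarrow> 'b::euclidean_space"
  shows "Ck_on 2 spacetime f \<Longrightarrow> z \<in> spacetime \<Longrightarrow> pdir \<alpha> (pdir \<beta> f) z = pdir \<beta> (pdir \<alpha> f) z"
  unfolding pdir_def by (rule symmetric_second_derivative[OF _ open_spacetime])

lemma Ck_on_pdir: "Ck_on (Suc k) spacetime f \<Longrightarrow> Ck_on k spacetime (pdir \<alpha> f)"
  unfolding pdir_def[abs_def] by (rule Ck_on_deriv)

lemma Ck_on_minus: "Ck_on k spacetime f \<Longrightarrow> Ck_on k spacetime (\<lambda>z. - f z)"
  using bounded_linear.Ck_on_compose[OF bounded_linear_minus[OF bounded_linear_ident] open_spacetime] .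

lemma Ck_on_diff: "Ck_on k spacetime f \<Longrightarrow> Ck_on k spacetime g \<Longrightarrow> Ck_on k spacetime (\<lambda>z. f z - g z)"
  using Ck_on_add[OF open_spacetime, of k f "\<lambda>z. - g z"] Ck_on_minus[of k g] by simp

lemma pd_slice:
  assumes "Ck_on 1 spacetime f" "(x, t) \<in> spacetime"
  shows "pd i (\<lambda>x. f (x, t)) x = pdir (Some i) f (x, t)"
proof -
  have "((\<lambda>x. (x, t)) has_derivative (\<lambda>h. (h, 0))) (at x)"
    by (auto intro!: derivative_eq_intros)
  from has_derivative_compose[OF this has_derivative_pdir[OF assms]]
  show ?thesis unfolding pd_def pdir_def by (simp add: frechet_derivative_at[symmetric])
qed

lemma vector_derivative_slice:
  assumes "Ck_on 1 spacetime f" "(x, t) \<in> spacetime"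
  shows "((\<lambda>s. f (x, s)) has_vector_derivative pdir None f (x, t)) (at t)"
proof -
  have "(Pair x has_vector_derivative (0, 1)) (at t)"
    unfolding has_vector_derivative_def by (auto intro!: derivative_eq_intros)
  from vector_diff_chain_at_derivative[OF this has_derivative_pdir[OF assms]]
  show ?thesis by (simp add: pdir_def o_def)
qed

subsection \<open>Smoothness of the geometric quantities\<close>

lemma Ck_on_conn: "Ck_on k spacetime (conn \<alpha>)"
proof (cases \<alpha>)
  case None
  then show ?thesis unfolding conn_def by (simp add: Ck_on_const open_spacetime)
next
  case (Some i)
  have "smooth_on (UNIV \<times> {a..<b}) (\<lambda>(x, t). A t i x)"
    using smooth unfolding smooth_family_def by blast
  then have "Ck_on k spacetime (\<lambda>(x, t). A t i x)"
    by (rule smooth_on_open_imp_Ck_on[OF _ open_spacetime]) (auto simp: spacetime_def)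
  then show ?thesis by (simp add: Some conn_def[abs_def] case_prod_beta')
qed

lemma Ck_on_field: "Ck_on k spacetime field"
proof -
  have "smooth_on (UNIV \<times> {a..<b}) (\<lambda>(x, t). u t x)"
    using smooth unfolding smooth_family_def by blast
  then have "Ck_on k spacetime (\<lambda>(x, t). u t x)"
    by (rule smooth_on_open_imp_Ck_on[OF _ open_spacetime]) (auto simp: spacetime_def)
  then show ?thesis by (simp add: field_def[abs_def] case_prod_beta')
qed

lemma Ck_on_F: "Ck_on k spacetime (F \<alpha> \<beta>)"
  unfolding F_def[abs_def]
  by (intro Ck_on_add Ck_on_diff Ck_on_pdir Ck_on_conn B.Ck_on_compose open_spacetime)

lemma Ck_on_cov: "Ck_on (Suc k) spacetime v \<Longrightarrow> Ck_on k spacetime (cov \<alpha> v)"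
  unfolding cov_def[abs_def]
  by (intro Ck_on_add Ck_on_pdir Ck_on_conn V.Ck_on_compose open_spacetime Ck_on_SucD[of k spacetime v])

lemma Ck_on_Du: "Ck_on k spacetime (Du \<alpha>)"
  by (intro Ck_on_cov Ck_on_field)

lemma curv_eq: "(x, t) \<in> spacetime \<Longrightarrow> curv br (A t) i j x = F (Some i) (Some j) (x, t)"
  using pd_slice[OF Ck_on_conn[of 1 "Some i"], of x t j] pd_slice[OF Ck_on_conn[of 1 "Some j"], of x t i]
  by (simp add: curv_def F_def conn_def)

lemma covD_eq: "(x, t) \<in> spacetime \<Longrightarrow> covD act (A t) i (u t) x = Du (Some i) (x, t)"
  using pd_slice[OF Ck_on_field, of x t i] by (simp add: covD_def cov_def conn_def field_def)

lemma conn_None: "conn None = (\<lambda>z. 0)"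
  by (simp add: conn_def[abs_def])

lemma pdir_zero: "pdir \<alpha> (\<lambda>z. 0) z = 0"
  using pdir_eq[OF has_derivative_const] .

lemma dt_A_eq: "(x, t) \<in> spacetime \<Longrightarrow> vector_derivative (\<lambda>s. A s j x) (at t) = F None (Some j) (x, t)"
  using vector_derivative_slice[OF Ck_on_conn[of 1 "Some j"], of x t]
  by (simp add: F_def conn_None pdir_zero B.zero_left)
    (simp add: conn_def vector_derivative_at)

lemma dt_u_eq: "(x, t) \<in> spacetime \<Longrightarrow> vector_derivative (\<lambda>s. u s x) (at t) = Du None (x, t)"
  using vector_derivative_slice[OF Ck_on_field, of x t]
  by (simp add: cov_def conn_None V.zero_left) (simp add: field_def vector_derivative_at)

lemma flow_A:
  assumes "z \<in> spacetime"
  shows "(\<Sum>i\<in>UNIV. adcov (Some i) (F (Some i) (Some j)) z)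
       = F None (Some j) z + odot act (field z) (Du (Some j) z)"
proof -
  obtain x t where z: "z = (x, t)" by (cases z)
  have xt: "(x', t) \<in> spacetime" for x' using assms z by (auto simp: spacetime_def)
  have "nabla br (A t) i (curv br (A t) i j) x = adcov (Some i) (F (Some i) (Some j)) z" for i
  proof -
    have "curv br (A t) i j = (\<lambda>x. F (Some i) (Some j) (x, t))" using curv_eq[OF xt] by blast
    then show ?thesis
      using pd_slice[OF Ck_on_F[of 1 "Some i" "Some j"] xt, of i x]
      by (simp add: nabla_def adcov_def z conn_def)
  qed
  moreover have "vector_derivative (\<lambda>s. A s j x) (at t) =
      (\<Sum>i\<in>UNIV. nabla br (A t) i (curv br (A t) i j) x) - odot act (u t x) (covD act (A t) j (u t) x)"
    using flow assms z unfolding YMH_flow_def spacetime_def by blast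
  ultimately show ?thesis using dt_A_eq[OF xt, of j x] covD_eq[OF xt, of j x] by (simp add: z field_def)
qed

lemma flow_u:
  assumes "z \<in> spacetime"
  shows "(\<Sum>i\<in>UNIV. cov (Some i) (Du (Some i)) z)
       = Du None z + (2 * deriv W ((norm (field z))\<^sup>2)) *\<^sub>R field z"
proof -
  obtain x t where z: "z = (x, t)" by (cases z)
  have xt: "(x', t) \<in> spacetime" for x' using assms z by (auto simp: spacetime_def)
  have "covD act (A t) i (covD act (A t) i (u t)) x = cov (Some i) (Du (Some i)) z" for i
  proof -
    have "covD act (A t) i (u t) = (\<lambda>x. Du (Some i) (x, t))" using covD_eq[OF xt] by blast
    then show ?thesis
      using pd_slice[OF Ck_on_Du[of 1 "Some i"] xt, of i x]
      by (simp add: covD_def cov_def z conn_def)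
  qed
  moreover have "vector_derivative (\<lambda>s. u s x) (at t) =
      (\<Sum>i\<in>UNIV. covD act (A t) i (covD act (A t) i (u t)) x) - (2 * deriv W ((norm (u t x))\<^sup>2)) *\<^sub>R u t x"
    using flow assms z unfolding YMH_flow_def spacetime_def by blast
  ultimately show ?thesis using dt_u_eq[OF xt, of x] by (simp add: z field_def)
qed

subsection \<open>Bianchi and Ricci identities\<close>

lemma F_antisym: "F \<alpha> \<beta> z = - F \<beta> \<alpha> z"
  using br_antisym[of "conn \<alpha> z" "conn \<beta> z"] by (simp add: F_def)

lemma adcov_antisym: "z \<in> spacetime \<Longrightarrow> adcov \<gamma> (F \<alpha> \<beta>) z = - adcov \<gamma> (F \<beta> \<alpha>) z"
proof -
  assume z: "z \<in> spacetime"
  have "F \<alpha> \<beta> = (\<lambda>z. - F \<beta> \<alpha> z)" using F_antisym by blast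
  then show ?thesis
    by (simp add: adcov_def pdir_minus[OF Ck_on_F z] B.minus_right)
qed

text \<open>In the cyclic sum second derivatives cancel by symmetry, brackets with one derivative cancel in
  pairs by antisymmetry, and the triple brackets by the Jacobi identity.\<close>

lemma bianchi:
  assumes z: "z \<in> spacetime"
  shows "adcov \<alpha> (F \<beta> \<gamma>) z + adcov \<beta> (F \<gamma> \<alpha>) z + adcov \<gamma> (F \<alpha> \<beta>) z = 0"
proof -
  have expand: "adcov \<alpha> (F \<beta> \<gamma>) z = pdir \<alpha> (pdir \<beta> (conn \<gamma>)) z - pdir \<alpha> (pdir \<gamma> (conn \<beta>)) z
      - br (conn \<gamma> z) (pdir \<alpha> (conn \<beta>) z) + br (conn \<beta> z) (pdir \<alpha> (conn \<gamma>) z)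
      + br (conn \<alpha> z) (pdir \<beta> (conn \<gamma>) z) - br (conn \<alpha> z) (pdir \<gamma> (conn \<beta>) z)
      + br (conn \<alpha> z) (br (conn \<beta> z) (conn \<gamma> z))" for \<alpha> \<beta> \<gamma>
  proof -
    have "pdir \<alpha> (F \<beta> \<gamma>) z = pdir \<alpha> (pdir \<beta> (conn \<gamma>)) z - pdir \<alpha> (pdir \<gamma> (conn \<beta>)) z
        + (br (conn \<beta> z) (pdir \<alpha> (conn \<gamma>) z) + br (pdir \<alpha> (conn \<beta>) z) (conn \<gamma> z))"
      unfolding F_def[abs_def]
      by (subst pdir_add pdir_diff pdir_bilinear[OF bilinear_br] |
          intro Ck_on_diff Ck_on_pdir Ck_on_conn B.Ck_on_compose open_spacetime z refl)+
    moreover have "br (pdir \<alpha> (conn \<beta>) z) (conn \<gamma> z) = - br (conn \<gamma> z) (pdir \<alpha> (conn \<beta>) z)"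
      by (rule br_antisym)
    ultimately show ?thesis
      by (simp add: adcov_def F_def B.add_right B.diff_right)
  qed
  have "br (conn \<gamma> z) (br (conn \<alpha> z) (conn \<beta> z)) = - br (br (conn \<alpha> z) (conn \<beta> z)) (conn \<gamma> z)"
    by (rule br_antisym)
  also have "\<dots> = - br (conn \<alpha> z) (br (conn \<beta> z) (conn \<gamma> z)) + br (conn \<beta> z) (br (conn \<alpha> z) (conn \<gamma> z))"
    by (simp add: jacobi)
  also have "br (conn \<alpha> z) (conn \<gamma> z) = - br (conn \<gamma> z) (conn \<alpha> z)" by (rule br_antisym)
  finally show ?thesis
    using pdir_commute[OF Ck_on_conn z, of \<alpha> \<beta> \<gamma>] pdir_commute[OF Ck_on_conn z, of \<alpha> \<gamma> \<beta>]
      pdir_commute[OF Ck_on_conn z, of \<beta> \<gamma> \<alpha>]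
    by (simp add: expand B.minus_right)
qed

lemma ricci:
  assumes z: "z \<in> spacetime"
  shows "cov \<alpha> (Du \<beta>) z = cov \<beta> (Du \<alpha>) z + act (F \<alpha> \<beta> z) (field z)"
proof -
  have expand: "cov \<alpha> (Du \<beta>) z = pdir \<alpha> (pdir \<beta> field) z + act (conn \<beta> z) (pdir \<alpha> field z)
      + act (pdir \<alpha> (conn \<beta>) z) (field z) + act (conn \<alpha> z) (pdir \<beta> field z)
      + act (conn \<alpha> z) (act (conn \<beta> z) (field z))" for \<alpha> \<beta>
  proof -
    have "pdir \<alpha> (Du \<beta>) z = pdir \<alpha> (pdir \<beta> field) z
        + (act (conn \<beta> z) (pdir \<alpha> field z) + act (pdir \<alpha> (conn \<beta>) z) (field z))"
      unfolding cov_def[abs_def]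
      by (subst pdir_add pdir_bilinear[OF bilinear_act] |
          intro Ck_on_pdir Ck_on_conn Ck_on_field V.Ck_on_compose open_spacetime z refl)+
    then show ?thesis by (simp add: cov_def[of \<alpha>] V.add_right) (simp add: cov_def V.add_right)
  qed
  show ?thesis
    using pdir_commute[OF Ck_on_field z, of \<alpha> \<beta>]
    by (simp add: expand) (simp add: F_def act_br V.add_left V.diff_left)
qed

lemma pdir_inner_adcov:
  assumes "Ck_on 1 spacetime Y" "Ck_on 1 spacetime Z" "z \<in> spacetime"
  shows "pdir \<alpha> (\<lambda>z. Y z \<bullet> Z z) z = adcov \<alpha> Y z \<bullet> Z z + Y z \<bullet> adcov \<alpha> Z z"
  using br_skew[of "conn \<alpha> z" "Y z" "Z z"]
  by (simp add: pdir_inner[OF assms] adcov_def inner_add_left inner_add_right)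

lemma pdir_inner_cov:
  assumes "Ck_on 1 spacetime v" "Ck_on 1 spacetime w" "z \<in> spacetime"
  shows "pdir \<alpha> (\<lambda>z. v z \<bullet> w z) z = cov \<alpha> v z \<bullet> w z + v z \<bullet> cov \<alpha> w z"
  using act_skew[of "conn \<alpha> z" "v z" "w z"]
  by (simp add: pdir_inner[OF assms] cov_def inner_add_left inner_add_right)

end

context ymh_flow
begin

interpretation B: bounded_bilinear br by (rule bilinear_br)
interpretation V: bounded_bilinear act by (rule bilinear_act)

subsection \<open>The energy and its stress tensor\<close>

definition edens :: "(real^'n) \<times> real \<Rightarrow> real" where
  "edens z = (\<Sum>i\<in>UNIV. \<Sum>j\<in>UNIV. F (Some i) (Some j) z \<bullet> F (Some i) (Some j) z) / 4
     + (\<Sum>i\<in>UNIV. Du (Some i) z \<bullet> Du (Some i) z) / 2 + W (field z \<bullet> field z)"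

definition stress :: "'n \<Rightarrow> 'n option \<Rightarrow> (real^'n) \<times> real \<Rightarrow> real" where
  "stress i \<alpha> z = (\<Sum>j\<in>UNIV. F (Some i) (Some j) z \<bullet> F \<alpha> (Some j) z) + Du (Some i) z \<bullet> Du \<alpha> z"

lemma W_has_derivative: "(W has_real_derivative deriv W s) (at s)"
  and continuous_deriv_W: "continuous_on UNIV (deriv W)"
proof -
  obtain D where D: "\<And>s. (W has_vector_derivative D s) (at s)" "continuous_on UNIV D"
    using W_C1 unfolding C1_differentiable_on_def by auto
  have D': "(W has_real_derivative D s) (at s)" for s
    using D(1) by (simp add: has_real_derivative_iff_has_vector_derivative)
  then have "deriv W = D" using DERIV_imp_deriv by blast
  with D' D(2) show "(W has_real_derivative deriv W s) (at s)" "continuous_on UNIV (deriv W)" by auto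
qed

lemma has_derivative_potential:
  assumes "z \<in> spacetime"
  shows "((\<lambda>z. W (field z \<bullet> field z)) has_derivative
      (\<lambda>h. 2 * deriv W (field z \<bullet> field z) * (field z \<bullet> frechet_derivative field (at z) h))) (at z)"
proof -
  have "(field has_derivative frechet_derivative field (at z)) (at z)"
    by (rule has_derivative_pdir[OF Ck_on_field assms])
  from has_derivative_inner[OF this this]
  have "((\<lambda>z. field z \<bullet> field z) has_derivative
      (\<lambda>h. 2 * (field z \<bullet> frechet_derivative field (at z) h))) (at z)"
    by (simp add: inner_commute)
  from has_derivative_compose[OF this W_has_derivative[unfolded has_field_derivative_def]]
  show ?thesis by (simp add: algebra_simps)
qed

lemma Ck_on_potential: "Ck_on 1 spacetime (\<lambda>z. W (field z \<bullet> field z))"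
  unfolding One_nat_def
proof (rule Ck_on_SucI[OF open_spacetime has_derivative_potential])
  fix v
  have c: "continuous_on spacetime field" "continuous_on spacetime (\<lambda>z. frechet_derivative field (at z) v)"
    using Ck_on_field[of 0] Ck_on_deriv[of 0, OF Ck_on_field] by auto
  show "Ck_on 0 spacetime (\<lambda>z. 2 * deriv W (field z \<bullet> field z) * (field z \<bullet> frechet_derivative field (at z) v))"
    by (simp, intro continuous_intros c continuous_on_compose2[OF continuous_deriv_W]) auto
qed

lemma pdir_potential:
  assumes "z \<in> spacetime"
  shows "pdir \<alpha> (\<lambda>z. W (field z \<bullet> field z)) z = 2 * deriv W (field z \<bullet> field z) * (field z \<bullet> Du \<alpha> z)"
proof -
  have "field z \<bullet> act (conn \<alpha> z) (field z) = 0"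
    using act_skew[of "conn \<alpha> z" "field z" "field z"] by (simp add: inner_commute)
  then show ?thesis
    unfolding pdir_eq[OF has_derivative_potential[OF assms]] by (simp add: cov_def inner_add_right pdir_def)
qed

lemma Ck_on_edens: "Ck_on 1 spacetime edens"
  unfolding edens_def[abs_def] divide_inverse
  by (intro Ck_on_add Ck_on_sum Ck_on_inner Ck_on_mult Ck_on_const Ck_on_potential Ck_on_F Ck_on_Du
      open_spacetime)

lemma Ck_on_stress: "Ck_on k spacetime (stress i \<alpha>)"
  unfolding stress_def[abs_def]
  by (intro Ck_on_add Ck_on_sum Ck_on_inner Ck_on_F Ck_on_Du open_spacetime)

lemma edens_nonneg: "edens z \<ge> 0"
  unfolding edens_def using W_nonneg by (auto intro!: add_nonneg_nonneg sum_nonneg)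

lemma pdir_edens:
  assumes z: "z \<in> spacetime"
  shows "pdir \<alpha> edens z
    = (\<Sum>i\<in>UNIV. \<Sum>j\<in>UNIV. F (Some i) (Some j) z \<bullet> adcov \<alpha> (F (Some i) (Some j)) z) / 2
    + (\<Sum>i\<in>UNIV. Du (Some i) z \<bullet> cov \<alpha> (Du (Some i)) z)
    + 2 * deriv W (field z \<bullet> field z) * (field z \<bullet> Du \<alpha> z)"
proof -
  have c: "Ck_on 1 spacetime (\<lambda>z. F (Some i) (Some j) z \<bullet> F (Some i) (Some j) z)" for i j
    by (intro Ck_on_inner Ck_on_F open_spacetime)
  have c': "Ck_on 1 spacetime (\<lambda>z. Du (Some i) z \<bullet> Du (Some i) z)" for i
    by (intro Ck_on_inner Ck_on_Du open_spacetime)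
  have e: "edens = (\<lambda>z. ((\<Sum>i\<in>UNIV. \<Sum>j\<in>UNIV. (1/4) * (F (Some i) (Some j) z \<bullet> F (Some i) (Some j) z))
     + (\<Sum>i\<in>UNIV. (1/2) * (Du (Some i) z \<bullet> Du (Some i) z))) + W (field z \<bullet> field z))"
    unfolding edens_def[abs_def] by (simp add: sum_divide_distrib)
  have q: "pdir \<alpha> (\<lambda>z. (1/4) * (F (Some i) (Some j) z \<bullet> F (Some i) (Some j) z)) z
      = (F (Some i) (Some j) z \<bullet> adcov \<alpha> (F (Some i) (Some j)) z) / 2" for i j
    by (subst pdir_mult[OF Ck_on_const[OF open_spacetime] c z])
      (simp add: pdir_eq[OF has_derivative_const] pdir_inner_adcov[OF Ck_on_F Ck_on_F z] inner_commute)
  have q': "pdir \<alpha> (\<lambda>z. (1/2) * (Du (Some i) z \<bullet> Du (Some i) z)) z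
      = Du (Some i) z \<bullet> cov \<alpha> (Du (Some i)) z" for i
    by (subst pdir_mult[OF Ck_on_const[OF open_spacetime] c' z])
      (simp add: pdir_eq[OF has_derivative_const] pdir_inner_cov[OF Ck_on_Du Ck_on_Du z] inner_commute)
  note ck = Ck_on_add Ck_on_sum Ck_on_mult Ck_on_const c c' Ck_on_potential open_spacetime
  have "pdir \<alpha> edens z = (pdir \<alpha> (\<lambda>z. \<Sum>i\<in>UNIV. \<Sum>j\<in>UNIV. (1/4) * (F (Some i) (Some j) z \<bullet> F (Some i) (Some j) z)) z
     + pdir \<alpha> (\<lambda>z. \<Sum>i\<in>UNIV. (1/2) * (Du (Some i) z \<bullet> Du (Some i) z)) z)
     + pdir \<alpha> (\<lambda>z. W (field z \<bullet> field z)) z"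
    unfolding e by (subst pdir_add[OF _ _ z], intro ck, intro ck, subst pdir_add[OF _ _ z])
      (intro ck refl)+
  also have "pdir \<alpha> (\<lambda>z. \<Sum>i\<in>UNIV. \<Sum>j\<in>UNIV. (1/4) * (F (Some i) (Some j) z \<bullet> F (Some i) (Some j) z)) z
     = (\<Sum>i\<in>UNIV. \<Sum>j\<in>UNIV. (F (Some i) (Some j) z \<bullet> adcov \<alpha> (F (Some i) (Some j)) z) / 2)"
    by (subst pdir_sum[OF _ z], intro ck, intro sum.cong refl, subst pdir_sum[OF _ z], intro ck)
      (simp only: q)
  also have "pdir \<alpha> (\<lambda>z. \<Sum>i\<in>UNIV. (1/2) * (Du (Some i) z \<bullet> Du (Some i) z)) z
     = (\<Sum>i\<in>UNIV. Du (Some i) z \<bullet> cov \<alpha> (Du (Some i)) z)"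
    by (subst pdir_sum[OF _ z], intro ck) (simp only: q')
  finally show ?thesis by (simp add: pdir_potential[OF z] sum_divide_distrib)
qed

text \<open>Noether identity. The divergence of the stress tensor in the space directions produces the flow
  operators, which the equations replace by the \<open>t\<close>-components; what remains is a gradient, by the
  Bianchi identity for the curvature part and the Ricci identity for the scalar part, whose
  commutator terms cancel against the coupling \<open>u \<odot> D u\<close>. For \<open>\<alpha> = t\<close> this is the local energy
  identity.\<close>

lemma divergence_stress:
  assumes z: "z \<in> spacetime"
  shows "(\<Sum>i\<in>UNIV. pdir (Some i) (stress i \<alpha>) z)
    = pdir \<alpha> edens z + (\<Sum>j\<in>UNIV. F None (Some j) z \<bullet> F \<alpha> (Some j) z) + Du None z \<bullet> Du \<alpha> z"
proof -
  let ?F = "\<lambda>i j. F (Some i) (Some j)" and ?D = "\<lambda>i. Du (Some i)"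
  have stress: "pdir (Some i) (stress i \<alpha>) z = (\<Sum>j\<in>UNIV. adcov (Some i) (?F i j) z \<bullet> F \<alpha> (Some j) z)
      + (\<Sum>j\<in>UNIV. ?F i j z \<bullet> adcov (Some i) (F \<alpha> (Some j)) z)
      + cov (Some i) (?D i) z \<bullet> Du \<alpha> z + ?D i z \<bullet> cov (Some i) (Du \<alpha>) z" for i
    unfolding stress_def[abs_def]
    by (subst pdir_add[OF _ _ z], (intro Ck_on_sum Ck_on_inner Ck_on_F Ck_on_Du open_spacetime)+,
        subst pdir_sum[OF _ z], intro Ck_on_inner Ck_on_F open_spacetime)
      (simp add: pdir_inner_adcov[OF Ck_on_F Ck_on_F z] pdir_inner_cov[OF Ck_on_Du Ck_on_Du z] sum.distrib)
  have "(\<Sum>i\<in>UNIV. \<Sum>j\<in>UNIV. adcov (Some i) (?F i j) z \<bullet> F \<alpha> (Some j) z)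
      = (\<Sum>j\<in>UNIV. (\<Sum>i\<in>UNIV. adcov (Some i) (?F i j) z) \<bullet> F \<alpha> (Some j) z)"
    by (subst sum.swap) (simp add: inner_sum_left)
  also have "\<dots> = (\<Sum>j\<in>UNIV. F None (Some j) z \<bullet> F \<alpha> (Some j) z)
      + (\<Sum>j\<in>UNIV. act (F \<alpha> (Some j) z) (field z) \<bullet> ?D j z)"
    by (simp add: flow_A[OF z] inner_add_left sum.distrib inner_commute[of "odot act _ _"] odot)
  finally have 1: "(\<Sum>i\<in>UNIV. \<Sum>j\<in>UNIV. adcov (Some i) (?F i j) z \<bullet> F \<alpha> (Some j) z) = \<dots>" .
  have 2: "(\<Sum>i\<in>UNIV. \<Sum>j\<in>UNIV. ?F i j z \<bullet> adcov (Some i) (F \<alpha> (Some j)) z)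
      = (\<Sum>i\<in>UNIV. \<Sum>j\<in>UNIV. ?F i j z \<bullet> adcov \<alpha> (?F i j) z) / 2" (is "?S = _")
  proof -
    have "?S = (\<Sum>i\<in>UNIV. \<Sum>j\<in>UNIV. ?F j i z \<bullet> adcov (Some j) (F \<alpha> (Some i)) z)"
      by (rule sum.swap)
    moreover have "?F j i z \<bullet> adcov (Some j) (F \<alpha> (Some i)) z
        = ?F i j z \<bullet> adcov (Some j) (F (Some i) \<alpha>) z" for i j
      using F_antisym[of "Some j" "Some i" z] adcov_antisym[OF z, of "Some j" \<alpha> "Some i"] by simp
    ultimately have "2 * ?S = (\<Sum>i\<in>UNIV. \<Sum>j\<in>UNIV. ?F i j z \<bullet>
        (adcov (Some i) (F \<alpha> (Some j)) z + adcov (Some j) (F (Some i) \<alpha>) z))"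
      by (simp add: inner_add_right sum.distrib)
    moreover have "adcov (Some i) (F \<alpha> (Some j)) z + adcov (Some j) (F (Some i) \<alpha>) z = adcov \<alpha> (?F i j) z"
      for i j
      using bianchi[OF z, of "Some i" \<alpha> "Some j"] adcov_antisym[OF z, of \<alpha> "Some j" "Some i"]
      by (simp add: algebra_simps eq_neg_iff_add_eq_0)
    ultimately show ?thesis by simp
  qed
  have 3: "(\<Sum>i\<in>UNIV. cov (Some i) (?D i) z \<bullet> Du \<alpha> z)
      = Du None z \<bullet> Du \<alpha> z + 2 * deriv W (field z \<bullet> field z) * (field z \<bullet> Du \<alpha> z)"
    by (simp add: inner_sum_left[symmetric] flow_u[OF z] inner_add_left dot_square_norm)
  have 4: "(\<Sum>i\<in>UNIV. ?D i z \<bullet> cov (Some i) (Du \<alpha>) z)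
      = (\<Sum>i\<in>UNIV. ?D i z \<bullet> cov \<alpha> (?D i) z) - (\<Sum>i\<in>UNIV. act (F \<alpha> (Some i) z) (field z) \<bullet> ?D i z)"
    by (simp add: ricci[OF z, of "Some _" \<alpha>] inner_add_right sum.distrib F_antisym[of "Some _" \<alpha>]
        V.minus_left sum_negf inner_commute inner_diff_right sum_subtractf)
  show ?thesis
    by (simp add: stress sum.distrib pdir_edens[OF z] 1 2 3 4)
qed

subsection \<open>The monotone flux field of a centre\<close>

text \<open>The vector \<open>\<xi>\<close> is the gradient of the logarithm of the backward heat kernel centred at \<open>(X, T)\<close>; the
  centre is arbitrary, and \<open>T\<close> need not be the final time of the flow. The vector \<open>Y\<close> is the contraction of
  the stress tensor with \<open>(\<xi>, 1)\<close>, and \<open>P\<close>, \<open>Q\<close> are the two integrands of the monotonicity formula.\<close>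

definition xi :: "real^'n \<Rightarrow> real \<Rightarrow> 'n \<Rightarrow> (real^'n) \<times> real \<Rightarrow> real" where
  "xi X T i z = (fst z - X) $ i / (2 * (snd z - T))"

definition xiF :: "real^'n \<Rightarrow> real \<Rightarrow> 'n \<Rightarrow> (real^'n) \<times> real \<Rightarrow> 'l" where
  "xiF X T j z = (\<Sum>i\<in>UNIV. xi X T i z *\<^sub>R F (Some i) (Some j) z)"

definition xiD :: "real^'n \<Rightarrow> real \<Rightarrow> (real^'n) \<times> real \<Rightarrow> 'v" where
  "xiD X T z = (\<Sum>i\<in>UNIV. xi X T i z *\<^sub>R Du (Some i) z)"

definition SA :: "real^'n \<Rightarrow> real \<Rightarrow> 'n \<Rightarrow> (real^'n) \<times> real \<Rightarrow> 'l" where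
  "SA X T j z = F None (Some j) z + xiF X T j z"

definition Ju :: "real^'n \<Rightarrow> real \<Rightarrow> (real^'n) \<times> real \<Rightarrow> 'v" where
  "Ju X T z = Du None z + xiD X T z"

definition Yvec :: "real^'n \<Rightarrow> real \<Rightarrow> 'n \<Rightarrow> (real^'n) \<times> real \<Rightarrow> real" where
  "Yvec X T i z = stress i None z + (\<Sum>k\<in>UNIV. xi X T k z * stress i (Some k) z)"

definition xiY :: "real^'n \<Rightarrow> real \<Rightarrow> (real^'n) \<times> real \<Rightarrow> real" where
  "xiY X T z = (\<Sum>j\<in>UNIV. xiF X T j z \<bullet> SA X T j z) + xiD X T z \<bullet> Ju X T z"

definition Pdens :: "real^'n \<Rightarrow> real \<Rightarrow> (real^'n) \<times> real \<Rightarrow> real" where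
  "Pdens X T z = edens z * ((real CARD('n) - 4) / (2 * (T - snd z))) - xiY X T z"

definition Qdens :: "real^'n \<Rightarrow> real \<Rightarrow> (real^'n) \<times> real \<Rightarrow> real" where
  "Qdens X T z = ((\<Sum>i\<in>UNIV. Du (Some i) z \<bullet> Du (Some i) z) + 4 * W (field z \<bullet> field z)) / (2 * (T - snd z))
     + (\<Sum>j\<in>UNIV. SA X T j z \<bullet> SA X T j z) + Ju X T z \<bullet> Ju X T z"

lemma Yvec_eq: "Yvec X T i z = (\<Sum>j\<in>UNIV. F (Some i) (Some j) z \<bullet> SA X T j z) + Du (Some i) z \<bullet> Ju X T z"
proof -
  have "(\<Sum>k\<in>UNIV. xi X T k z * (\<Sum>j\<in>UNIV. F (Some i) (Some j) z \<bullet> F (Some k) (Some j) z))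
      = (\<Sum>j\<in>UNIV. F (Some i) (Some j) z \<bullet> xiF X T j z)"
    unfolding xiF_def inner_sum_right sum_distrib_left inner_scaleR_right by (rule sum.swap)
  then show ?thesis
    by (simp add: Yvec_def stress_def SA_def Ju_def xiD_def inner_add_right sum.distrib
        distrib_left inner_sum_right)
qed

lemma sum_xi_Yvec: "(\<Sum>i\<in>UNIV. xi X T i z * Yvec X T i z) = xiY X T z"
proof -
  have "(\<Sum>i\<in>UNIV. xi X T i z * (\<Sum>j\<in>UNIV. F (Some i) (Some j) z \<bullet> SA X T j z))
      = (\<Sum>j\<in>UNIV. xiF X T j z \<bullet> SA X T j z)"
    unfolding xiF_def inner_sum_left sum_distrib_left inner_scaleR_left by (rule sum.swap)
  then show ?thesis
    by (simp add: Yvec_eq xiY_def distrib_left sum.distrib xiD_def inner_sum_left)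
qed

lemma has_derivative_xi:
  assumes "snd z \<noteq> T"
  shows "(xi X T i has_derivative (\<lambda>h. fst h $ i / (2 * (snd z - T))
    - snd h * (fst z - X) $ i / (2 * (snd z - T)\<^sup>2))) (at z)"
proof -
  have n: "((\<lambda>z. (fst z - X) $ i) has_derivative (\<lambda>h. fst h $ i)) (at z)"
    by (intro bounded_linear.has_derivative[OF bounded_linear_vec_nth])
      (auto intro!: derivative_eq_intros)
  have d: "((\<lambda>z. 2 * (snd z - T)) has_derivative (\<lambda>h. 2 * snd h)) (at z)"
    by (auto intro!: derivative_eq_intros)
  have alg: "(p * (2 * s) - q * (2 * k)) / ((2 * s) * (2 * s)) = p / (2 * s) - k * q / (2 * s\<^sup>2)"
    if "s \<noteq> 0" for p q k s :: real
    using that by (simp add: field_simps power2_eq_square)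
  have ne: "2 * (snd z - T) \<noteq> 0" "snd z - T \<noteq> 0" using assms by auto
  show ?thesis
    unfolding xi_def[abs_def] alg[OF ne(2), symmetric]
    by (rule has_derivative_divide'[OF n d ne(1)])
qed

lemma pdir_xi:
  "snd z \<noteq> T \<Longrightarrow> pdir (Some i) (xi X T k) z = (if i = k then 1 / (2 * (snd z - T)) else 0)"
  by (simp add: pdir_eq[OF has_derivative_xi] axis_def)

text \<open>The left side is the divergence of the flux field \<open>(\<xi> e - Y, e)\<close>, written out by the product rule. It
  is the Noether identity contracted with \<open>(\<xi>, 1)\<close>, plus the terms with \<open>\<partial>\<^sub>i \<xi>\<^sub>k = \<delta>\<^sub>i\<^sub>k / (2 (t - T))\<close>. These
  give \<open>n e\<close> minus the trace of the stress tensor, and since that trace is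
  \<open>4 e - |D u|\<^sup>2 - 4 W\<close>, the factor \<open>n - 4\<close> and the first part of \<open>Q\<close>.\<close>

lemma divergence_flux:
  assumes z: "z \<in> spacetime" and T: "snd z < T"
  shows "pdir None edens z + (\<Sum>i\<in>UNIV. xi X T i z * pdir (Some i) edens z
      + edens z / (2 * (snd z - T))
      - (pdir (Some i) (stress i None) z + (\<Sum>k\<in>UNIV. xi X T k z * pdir (Some i) (stress i (Some k)) z)
         + stress i (Some i) z / (2 * (snd z - T))))
    = - (Pdens X T z + Qdens X T z)"
proof -
  let ?c = "1 / (2 * (snd z - T))" and ?n = "real CARD('n)"
  let ?D2 = "\<Sum>i\<in>UNIV. Du (Some i) z \<bullet> Du (Some i) z"
  have trace: "(\<Sum>i\<in>UNIV. stress i (Some i) z) = 4 * edens z - ?D2 - 4 * W (field z \<bullet> field z)"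
    by (simp add: stress_def edens_def sum.distrib)
  have "(\<Sum>i\<in>UNIV. \<Sum>k\<in>UNIV. xi X T k z * pdir (Some i) (stress i (Some k)) z)
      = (\<Sum>k\<in>UNIV. xi X T k z * (\<Sum>i\<in>UNIV. pdir (Some i) (stress i (Some k)) z))"
    by (subst sum.swap) (simp add: sum_distrib_left)
  also have "\<dots> = (\<Sum>k\<in>UNIV. xi X T k z * pdir (Some k) edens z)
      + (\<Sum>k\<in>UNIV. xi X T k z * (\<Sum>j\<in>UNIV. F None (Some j) z \<bullet> F (Some k) (Some j) z))
      + (\<Sum>k\<in>UNIV. xi X T k z * (Du None z \<bullet> Du (Some k) z))"
    by (simp add: divergence_stress[OF z] distrib_left sum.distrib)
  also have "(\<Sum>k\<in>UNIV. xi X T k z * (\<Sum>j\<in>UNIV. F None (Some j) z \<bullet> F (Some k) (Some j) z))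
      = (\<Sum>j\<in>UNIV. F None (Some j) z \<bullet> xiF X T j z)"
    unfolding xiF_def inner_sum_right sum_distrib_left inner_scaleR_right by (rule sum.swap)
  also have "(\<Sum>k\<in>UNIV. xi X T k z * (Du None z \<bullet> Du (Some k) z)) = Du None z \<bullet> xiD X T z"
    by (simp add: xiD_def inner_sum_right)
  finally have sw: "(\<Sum>i\<in>UNIV. \<Sum>k\<in>UNIV. xi X T k z * pdir (Some i) (stress i (Some k)) z)
      = (\<Sum>k\<in>UNIV. xi X T k z * pdir (Some k) edens z) + (\<Sum>j\<in>UNIV. F None (Some j) z \<bullet> xiF X T j z)
        + Du None z \<bullet> xiD X T z" .
  have SF: "F None (Some j) z = SA X T j z - xiF X T j z" for j by (simp add: SA_def)
  have JD: "Du None z = Ju X T z - xiD X T z" by (simp add: Ju_def)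
  have "(\<Sum>j\<in>UNIV. F None (Some j) z \<bullet> F None (Some j) z) + (\<Sum>j\<in>UNIV. F None (Some j) z \<bullet> xiF X T j z)
      + Du None z \<bullet> Du None z + Du None z \<bullet> xiD X T z
      = (\<Sum>j\<in>UNIV. SA X T j z \<bullet> SA X T j z) + Ju X T z \<bullet> Ju X T z - xiY X T z"
    unfolding SF JD xiY_def
    by (simp add: inner_diff_left inner_diff_right sum_subtractf sum.distrib sum_distrib_left
        inner_commute algebra_simps)
  moreover have "pdir None edens z + (\<Sum>i\<in>UNIV. xi X T i z * pdir (Some i) edens z
      + edens z / (2 * (snd z - T))
      - (pdir (Some i) (stress i None) z + (\<Sum>k\<in>UNIV. xi X T k z * pdir (Some i) (stress i (Some k)) z)
         + stress i (Some i) z / (2 * (snd z - T))))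
    = ?c * (?n * edens z - (\<Sum>i\<in>UNIV. stress i (Some i) z))
      - ((\<Sum>j\<in>UNIV. F None (Some j) z \<bullet> F None (Some j) z) + (\<Sum>j\<in>UNIV. F None (Some j) z \<bullet> xiF X T j z)
      + Du None z \<bullet> Du None z + Du None z \<bullet> xiD X T z)"
    by (simp add: sum.distrib sum_subtractf sw divergence_stress[OF z] sum_divide_distrib[symmetric]
        right_diff_distrib diff_divide_distrib)
  moreover have "?c * (?n * edens z - (\<Sum>i\<in>UNIV. stress i (Some i) z))
      = - edens z * ((?n - 4) / (2 * (T - snd z))) - (?D2 + 4 * W (field z \<bullet> field z)) / (2 * (T - snd z))"
  proof -
    have "1 / (2 * s) * (m * e - (4 * e - d - w)) = - e * ((m - 4) / (2 * r)) - (d + w) / (2 * r)"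
      if "s \<noteq> 0" "r = - s" for s r m e d w :: real
      using that by (simp add: field_simps)
    from this[of "snd z - T" "T - snd z"] show ?thesis unfolding trace using T by simp
  qed
  ultimately show ?thesis by (simp add: Pdens_def Qdens_def)
qed

end

section \<open>The divergence theorem on a space-time slab\<close>

lemma integral_translate:
  fixes g :: "'a::euclidean_space \<Rightarrow> real"
  assumes "g \<in> borel_measurable borel"
  shows "(LINT x|lborel. g (c + x)) = (LINT x|lborel. g x)"
proof -
  have "(LINT x|lborel. g x) = (LINT x|distr lborel borel ((+) c). g x)" by (simp add: lborel_distr_plus)
  also have "\<dots> = (LINT x|lborel. g (c + x))" by (rule integral_distr) (use assms in auto)
  finally show ?thesis ..
qed

lemma integrable_translate:
  fixes g :: "'a::euclidean_space \<Rightarrow> real"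
  assumes "integrable lborel g"
  shows "integrable lborel (\<lambda>x. g (c + x))"
proof -
  have "integrable (distr lborel borel ((+) c)) g" using assms by (simp add: lborel_distr_plus)
  then show ?thesis by (subst (asm) integrable_distr_eq) (use assms in auto)
qed

lemma continuous_support_integrable:
  fixes g :: "'a::euclidean_space \<Rightarrow> real"
  assumes "continuous_on UNIV g" "compact K" "\<And>x. x \<notin> K \<Longrightarrow> g x = 0"
  shows "integrable lborel g"
proof -
  have "integrable lborel (\<lambda>x. indicator K x *\<^sub>R g x)"
    by (rule borel_integrable_compact[OF assms(2)]) (use assms(1) continuous_on_subset in blast)
  moreover have "(\<lambda>x. indicator K x *\<^sub>R g x) = g"
    using assms(3) by (auto simp: indicator_def fun_eq_iff)
  ultimately show ?thesis by simp
qed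

text \<open>The integral of \<open>g(x + h v) - g(x)\<close> vanishes by translation invariance; divide by \<open>h\<close> and let
  \<open>h\<close> tend to \<open>0\<close>.\<close>

lemma integral_directional_derivative_eq_0:
  fixes g :: "'a::euclidean_space \<Rightarrow> real"
  assumes d: "\<And>x. (g has_derivative g' x) (at x)"
    and c: "continuous_on UNIV (\<lambda>x. g' x v)"
    and supp: "\<And>x. x \<notin> cball X R \<Longrightarrow> g x = 0"
  shows "(LINT x|lborel. g' x v) = 0"
proof -
  have cg: "continuous_on UNIV g"
    using d by (auto intro!: continuous_at_imp_continuous_on has_derivative_continuous)
  have g'0: "g' x v = 0" if "x \<notin> cball X R" for x
  proof -
    have "(g has_derivative (\<lambda>_. 0)) (at x)"
      by (rule has_derivative_transform_within_open[of "\<lambda>_. 0" _ _ _ "- cball X R"])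
        (use that supp in auto)
    then show ?thesis using has_derivative_unique[OF d] by metis
  qed
  have "compact ((\<lambda>x. g' x v) ` cball X R)"
    by (rule compact_continuous_image) (use c continuous_on_subset in auto)
  then obtain M where M: "\<And>x. x \<in> cball X R \<Longrightarrow> \<bar>g' x v\<bar> \<le> M" "M \<ge> 0"
    using compact_imp_bounded[THEN bounded_pos[THEN iffD1]] by (metis imageI less_imp_le real_norm_def)
  have M': "\<bar>g' x v\<bar> \<le> M" for x using M g'0[of x] by (cases "x \<in> cball X R") auto
  define h where "h k = 1 / (real k + 1)" for k :: nat
  have h: "0 < h k" "h k \<le> 1" for k unfolding h_def by auto
  have hl: "h \<longlonglongrightarrow> 0" unfolding h_def by real_asymp
  define s where "s k x = (g (h k *\<^sub>R v + x) - g x) / h k" for k x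
  have int: "integrable lborel g" by (rule continuous_support_integrable[OF cg compact_cball supp])
  have line: "((\<lambda>r. g (r *\<^sub>R v + x)) has_real_derivative g' (r *\<^sub>R v + x) v) (at r)" for r x
  proof -
    have "((\<lambda>r. r *\<^sub>R v + x) has_vector_derivative v) (at r)"
      unfolding has_vector_derivative_def
      by (rule has_derivative_eq_rhs, (rule derivative_intros)+) simp
    from vector_diff_chain_at_derivative[OF this d] show ?thesis
      by (simp add: o_def has_real_derivative_iff_has_vector_derivative)
  qed
  have "(\<lambda>k. LINT x|lborel. s k x) \<longlonglongrightarrow> (LINT x|lborel. g' x v)"
  proof (rule integral_dominated_convergence[where w="\<lambda>x. M * indicator (cball X (R + norm v)) x"])
    show "(\<lambda>x. g' x v) \<in> borel_measurable lborel"
      using borel_measurable_continuous_onI[OF c] by simp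
    have "continuous_on UNIV (s k)" for k
      unfolding s_def by (intro continuous_intros continuous_on_compose2[OF cg]) (use h[of k] in auto)
    then show "s k \<in> borel_measurable lborel" for k
      by (simp add: borel_measurable_continuous_onI)
    have "emeasure lborel (cball X (R + norm v)) < \<infinity>"
      using emeasure_bounded_finite[OF bounded_cball] by auto
    then show "integrable lborel (\<lambda>x. M * indicator (cball X (R + norm v)) x)"
      by (intro integrable_mult_right integrable_real_indicator) auto
    have "(\<lambda>k. s k x) \<longlonglongrightarrow> g' x v" for x
    proof -
      have "((\<lambda>r. (g (r *\<^sub>R v + x) - g x) / r) \<longlongrightarrow> g' x v) (at 0)"
        using line[of x 0] unfolding has_field_derivative_iff by simp
      moreover have "filterlim h (at 0) sequentially"
        unfolding filterlim_at using hl h by (auto intro!: always_eventually simp: less_imp_neq[symmetric])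
      ultimately show ?thesis unfolding s_def by (rule filterlim_compose)
    qed
    then show "AE x in lborel. (\<lambda>k. s k x) \<longlonglongrightarrow> g' x v" by simp
    have "norm (s k x) \<le> M * indicator (cball X (R + norm v)) x" for k x
    proof (cases "x \<in> cball X (R + norm v)")
      case True
      have "\<exists>r. 0 < r \<and> r < h k \<and> g (h k *\<^sub>R v + x) - g (0 *\<^sub>R v + x) = (h k - 0) * g' (r *\<^sub>R v + x) v"
        by (rule MVT2[of 0 "h k" "\<lambda>r. g (r *\<^sub>R v + x)" "\<lambda>r. g' (r *\<^sub>R v + x) v", OF h(1) line])
      then obtain r where "s k x = g' (r *\<^sub>R v + x) v"
        unfolding s_def using h(1)[of k] by (auto simp: field_simps)
      then show ?thesis using M' True by simp
    next
      case False
      have "dist X x \<le> dist X (h k *\<^sub>R v + x) + norm (h k *\<^sub>R v)"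
        using dist_triangle[of X x "h k *\<^sub>R v + x"] by (simp add: dist_norm)
      also have "norm (h k *\<^sub>R v) \<le> norm v" using h[of k] by (simp add: mult_left_le_one_le)
      finally have "h k *\<^sub>R v + x \<notin> cball X R" "x \<notin> cball X R" using False
        by (auto, smt (verit) norm_ge_zero)
      then show ?thesis using False by (simp add: s_def supp)
    qed
    then show "AE x in lborel. norm (s k x) \<le> M * indicator (cball X (R + norm v)) x" for k by simp
  qed
  moreover have "(LINT x|lborel. s k x) = 0" for k
    unfolding s_def using int integrable_translate[OF int] integral_translate[of g "h k *\<^sub>R v"]
    by simp
  ultimately show ?thesis by (simp add: LIMSEQ_const_iff)
qed

text \<open>On each time slice the space derivatives integrate to \<open>0\<close>; on each vertical line the time
  derivative integrates to the difference of the boundary values.\<close>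

lemma slab_divergence_theorem:
  fixes G :: "'n option \<Rightarrow> (real^'n::finite) \<times> real \<Rightarrow> real"
  assumes U: "open U" "UNIV \<times> {t1..t2} \<subseteq> U" and t: "t1 \<le> t2"
    and G: "\<And>\<alpha>. Ck_on 1 U (G \<alpha>)"
    and supp: "\<And>\<alpha> x t. (x, t) \<in> U \<Longrightarrow> x \<notin> cball X R \<Longrightarrow> G \<alpha> (x, t) = 0"
  shows "(LINT z:cball X R \<times> {t1..t2}|lborel. pdir None (G None) z + (\<Sum>i\<in>UNIV. pdir (Some i) (G (Some i)) z))
    = (LINT x:cball X R|lborel. G None (x, t2)) - (LINT x:cball X R|lborel. G None (x, t1))"
proof -
  let ?K = "cball X R \<times> {t1..t2}"
  have K: "compact ?K" by (intro compact_Times) auto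
  have KU: "?K \<subseteq> U" using U by auto
  have hd: "(G \<alpha> has_derivative frechet_derivative (G \<alpha>) (at z)) (at z)" if "z \<in> U" for \<alpha> z
    using Ck_on_has_derivative[of 0 U "G \<alpha>"] G that by simp
  have cd: "continuous_on U (pdir \<beta> (G \<alpha>))" for \<alpha> \<beta>
    using Ck_on_deriv[of 0 U "G \<alpha>"] G unfolding pdir_def[abs_def] by simp
  have int: "integrable lborel (\<lambda>z. indicator ?K z *\<^sub>R pdir \<beta> (G \<alpha>) z)" for \<alpha> \<beta>
    by (rule borel_integrable_compact[OF K continuous_on_subset[OF cd KU]])
  have slice: "(Pair x has_vector_derivative (0, 1)) (at t)" for x :: "real^'n" and t :: real
    unfolding has_vector_derivative_def by (auto intro!: derivative_eq_intros)
  have time: "(LINT z|lborel. indicator ?K z *\<^sub>R pdir None (G None) z)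
    = (LINT x:cball X R|lborel. G None (x, t2)) - (LINT x:cball X R|lborel. G None (x, t1))"
  proof -
    have inner: "(LINT t|lborel. indicator ?K (x, t) *\<^sub>R pdir None (G None) (x, t))
      = indicator (cball X R) x *\<^sub>R (G None (x, t2) - G None (x, t1))" for x
    proof -
      have "(LINT t|lborel. indicator {t1..t2} t *\<^sub>R pdir None (G None) (x, t))
          = G None (x, t2) - G None (x, t1)"
      proof (rule integral_FTC_atLeastAtMost[OF t])
        fix s assume "t1 \<le> s" "s \<le> t2"
        then have "(x, s) \<in> U" using U by auto
        from vector_diff_chain_at_derivative[OF slice hd[OF this]]
        show "((\<lambda>t. G None (x, t)) has_vector_derivative pdir None (G None) (x, s)) (at s within {t1..t2})"
          by (simp add: o_def pdir_def has_vector_derivative_at_within)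
      next
        show "continuous_on {t1..t2} (\<lambda>t. pdir None (G None) (x, t))"
          by (rule continuous_on_compose2[OF cd]) (use U in \<open>auto intro!: continuous_intros\<close>)
      qed
      then show ?thesis by (simp add: indicator_times mult.assoc)
    qed
    have cG: "continuous_on (cball X R) (\<lambda>x. G None (x, s))" if "s \<in> {t1..t2}" for s
      by (rule continuous_on_compose2[OF Ck_on_imp_continuous[OF G]])
        (use U that in \<open>auto intro!: continuous_intros\<close>)
    have iG: "set_integrable lborel (cball X R) (\<lambda>x. G None (x, s))" if "s \<in> {t1..t2}" for s
      unfolding set_integrable_def by (rule borel_integrable_compact[OF compact_cball cG[OF that]])
    have "(LINT z|lborel. indicator ?K z *\<^sub>R pdir None (G None) z)
      = (LINT x|lborel. LINT t|lborel. indicator ?K (x, t) *\<^sub>R pdir None (G None) (x, t))"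
      unfolding lborel_prod[symmetric]
      by (rule lborel_pair.integral_fst'[symmetric]) (use int[of None None] in \<open>simp only: lborel_prod\<close>)
    also have "\<dots> = (LINT x:cball X R|lborel. G None (x, t2) - G None (x, t1))"
      unfolding inner set_lebesgue_integral_def ..
    also have "\<dots> = (LINT x:cball X R|lborel. G None (x, t2)) - (LINT x:cball X R|lborel. G None (x, t1))"
      by (rule set_integral_diff) (use t in \<open>auto intro!: iG\<close>)
    finally show ?thesis .
  qed
  have space: "(LINT z|lborel. indicator ?K z *\<^sub>R pdir (Some i) (G (Some i)) z) = 0" for i
  proof -
    have inner: "(LINT x|lborel. indicator ?K (x, t) *\<^sub>R pdir (Some i) (G (Some i)) (x, t)) = 0" for t
    proof (cases "t \<in> {t1..t2}")
      case True
      then have tU: "(x, t) \<in> U" for x using U by auto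
      let ?g = "\<lambda>x. G (Some i) (x, t)"
      have d: "(?g has_derivative (\<lambda>h. frechet_derivative (G (Some i)) (at (x, t)) (h, 0))) (at x)" for x
      proof -
        have "((\<lambda>x. (x, t)) has_derivative (\<lambda>h. (h, 0))) (at x)"
          by (auto intro!: derivative_eq_intros)
        from has_derivative_compose[OF this hd[OF tU]] show ?thesis .
      qed
      have c: "continuous_on UNIV (\<lambda>x. frechet_derivative (G (Some i)) (at (x, t)) (axis i 1, 0))"
        by (rule continuous_on_compose2[OF cd[of "Some i" "Some i", unfolded pdir_def[abs_def] dir.simps]])
          (use tU in \<open>auto intro!: continuous_intros\<close>)
      have z: "frechet_derivative (G (Some i)) (at (x, t)) (axis i 1, 0) = 0" if "x \<notin> cball X R" for x
      proof -
        have "(?g has_derivative (\<lambda>_. 0)) (at x)"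
          by (rule has_derivative_transform_within_open[of "\<lambda>_. 0" _ _ _ "- cball X R"])
            (use that supp tU in auto)
        then show ?thesis using has_derivative_unique[OF d] by metis
      qed
      have "(\<lambda>x. indicator ?K (x, t) *\<^sub>R pdir (Some i) (G (Some i)) (x, t))
          = (\<lambda>x. frechet_derivative (G (Some i)) (at (x, t)) (axis i 1, 0))"
        using z True by (auto simp: indicator_def pdir_def fun_eq_iff)
      then show ?thesis
        using integral_directional_derivative_eq_0[OF d c, of X R] supp tU by simp
    next
      case False
      then have "indicator ?K (x, t) = (0::real)" for x by auto
      then show ?thesis by simp
    qed
    have "(LINT z|lborel. indicator ?K z *\<^sub>R pdir (Some i) (G (Some i)) z)
      = (LINT t|lborel. LINT x|lborel. indicator ?K (x, t) *\<^sub>R pdir (Some i) (G (Some i)) (x, t))"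
      unfolding lborel_prod[symmetric]
      by (rule lborel_pair.integral_snd[symmetric, where f="\<lambda>x t. indicator ?K (x, t) *\<^sub>R pdir (Some i) (G (Some i)) (x, t)",
            unfolded case_prod_eta split_beta prod.collapse])
        (use int[of "Some i" "Some i"] in \<open>simp only: lborel_prod\<close>)
    then show ?thesis by (simp only: inner) simp
  qed
  have "(LINT z:?K|lborel. pdir None (G None) z + (\<Sum>i\<in>UNIV. pdir (Some i) (G (Some i)) z))
    = (LINT z|lborel. indicator ?K z *\<^sub>R pdir None (G None) z
        + (\<Sum>i\<in>UNIV. indicator ?K z *\<^sub>R pdir (Some i) (G (Some i)) z))"
    unfolding set_lebesgue_integral_def by (simp only: scaleR_add_right scaleR_sum_right)
  also have "\<dots> = (LINT z|lborel. indicator ?K z *\<^sub>R pdir None (G None) z)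
      + (LINT z|lborel. (\<Sum>i\<in>UNIV. indicator ?K z *\<^sub>R pdir (Some i) (G (Some i)) z))"
    by (rule Bochner_Integration.integral_add) (intro int Bochner_Integration.integrable_sum)+
  also have "(LINT z|lborel. (\<Sum>i\<in>UNIV. indicator ?K z *\<^sub>R pdir (Some i) (G (Some i)) z))
      = (\<Sum>i\<in>UNIV. LINT z|lborel. indicator ?K z *\<^sub>R pdir (Some i) (G (Some i)) z)"
    by (rule Bochner_Integration.integral_sum) (rule int)
  finally show ?thesis by (simp only: space time) simp
qed

context ymh_flow
begin

lemma xi_norm: "(\<Sum>i\<in>UNIV. xi X T i z * xi X T i z) = (norm (fst z - X))\<^sup>2 / (4 * (T - snd z)\<^sup>2)"
proof -
  have "(\<Sum>i\<in>UNIV. xi X T i z * xi X T i z) = (\<Sum>i\<in>UNIV. ((fst z - X) $ i)\<^sup>2) / (2 * (snd z - T))\<^sup>2"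
    by (simp add: xi_def power2_eq_square sum_divide_distrib)
  also have "(\<Sum>i\<in>UNIV. ((fst z - X) $ i)\<^sup>2) = (norm (fst z - X))\<^sup>2"
    by (simp add: norm_vec_def L2_set_def sum_nonneg)
  also have "(2 * (snd z - T))\<^sup>2 = 4 * (T - snd z)\<^sup>2"
    by (simp add: power2_eq_square algebra_simps)
  finally show ?thesis .
qed

lemma Ck_on_xi:
  assumes "b \<le> T"
  shows "Ck_on 1 spacetime (xi X T i)"
  unfolding One_nat_def
proof (rule Ck_on_SucI[OF open_spacetime has_derivative_xi])
  have ne: "snd z \<noteq> T" if "z \<in> spacetime" for z using that assms by (auto simp: spacetime_def)
  then show "z \<in> spacetime \<Longrightarrow> snd z \<noteq> T" for z .
  show "Ck_on 0 spacetime (\<lambda>z. fst v $ i / (2 * (snd z - T)) - snd v * (fst z - X) $ i / (2 * (snd z - T)\<^sup>2))" for v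
    using ne by (auto intro!: continuous_intros)
qed

lemma continuous_on_Qdens: "b \<le> T \<Longrightarrow> continuous_on spacetime (Qdens X T)"
  and continuous_on_Pdens: "b \<le> T \<Longrightarrow> continuous_on spacetime (Pdens X T)"
  and continuous_on_xiY: "b \<le> T \<Longrightarrow> continuous_on spacetime (xiY X T)"
proof -
  assume bT: "b \<le> T"
  have ne: "snd z \<noteq> T" if "z \<in> spacetime" for z using that bT by (auto simp: spacetime_def)
  note c = Ck_on_imp_continuous[OF Ck_on_F[of 0]] Ck_on_imp_continuous[OF Ck_on_Du[of 0]]
    Ck_on_imp_continuous[OF Ck_on_edens] Ck_on_imp_continuous[OF Ck_on_potential]
    Ck_on_imp_continuous[OF Ck_on_xi[OF bT]]
  have xiF: "continuous_on spacetime (xiF X T j)" for j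
    unfolding xiF_def[abs_def] by (intro continuous_intros c)
  have xiD: "continuous_on spacetime (xiD X T)"
    unfolding xiD_def[abs_def] by (intro continuous_intros c)
  have SA: "continuous_on spacetime (SA X T j)" for j
    unfolding SA_def[abs_def] by (intro continuous_intros c xiF)
  have Ju: "continuous_on spacetime (Ju X T)"
    unfolding Ju_def[abs_def] by (intro continuous_intros c xiD)
  show xiY: "continuous_on spacetime (xiY X T)"
    unfolding xiY_def[abs_def] by (intro continuous_intros xiF xiD SA Ju)
  show "continuous_on spacetime (Pdens X T)"
    unfolding Pdens_def[abs_def] by (intro continuous_intros c xiY) (use ne in force)
  show "continuous_on spacetime (Qdens X T)"
    unfolding Qdens_def[abs_def] by (intro continuous_intros c SA Ju) (use ne in force)
qed

definition radial_flux :: "real^'n \<Rightarrow> real \<Rightarrow> (real^'n) \<times> real \<Rightarrow> real" where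
  "radial_flux X T z = (norm (fst z - X))\<^sup>2 / (4 * (T - snd z)\<^sup>2) * edens z - xiY X T z"

lemmas continuous_on_edens = Ck_on_imp_continuous[OF Ck_on_edens]

text \<open>The flux field tested against a weight \<open>\<phi>\<close> whose spatial gradient \<open>g \<xi>\<close> is radial; only the
  radial component of \<open>Y\<close> then occurs.\<close>

lemma slab_identity:
  assumes bT: "b \<le> T" and t: "a < t1" "t1 \<le> t2" "t2 < b"
    and \<phi>: "Ck_on 1 spacetime \<phi>"
    and grad: "\<And>i z. z \<in> spacetime \<Longrightarrow> pdir (Some i) \<phi> z = g z * xi X T i z"
    and supp: "\<And>z. z \<in> spacetime \<Longrightarrow> fst z \<notin> cball X R \<Longrightarrow> \<phi> z = 0"
  shows "(LINT z:cball X R \<times> {t1..t2}|lborel. edens z * pdir None \<phi> z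
      + g z * radial_flux X T z
      - \<phi> z * (Pdens X T z + Qdens X T z))
    = (LINT x:cball X R|lborel. \<phi> (x, t2) * edens (x, t2)) - (LINT x:cball X R|lborel. \<phi> (x, t1) * edens (x, t1))"
proof -
  define G where "G \<alpha> z = (case \<alpha> of None \<Rightarrow> \<phi> z * edens z
      | Some i \<Rightarrow> \<phi> z * (xi X T i z * edens z - Yvec X T i z))" for \<alpha> z
  have Y: "Ck_on 1 spacetime (Yvec X T i)" for i
    unfolding Yvec_def[abs_def]
    by (intro Ck_on_add Ck_on_sum Ck_on_mult Ck_on_stress Ck_on_xi bT open_spacetime)
  have xe: "Ck_on 1 spacetime (\<lambda>z. xi X T i z * edens z)" for i
    by (intro Ck_on_mult Ck_on_xi bT open_spacetime Ck_on_edens)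
  have CG: "Ck_on 1 spacetime (G \<alpha>)" for \<alpha>
    unfolding G_def[abs_def]
    by (cases \<alpha>) (auto simp del: Ck_on.simps One_nat_def intro!: Ck_on_mult Ck_on_diff \<phi> Ck_on_edens open_spacetime Y xe)
  have div: "pdir None (G None) z + (\<Sum>i\<in>UNIV. pdir (Some i) (G (Some i)) z) = edens z * pdir None \<phi> z
      + g z * radial_flux X T z
      - \<phi> z * (Pdens X T z + Qdens X T z)" if z: "z \<in> spacetime" for z
  proof -
    have zT: "snd z < T" using z bT by (auto simp: spacetime_def)
    have N: "pdir None (G None) z = \<phi> z * pdir None edens z + pdir None \<phi> z * edens z"
      unfolding G_def option.case by (rule pdir_mult[OF \<phi> Ck_on_edens z])
    have dY: "pdir (Some i) (Yvec X T i) z = pdir (Some i) (stress i None) z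
        + (\<Sum>k\<in>UNIV. xi X T k z * pdir (Some i) (stress i (Some k)) z)
         + stress i (Some i) z / (2 * (snd z - T))" for i
    proof -
      have m: "pdir (Some i) (\<lambda>z. xi X T k z * stress i (Some k) z) z
          = xi X T k z * pdir (Some i) (stress i (Some k)) z
            + (if i = k then stress i (Some i) z / (2 * (snd z - T)) else 0)" for k
        using pdir_mult[OF Ck_on_xi[OF bT] Ck_on_stress z, of "Some i" X k i "Some k"] zT
        by (simp add: pdir_xi)
      show ?thesis
        unfolding Yvec_def[abs_def]
        by (subst pdir_add[OF _ _ z], (intro Ck_on_sum Ck_on_mult Ck_on_stress Ck_on_xi bT open_spacetime)+,
            subst pdir_sum[OF _ z], intro Ck_on_mult Ck_on_stress Ck_on_xi bT open_spacetime)
          (simp add: m sum.distrib)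
    qed
    have S: "pdir (Some i) (G (Some i)) z = \<phi> z * (xi X T i z * pdir (Some i) edens z
      + edens z / (2 * (snd z - T))
      - (pdir (Some i) (stress i None) z + (\<Sum>k\<in>UNIV. xi X T k z * pdir (Some i) (stress i (Some k)) z)
         + stress i (Some i) z / (2 * (snd z - T))))
      + g z * (xi X T i z * xi X T i z * edens z - xi X T i z * Yvec X T i z)" for i
    proof -
      have d: "pdir (Some i) (\<lambda>z. xi X T i z * edens z - Yvec X T i z) z
          = xi X T i z * pdir (Some i) edens z + edens z / (2 * (snd z - T)) - pdir (Some i) (Yvec X T i) z"
        using pdir_mult[OF Ck_on_xi[OF bT] Ck_on_edens z, of "Some i" X i] zT
        by (simp add: pdir_diff[OF xe Y z] pdir_xi)
      show ?thesis
        unfolding G_def option.case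
        by (subst pdir_mult[OF \<phi> Ck_on_diff[OF xe Y] z]) (simp add: d dY grad[OF z] algebra_simps)
    qed
    have "pdir None (G None) z + (\<Sum>i\<in>UNIV. pdir (Some i) (G (Some i)) z)
      = \<phi> z * (pdir None edens z + (\<Sum>i\<in>UNIV. xi X T i z * pdir (Some i) edens z
        + edens z / (2 * (snd z - T))
        - (pdir (Some i) (stress i None) z + (\<Sum>k\<in>UNIV. xi X T k z * pdir (Some i) (stress i (Some k)) z)
         + stress i (Some i) z / (2 * (snd z - T))))) + pdir None \<phi> z * edens z
      + g z * ((\<Sum>i\<in>UNIV. xi X T i z * xi X T i z) * edens z - (\<Sum>i\<in>UNIV. xi X T i z * Yvec X T i z))"
      unfolding N S sum.distrib
      by (simp only: sum_distrib_left[symmetric] sum_subtractf sum_distrib_right[symmetric] distrib_left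
          mult.assoc add.assoc add.commute add.left_commute mult.commute)
    then show ?thesis
      unfolding divergence_flux[OF z zT] sum_xi_Yvec xi_norm by (simp add: radial_flux_def algebra_simps)
  qed
  have K: "cball X R \<times> {t1..t2} \<subseteq> spacetime" using t by (auto simp: spacetime_def)
  have "(LINT z:cball X R \<times> {t1..t2}|lborel. pdir None (G None) z + (\<Sum>i\<in>UNIV. pdir (Some i) (G (Some i)) z))
    = (LINT x:cball X R|lborel. G None (x, t2)) - (LINT x:cball X R|lborel. G None (x, t1))"
  proof (rule slab_divergence_theorem[OF open_spacetime _ t(2) CG])
    show "UNIV \<times> {t1..t2} \<subseteq> spacetime" using t by (auto simp: spacetime_def)
    show "G \<alpha> (x, t) = 0" if "(x, t) \<in> spacetime" "x \<notin> cball X R" for \<alpha> x t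
      using supp[OF that(1)] that(2) by (simp add: G_def split: option.split)
  qed
  moreover have "(LINT z:cball X R \<times> {t1..t2}|lborel. pdir None (G None) z + (\<Sum>i\<in>UNIV. pdir (Some i) (G (Some i)) z))
    = (LINT z:cball X R \<times> {t1..t2}|lborel. edens z * pdir None \<phi> z
      + g z * radial_flux X T z
      - \<phi> z * (Pdens X T z + Qdens X T z))"
  proof (rule set_lebesgue_integral_cong)
    have "closed (cball X R \<times> {t1..t2})" by (intro closed_Times) auto
    then show "cball X R \<times> {t1..t2} \<in> sets lborel" by simp
  qed (use div K in blast)
  ultimately show ?thesis by (simp add: G_def)
qed

end

section \<open>Heat kernel weights\<close>

text \<open>The logarithm of the heat ball density, defined by a formula that is smooth for \<open>t < T\<close>.\<close>

definition psi :: "real^'n \<Rightarrow> real \<Rightarrow> (real^'n::finite) \<times> real \<Rightarrow> real" where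
  "psi X T z = - ((real CARD('n) - 4) / 2) * ln (4 * pi * (T - snd z))
     - (norm (fst z - X))\<^sup>2 / (4 * (T - snd z))"

lemma heat_Phi_eq: "t < T \<Longrightarrow> heat_Phi X T x t = exp (psi X T (x, t))"
proof -
  assume t: "t < T"
  then have "(4 * pi * (T - t)) powr ((real CARD('a) - 4) / 2)
      = exp ((real CARD('a) - 4) / 2 * ln (4 * pi * (T - t)))"
    by (simp add: powr_def)
  moreover have "(norm (x - X))\<^sup>2 / (4 * (t - T)) = - ((norm (x - X))\<^sup>2 / (4 * (T - t)))"
    by (metis minus_diff_eq minus_divide_right mult_minus_right)
  moreover have "exp (- q) / exp r = exp (- r - q)" for q r :: real
    by (simp add: exp_diff exp_minus divide_inverse)
  ultimately show ?thesis
    unfolding heat_Phi_def psi_def by simp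
qed

lemma has_derivative_sqdist:
  "((\<lambda>z. (norm (fst z - X))\<^sup>2) has_derivative (\<lambda>h. 2 * ((fst z - X) \<bullet> fst h))) (at z)"
proof -
  have "((\<lambda>z. fst z - X) has_derivative fst) (at z)"
    by (rule has_derivative_eq_rhs, (rule derivative_intros)+) (simp add: fun_eq_iff)
  from has_derivative_inner[OF this this] show ?thesis
    by (simp add: power2_norm_eq_inner inner_commute)
qed

lemma has_derivative_psi:
  fixes z :: "(real^'n::finite) \<times> real"
  assumes "snd z < T"
  shows "(psi X T has_derivative (\<lambda>h. snd h * ((real CARD('n) - 4) / (2 * (T - snd z))
      - (norm (fst z - X))\<^sup>2 / (4 * (T - snd z)\<^sup>2)) - (fst z - X) \<bullet> fst h / (2 * (T - snd z)))) (at z)"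
proof -
  let ?m = "real CARD('n) - 4" and ?\<tau> = "T - snd z"
  have \<tau>: "?\<tau> > 0" using assms by simp
  have l: "((\<lambda>z. ln (4 * pi * (T - snd z))) has_derivative (\<lambda>h. - snd h / ?\<tau>)) (at z)"
  proof -
    have "((\<lambda>z. 4 * pi * (T - snd z)) has_derivative (\<lambda>h. - (4 * pi * snd h))) (at z)"
      by (rule has_derivative_eq_rhs, (rule derivative_intros)+) simp
    from has_derivative_compose[OF this DERIV_ln[unfolded has_field_derivative_def]]
    show ?thesis by (rule has_derivative_eq_rhs) (use \<tau> in \<open>simp_all add: fun_eq_iff divide_simps\<close>)
  qed
  have d: "((\<lambda>z. 4 * (T - snd z)) has_derivative (\<lambda>h. - 4 * snd h)) (at z)"
    by (rule has_derivative_eq_rhs, (rule derivative_intros)+) simp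
  have ne: "4 * ?\<tau> \<noteq> 0" using \<tau> by simp
  have alg: "- (m / 2) * (- k / r) - (2 * p * (4 * r) - q * (- 4 * k)) / (4 * r * (4 * r))
      = k * (m / (2 * r) - q / (4 * r\<^sup>2)) - p / (2 * r)" if "r > 0" for m k r p q :: real
    using that by (simp add: field_simps power2_eq_square)
  show ?thesis
    unfolding psi_def[abs_def] alg[OF \<tau>, symmetric]
    by (intro has_derivative_diff has_derivative_mult_right l
        has_derivative_divide'[OF has_derivative_sqdist d ne])
qed

lemma continuous_on_psi: "continuous_on {z. snd z < T} (psi X T)"
  by (intro continuous_at_imp_continuous_on ballI has_derivative_continuous[OF has_derivative_psi]) simp

context ymh_flow
begin

lemma continuous_on_psi': "b \<le> T \<Longrightarrow> continuous_on spacetime (psi X T)"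
  by (rule continuous_on_subset[OF continuous_on_psi]) (auto simp: spacetime_def)

text \<open>Since \<open>\<xi> \<cdot> Y\<close> pairs \<open>S\<close> and \<open>J\<close>, whose squares are part of \<open>Q\<close>, with the contractions of \<open>F\<close> and \<open>D u\<close>
  with \<open>\<xi>\<close>, whose squares are at most \<open>4 |\<xi>|\<^sup>2 e\<close> together, Young's inequality bounds it by \<open>Q\<close> and
  \<open>|\<xi>|\<^sup>2 e\<close> in any proportion.\<close>

lemma xiY_bound:
  assumes t: "snd z < T" and nn: "\<kappa> \<ge> 0" "\<alpha> \<ge> 0"
  shows "2 * \<kappa> * \<alpha> * \<bar>xiY X T z\<bar>
    \<le> \<kappa>\<^sup>2 * Qdens X T z + 4 * \<alpha>\<^sup>2 * ((norm (fst z - X))\<^sup>2 / (4 * (T - snd z)\<^sup>2)) * edens z"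
proof -
  let ?x2 = "(norm (fst z - X))\<^sup>2 / (4 * (T - snd z)\<^sup>2)"
  have sq: "(\<Sum>i\<in>UNIV. xi X T i z *\<^sub>R f i) \<bullet> (\<Sum>i\<in>UNIV. xi X T i z *\<^sub>R f i) \<le> ?x2 * (\<Sum>i\<in>UNIV. f i \<bullet> f i)"
    for f :: "'n \<Rightarrow> 'c::real_inner"
  proof -
    have "norm (\<Sum>i\<in>UNIV. xi X T i z *\<^sub>R f i) \<le> (\<Sum>i\<in>UNIV. \<bar>xi X T i z\<bar> * norm (f i))"
      using norm_sum[of "\<lambda>i. xi X T i z *\<^sub>R f i" UNIV] by simp
    then have "(norm (\<Sum>i\<in>UNIV. xi X T i z *\<^sub>R f i))\<^sup>2 \<le> (\<Sum>i\<in>UNIV. \<bar>xi X T i z\<bar> * norm (f i))\<^sup>2"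
      by (rule power_mono) simp
    also have "\<dots> \<le> (\<Sum>i\<in>UNIV. \<bar>xi X T i z\<bar>\<^sup>2) * (\<Sum>i\<in>UNIV. (norm (f i))\<^sup>2)"
      by (rule Cauchy_Schwarz_ineq_sum)
    also have "(\<Sum>i\<in>UNIV. \<bar>xi X T i z\<bar>\<^sup>2) = ?x2"
      using xi_norm[of X T z] by (simp add: power2_eq_square)
    finally show ?thesis by (simp only: power2_norm_eq_inner[of "f _"] dot_square_norm[symmetric])
  qed
  have mixed: "2 * \<kappa> * \<alpha> * \<bar>p \<bullet> q\<bar> \<le> \<kappa>\<^sup>2 * (q \<bullet> q) + \<alpha>\<^sup>2 * (p \<bullet> p)" for p q :: "'c::real_inner"
  proof -
    have "2 * \<kappa> * \<alpha> * \<bar>p \<bullet> q\<bar> \<le> 2 * \<kappa> * \<alpha> * (norm p * norm q)"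
      using Cauchy_Schwarz_ineq2[of p q] nn by (intro mult_left_mono) auto
    also have "\<dots> \<le> \<kappa>\<^sup>2 * (norm q)\<^sup>2 + \<alpha>\<^sup>2 * (norm p)\<^sup>2"
      using sum_squares_bound[of "\<kappa> * norm q" "\<alpha> * norm p"] by (simp add: algebra_simps power_mult_distrib)
    finally show ?thesis by (simp add: power2_norm_eq_inner)
  qed
  let ?D2 = "\<Sum>i\<in>UNIV. Du (Some i) z \<bullet> Du (Some i) z"
  let ?F2 = "\<Sum>i\<in>UNIV. \<Sum>j\<in>UNIV. F (Some i) (Some j) z \<bullet> F (Some i) (Some j) z"
  let ?SJ = "(\<Sum>j\<in>UNIV. SA X T j z \<bullet> SA X T j z) + Ju X T z \<bullet> Ju X T z"
  have "(\<Sum>j\<in>UNIV. xiF X T j z \<bullet> xiF X T j z)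
      \<le> (\<Sum>j\<in>UNIV. ?x2 * (\<Sum>i\<in>UNIV. F (Some i) (Some j) z \<bullet> F (Some i) (Some j) z))"
    unfolding xiF_def by (intro sum_mono sq)
  also have "\<dots> = ?x2 * ?F2" unfolding sum_distrib_left by (rule sum.swap)
  finally have "(\<Sum>j\<in>UNIV. xiF X T j z \<bullet> xiF X T j z) + xiD X T z \<bullet> xiD X T z \<le> ?x2 * ?F2 + ?x2 * ?D2"
    using sq[of "\<lambda>i. Du (Some i) z"] unfolding xiD_def by linarith
  also have "\<dots> = ?x2 * (?F2 + ?D2)" by (simp only: distrib_left)
  also have "\<dots> \<le> ?x2 * (4 * edens z)"
  proof (rule mult_left_mono)
    have "?D2 \<ge> 0" by (intro sum_nonneg) simp
    then show "?F2 + ?D2 \<le> 4 * edens z" using W_nonneg[of "field z \<bullet> field z"] by (simp add: edens_def)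
  qed simp
  finally have grad: "(\<Sum>j\<in>UNIV. xiF X T j z \<bullet> xiF X T j z) + xiD X T z \<bullet> xiD X T z \<le> ?x2 * (4 * edens z)" .
  have "\<bar>xiY X T z\<bar> \<le> (\<Sum>j\<in>UNIV. \<bar>xiF X T j z \<bullet> SA X T j z\<bar>) + \<bar>xiD X T z \<bullet> Ju X T z\<bar>"
    unfolding xiY_def using sum_abs[of "\<lambda>j. xiF X T j z \<bullet> SA X T j z" UNIV] by linarith
  then have "2 * \<kappa> * \<alpha> * \<bar>xiY X T z\<bar>
      \<le> 2 * \<kappa> * \<alpha> * ((\<Sum>j\<in>UNIV. \<bar>xiF X T j z \<bullet> SA X T j z\<bar>) + \<bar>xiD X T z \<bullet> Ju X T z\<bar>)"
    using nn by (intro mult_left_mono) auto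
  also have "\<dots> = (\<Sum>j\<in>UNIV. 2 * \<kappa> * \<alpha> * \<bar>xiF X T j z \<bullet> SA X T j z\<bar>) + 2 * \<kappa> * \<alpha> * \<bar>xiD X T z \<bullet> Ju X T z\<bar>"
    by (simp add: sum_distrib_left distrib_left)
  also have "\<dots> \<le> (\<Sum>j\<in>UNIV. \<kappa>\<^sup>2 * (SA X T j z \<bullet> SA X T j z) + \<alpha>\<^sup>2 * (xiF X T j z \<bullet> xiF X T j z))
      + (\<kappa>\<^sup>2 * (Ju X T z \<bullet> Ju X T z) + \<alpha>\<^sup>2 * (xiD X T z \<bullet> xiD X T z))"
    by (intro add_mono sum_mono mixed)
  also have "\<dots> = \<kappa>\<^sup>2 * ?SJ + \<alpha>\<^sup>2 * ((\<Sum>j\<in>UNIV. xiF X T j z \<bullet> xiF X T j z) + xiD X T z \<bullet> xiD X T z)"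
    by (simp add: sum.distrib sum_distrib_left distrib_left)
  also have "\<dots> \<le> \<kappa>\<^sup>2 * Qdens X T z + \<alpha>\<^sup>2 * (?x2 * (4 * edens z))"
  proof (intro add_mono mult_left_mono grad)
    have "?D2 \<ge> 0" by (intro sum_nonneg) simp
    then have "(?D2 + 4 * W (field z \<bullet> field z)) / (2 * (T - snd z)) \<ge> 0"
      using W_nonneg[of "field z \<bullet> field z"] t by simp
    then show "?SJ \<le> Qdens X T z" unfolding Qdens_def by simp
  qed simp_all
  finally show ?thesis by (simp add: algebra_simps)
qed

lemma Qdens_nonneg: "snd z < T \<Longrightarrow> Qdens X T z \<ge> 0"
  unfolding Qdens_def using W_nonneg
  by (intro add_nonneg_nonneg divide_nonneg_pos sum_nonneg mult_nonneg_nonneg) auto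

lemma Pdens_bound:
  assumes "snd z < T" "CARD('n) > 4"
  shows "\<bar>Pdens X T z\<bar> \<le> Qdens X T z / 2
    + ((real CARD('n) - 4) / (2 * (T - snd z)) + (norm (fst z - X))\<^sup>2 / (2 * (T - snd z)\<^sup>2)) * edens z"
proof -
  have "\<bar>xiY X T z\<bar> \<le> Qdens X T z / 2 + (norm (fst z - X))\<^sup>2 / (2 * (T - snd z)\<^sup>2) * edens z"
    using xiY_bound[OF assms(1), of 1 1 X] by simp
  moreover have "(real CARD('n) - 4) / (2 * (T - snd z)) * edens z \<ge> 0"
    using edens_nonneg[of z] assms by simp
  moreover have "Pdens X T z = (real CARD('n) - 4) / (2 * (T - snd z)) * edens z - xiY X T z"
    by (simp add: Pdens_def)
  ultimately show ?thesis unfolding distrib_right by linarith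
qed

text \<open>A weight \<open>H(\<psi>) q(|x - X|\<^sup>2)\<close>. The time derivative of \<open>\<psi>\<close> is exactly what turns \<open>e\<close> and \<open>\<xi> \<cdot> Y\<close>
  into the density \<open>P\<close>: \<open>P\<close> is the derivative of \<open>\<psi>\<close> along the flux field.\<close>

lemma weighted_identity:
  assumes bT: "b \<le> T" and t: "a < t1" "t1 \<le> t2" "t2 < b"
    and H: "\<And>s. (H has_real_derivative H' s) (at s)" "continuous_on UNIV H'"
    and q: "\<And>s. (q has_real_derivative q' s) (at s)" "continuous_on UNIV q'"
    and supp: "\<And>z. z \<in> spacetime \<Longrightarrow> fst z \<notin> cball X R \<Longrightarrow> H (psi X T z) * q ((norm (fst z - X))\<^sup>2) = 0"
  shows "(LINT z:cball X R \<times> {t1..t2}|lborel.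
      (H' (psi X T z) - H (psi X T z)) * q ((norm (fst z - X))\<^sup>2) * Pdens X T z
      - H (psi X T z) * q ((norm (fst z - X))\<^sup>2) * Qdens X T z
      - 4 * (T - snd z) * H (psi X T z) * q' ((norm (fst z - X))\<^sup>2) * radial_flux X T z)
    = (LINT x:cball X R|lborel. H (psi X T (x, t2)) * q ((norm (x - X))\<^sup>2) * edens (x, t2))
      - (LINT x:cball X R|lborel. H (psi X T (x, t1)) * q ((norm (x - X))\<^sup>2) * edens (x, t1))"
    (is "(LINT z:?K|lborel. ?I z) = _")
proof -
  define \<phi> where "\<phi> z = H (psi X T z) * q ((norm (fst z - X))\<^sup>2)" for z
  define g where "g z = H' (psi X T z) * q ((norm (fst z - X))\<^sup>2)
      - 4 * (T - snd z) * H (psi X T z) * q' ((norm (fst z - X))\<^sup>2)" for z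
  have zT: "snd z < T" if "z \<in> spacetime" for z using that bT by (auto simp: spacetime_def)
  define \<phi>' where "\<phi>' z h = H (psi X T z) * (2 * ((fst z - X) \<bullet> fst h) * q' ((norm (fst z - X))\<^sup>2))
      + (snd h * ((real CARD('n) - 4) / (2 * (T - snd z))
      - (norm (fst z - X))\<^sup>2 / (4 * (T - snd z)\<^sup>2)) - (fst z - X) \<bullet> fst h / (2 * (T - snd z)))
        * H' (psi X T z) * q ((norm (fst z - X))\<^sup>2)" for z h
  have d\<phi>: "(\<phi> has_derivative \<phi>' z) (at z)" if "z \<in> spacetime" for z
  proof -
    have "((\<lambda>z. H (psi X T z)) has_derivative (\<lambda>h. (snd h * ((real CARD('n) - 4) / (2 * (T - snd z))
      - (norm (fst z - X))\<^sup>2 / (4 * (T - snd z)\<^sup>2)) - (fst z - X) \<bullet> fst h / (2 * (T - snd z)))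
        * H' (psi X T z))) (at z)"
      using has_derivative_compose[OF has_derivative_psi[OF zT[OF that]] H(1)[unfolded has_field_derivative_def]]
      by (simp add: mult.commute)
    moreover have "((\<lambda>z. q ((norm (fst z - X))\<^sup>2)) has_derivative
        (\<lambda>h. (2 * ((fst z - X) \<bullet> fst h)) * q' ((norm (fst z - X))\<^sup>2))) (at z)"
      using has_derivative_compose[OF has_derivative_sqdist q(1)[unfolded has_field_derivative_def]]
      by (simp add: mult.commute)
    ultimately show ?thesis
      unfolding \<phi>_def[abs_def] \<phi>'_def[abs_def] by (rule has_derivative_mult)
  qed
  have cH: "continuous_on UNIV H" "continuous_on UNIV q"
    using H(1) q(1) by (auto intro!: continuous_at_imp_continuous_on DERIV_isCont)
  have ne: "snd z \<noteq> T" "T \<noteq> snd z" if "z \<in> spacetime" for z using zT[OF that] by auto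
  have C\<phi>: "Ck_on 1 spacetime \<phi>"
    unfolding One_nat_def
  proof (rule Ck_on_SucI[OF open_spacetime d\<phi>])
    show "Ck_on 0 spacetime (\<lambda>z. \<phi>' z v)" for v
      unfolding \<phi>'_def Ck_on.simps
      by (intro continuous_intros continuous_on_compose2[OF cH(1)] continuous_on_compose2[OF cH(2)]
          continuous_on_compose2[OF H(2)] continuous_on_compose2[OF q(2)] continuous_on_psi'[OF bT]) (use ne in auto)
  qed
  have grad: "pdir (Some i) \<phi> z = g z * xi X T i z" if z: "z \<in> spacetime" for i z
  proof -
    have x: "(fst z - X) $ i = - (2 * (T - snd z)) * xi X T i z"
      unfolding xi_def using ne[OF z] by (simp add: field_simps)
    have x2: "(fst z - X) $ i / (2 * (T - snd z)) = - xi X T i z"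
    proof -
      have "- (2 * r) * k / (2 * r) = - k" if "r \<noteq> 0" for r k :: real using that by simp
      from this[of "T - snd z"] show ?thesis unfolding x using ne[OF z] by simp
    qed
    have f: "(fst z - X) \<bullet> fst (dir (Some i)) = (fst z - X) $ i"
      by (simp add: inner_axis)
    show ?thesis
      unfolding pdir_eq[OF d\<phi>[OF z]] \<phi>'_def g_def f x2 unfolding x by (simp add: algebra_simps)
  qed
  have time: "pdir None \<phi> z = H' (psi X T z) * q ((norm (fst z - X))\<^sup>2)
      * ((real CARD('n) - 4) / (2 * (T - snd z)) - (norm (fst z - X))\<^sup>2 / (4 * (T - snd z)\<^sup>2))"
    if z: "z \<in> spacetime" for z
    unfolding pdir_eq[OF d\<phi>[OF z]] \<phi>'_def by simp
  have I: "?I z = edens z * pdir None \<phi> z + g z * radial_flux X T z - \<phi> z * (Pdens X T z + Qdens X T z)"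
    if z: "z \<in> spacetime" for z
  proof -
    have "(h - h0) * p * Pdens X T z - h0 * p * Qdens X T z - w * f
      = edens z * (h * p * (m - x2)) + (h * p - w) * f - h0 * p * (Pdens X T z + Qdens X T z)"
      if "m = (real CARD('n) - 4) / (2 * (T - snd z))" "f = x2 * edens z - xiY X T z" for h h0 p w m x2 f
      unfolding Pdens_def that(1)[symmetric] that(2) by (simp add: algebra_simps)
    then show ?thesis unfolding time[OF z] g_def \<phi>_def by (blast intro: radial_flux_def)
  qed
  have K: "?K \<subseteq> spacetime" using t by (auto simp: spacetime_def)
  have "closed ?K" by (intro closed_Times) auto
  then have "?K \<in> sets lborel" by simp
  then have "(LINT z:?K|lborel. ?I z) = (LINT z:?K|lborel. edens z * pdir None \<phi> z + g z * radial_flux X T z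
      - \<phi> z * (Pdens X T z + Qdens X T z))"
    by (rule set_lebesgue_integral_cong) (use I K in blast)
  also have "\<dots> = (LINT x:cball X R|lborel. \<phi> (x, t2) * edens (x, t2)) - (LINT x:cball X R|lborel. \<phi> (x, t1) * edens (x, t1))"
    by (rule slab_identity[OF bT t C\<phi> grad]) (use supp in \<open>auto simp: \<phi>_def\<close>)
  finally show ?thesis by (simp add: \<phi>_def)
qed

end

section \<open>Localised monotonicity of the weighted energy\<close>

lemma power_exp_minus_le: "0 \<le> x \<Longrightarrow> x ^ k * exp (- x) \<le> fact k" for x :: real
proof -
  assume x: "0 \<le> x"
  have "x ^ k / fact k = (\<Sum>i\<in>{k}. x ^ i / fact i)" by simp
  also have "\<dots> \<le> (\<Sum>i. x ^ i / fact i)"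
    by (rule sum_le_suminf[OF _ _ _]) (use x summable_exp_generic[of x] in \<open>auto simp: divide_inverse mult.commute\<close>)
  also have "\<dots> = exp x" by (simp add: exp_def divide_inverse mult.commute)
  finally show ?thesis by (simp add: exp_minus field_simps)
qed

text \<open>The cut-off \<open>(1 - (s/R\<^sup>2)\<^sup>k)\<^sub>+\<^sup>2\<close>, as a function of \<open>s = |x - X|\<^sup>2\<close>. Its derivative vanishes at the
  centre to the order \<open>k - 1\<close>, which compensates the singularity of the heat kernel there.\<close>

definition cutoff :: "nat \<Rightarrow> real \<Rightarrow> real \<Rightarrow> real" where
  "cutoff k R s = (max 0 (1 - (s / R\<^sup>2) ^ k))\<^sup>2"

definition cutoff' :: "nat \<Rightarrow> real \<Rightarrow> real \<Rightarrow> real" where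
  "cutoff' k R s = - 2 * max 0 (1 - (s / R\<^sup>2) ^ k) * (real k * (s / R\<^sup>2) ^ (k - 1) / R\<^sup>2)"

lemma has_derivative_max0_square:
  "((\<lambda>x. (max 0 x)\<^sup>2) has_real_derivative 2 * max 0 x) (at x)" for x :: real
proof -
  consider "x > 0" | "x < 0" | "x = 0" by linarith
  then show ?thesis
  proof cases
    case 1
    have "((\<lambda>x. x\<^sup>2) has_real_derivative 2 * x) (at x)" by (auto intro!: derivative_eq_intros)
    then have "((\<lambda>x. (max 0 x)\<^sup>2) has_real_derivative 2 * x) (at x)"
      by (rule has_field_derivative_transform_within_open[of _ _ _ "{0<..}"]) (use 1 in auto)
    with 1 show ?thesis by simp
  next
    case 2
    have "((\<lambda>x. 0) has_real_derivative 0) (at x)" by simp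
    then have "((\<lambda>x. (max 0 x)\<^sup>2) has_real_derivative 0) (at x)"
      by (rule has_field_derivative_transform_within_open[of _ _ _ "{..<0}"]) (use 2 in auto)
    with 2 show ?thesis by simp
  next
    case 3
    have "((\<lambda>h. (max 0 h)\<^sup>2 / h) \<longlongrightarrow> 0) (at (0::real))"
    proof (rule Lim_null_comparison)
      show "\<forall>\<^sub>F h in at 0. norm ((max 0 h)\<^sup>2 / h) \<le> \<bar>h\<bar>" for h :: real
        by (rule always_eventually) (auto simp: max_def power2_eq_square)
      show "((\<lambda>h::real. \<bar>h\<bar>) \<longlongrightarrow> 0) (at 0)" by (auto intro!: tendsto_eq_intros)
    qed
    then show ?thesis unfolding has_field_derivative_iff using 3 by simp
  qed
qed

lemma cutoff_has_derivative: "(cutoff k R has_real_derivative cutoff' k R s) (at s)"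
proof -
  have p: "((\<lambda>s. (s / R\<^sup>2) ^ k) has_real_derivative real k * (1 / R\<^sup>2 * (s / R\<^sup>2) ^ (k - Suc 0))) (at s)"
    by (rule DERIV_power[OF DERIV_cdivide[OF DERIV_ident]])
  have "((\<lambda>s. 1 - (s / R\<^sup>2) ^ k) has_real_derivative - (real k * (s / R\<^sup>2) ^ (k - 1) / R\<^sup>2)) (at s)"
    using DERIV_diff[OF DERIV_const[of 1] p] by (simp add: mult.commute)
  from DERIV_chain2[OF has_derivative_max0_square this]
  show ?thesis unfolding cutoff_def[abs_def] cutoff'_def by (simp add: mult.assoc)
qed

lemma continuous_cutoff: "continuous_on UNIV (cutoff k R)"
  using cutoff_has_derivative by (auto intro!: continuous_at_imp_continuous_on DERIV_isCont)

lemma continuous_cutoff': "continuous_on UNIV (cutoff' k R)"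
  unfolding cutoff'_def[abs_def] divide_inverse by (intro continuous_intros)

lemma cutoff_eq_0: "s \<ge> R\<^sup>2 \<Longrightarrow> R > 0 \<Longrightarrow> cutoff k R s = 0"
  unfolding cutoff_def using one_le_power[of "s / R\<^sup>2" k] by simp

lemma cutoff_nonneg: "cutoff k R s \<ge> 0" by (simp add: cutoff_def)

lemma cutoff_le_1: "s \<ge> 0 \<Longrightarrow> cutoff k R s \<le> 1"
  unfolding cutoff_def by (rule power_le_one) auto

lemma cutoff_ge: "0 \<le> s \<Longrightarrow> s \<le> R\<^sup>2 / 4 \<Longrightarrow> R > 0 \<Longrightarrow> k > 0 \<Longrightarrow> cutoff k R s \<ge> 1 / 4"
proof -
  assume s: "0 \<le> s" "s \<le> R\<^sup>2 / 4" "R > 0" "k > 0"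
  have q: "0 \<le> s / R\<^sup>2" "s / R\<^sup>2 \<le> 1 / 4" using s by (simp_all add: field_simps)
  have "(s / R\<^sup>2) ^ k \<le> s / R\<^sup>2" using power_decreasing[of 1 k "s / R\<^sup>2"] q s(4) by simp
  then have "1 / 2 \<le> max 0 (1 - (s / R\<^sup>2) ^ k)" using q by linarith
  from power_mono[OF this, of 2] show ?thesis unfolding cutoff_def by (simp add: power2_eq_square)
qed

text \<open>The factor of \<open>e\<close> in the error of the cut-off at distance \<open>s\<^sup>\<onehalf>\<close> from the centre and \<open>\<tau>\<close> before its
  time: the heat kernel times the terms with a derivative of the cut-off.\<close>

definition cutoff_error :: "nat \<Rightarrow> real \<Rightarrow> real \<Rightarrow> real \<Rightarrow> real" where
  "cutoff_error n R \<tau> s = exp (- ((real n - 4) / 2) * ln (4 * pi * \<tau>) - s / (4 * \<tau>))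
    * (real n * (s / R\<^sup>2) ^ n / \<tau> * (2 + 32 * real n * \<tau> / R\<^sup>2))"

text \<open>The error stays bounded up to the singular time, because \<open>s\<^sup>n exp (- s / (4 \<tau>)) \<le> n! (4 \<tau>)\<^sup>n\<close> outweighs
  the negative powers of \<open>\<tau>\<close>.\<close>

lemma cutoff_error_bounded:
  fixes n :: nat and R \<tau>m :: real
  assumes n: "n > 4"
  shows "\<exists>B\<ge>0. \<forall>\<tau>\<in>{0<..\<tau>m}. \<forall>s\<ge>0. cutoff_error n R \<tau> s \<le> B"
proof -
  define m where "m = (real n - 4) / 2"
  have m: "m > 0" using n by (simp add: m_def)
  (* n - 1 - m is positive, so the remaining power of \<tau> is largest at the upper end \<tau>m. *)
  define B where "B = exp ((real n - 1 - m) * ln (4 * \<bar>\<tau>m\<bar>)) * 4 * fact n * (real n / (R\<^sup>2) ^ n)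
      * (2 + 32 * real n * \<bar>\<tau>m\<bar> / R\<^sup>2)"
  have "cutoff_error n R \<tau> s \<le> B" if \<tau>: "0 < \<tau>" "\<tau> \<le> \<tau>m" and s: "0 \<le> s" for \<tau> s
  proof -
    have 1: "exp (- m * ln (4 * pi * \<tau>)) * (4 * \<tau>) ^ (n - 1) \<le> exp ((real n - 1 - m) * ln (4 * \<bar>\<tau>m\<bar>))"
    proof -
      have "ln (4 * \<tau>) \<le> ln (4 * pi * \<tau>)" using \<tau> pi_ge_two by simp
      then have "exp (- m * ln (4 * pi * \<tau>)) \<le> exp (- m * ln (4 * \<tau>))" using m by simp
      moreover have "(4 * \<tau>) ^ (n - 1) = exp ((real n - 1) * ln (4 * \<tau>))"
        using \<tau> n exp_of_nat_mult[of "n - 1" "ln (4 * \<tau>)"] by (simp add: of_nat_diff)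
      ultimately have "exp (- m * ln (4 * pi * \<tau>)) * (4 * \<tau>) ^ (n - 1)
          \<le> exp (- m * ln (4 * \<tau>)) * exp ((real n - 1) * ln (4 * \<tau>))" by simp
      also have "\<dots> = exp ((real n - 1 - m) * ln (4 * \<tau>))"
        by (simp add: exp_add[symmetric] algebra_simps)
      also have "\<dots> \<le> exp ((real n - 1 - m) * ln (4 * \<bar>\<tau>m\<bar>))"
        using \<tau> n unfolding exp_le_cancel_iff by (intro mult_left_mono) (auto simp: m_def)
      finally show ?thesis .
    qed
    have n1: "(4 * \<tau>) ^ n = 4 * \<tau> * (4 * \<tau>) ^ (n - 1)" using n by (metis gr_implies_not0 power_eq_if)
    define x where "x = s / (4 * \<tau>)"
    have sx: "s = 4 * \<tau> * x" and x: "x \<ge> 0" using \<tau> s unfolding x_def by auto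
    have alg: "c * E * (n' * (4 * \<tau> * Y * Z / RR) / \<tau> * K) = (c * Y) * (4 * (Z * E) * (n' / RR)) * K"
      for c E n' Y Z RR K :: real using \<tau>(1) by simp
    have "exp (- m * ln (4 * pi * \<tau>) - x) * (real n * (s / R\<^sup>2) ^ n / \<tau> * (2 + 32 * real n * \<tau> / R\<^sup>2))
        = (exp (- m * ln (4 * pi * \<tau>)) * (4 * \<tau>) ^ (n - 1)) * (4 * (x ^ n * exp (- x)) * (real n / (R\<^sup>2) ^ n))
          * (2 + 32 * real n * \<tau> / R\<^sup>2)"
      unfolding sx power_divide power_mult_distrib[of "4 * \<tau>"] n1 diff_conv_add_uminus exp_add
      by (rule alg)
    also have "\<dots> \<le> (exp ((real n - 1 - m) * ln (4 * \<bar>\<tau>m\<bar>))) * (4 * fact n * (real n / (R\<^sup>2) ^ n))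
          * (2 + 32 * real n * \<bar>\<tau>m\<bar> / R\<^sup>2)"
      using \<tau> x by (intro mult_mono add_mono order_refl 1 power_exp_minus_le divide_right_mono)
        (auto intro!: mult_nonneg_nonneg divide_nonneg_nonneg add_nonneg_nonneg)
    also have "\<dots> = B" by (simp add: B_def)
    finally show ?thesis unfolding cutoff_error_def m_def x_def .
  qed
  moreover have "B \<ge> 0" unfolding B_def by (intro mult_nonneg_nonneg add_nonneg_nonneg) auto
  ultimately show ?thesis by auto
qed

definition local_kernel :: "real \<Rightarrow> real^'n \<Rightarrow> real \<Rightarrow> (real^'n::finite) \<times> real \<Rightarrow> real" where
  "local_kernel R X T z = exp (psi X T z) * cutoff CARD('n) R ((norm (fst z - X))\<^sup>2)"

lemma local_kernel_nonneg: "local_kernel R X T z \<ge> 0"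
  by (simp add: local_kernel_def cutoff_nonneg)

lemma local_kernel_le: "local_kernel R X T z \<le> exp (psi X T z)"
  unfolding local_kernel_def using cutoff_le_1 by (simp add: mult_left_le)

lemma local_kernel_ge:
  assumes "R > 0" "fst z \<in> cball X (R / 2)"
  shows "exp (psi X T z) / 4 \<le> local_kernel R X T z"
proof -
  have "norm (fst z - X) \<le> R / 2" using assms(2) by (simp add: dist_norm norm_minus_commute)
  then have "(norm (fst z - X))\<^sup>2 \<le> (R / 2)\<^sup>2" by (intro power_mono) auto
  then have "1 / 4 \<le> cutoff CARD('a) R ((norm (fst z - X))\<^sup>2)"
    using assms(1) by (intro cutoff_ge) (auto simp: power_divide)
  then have "exp (psi X T z) * (1 / 4) \<le> local_kernel R X T z"
    unfolding local_kernel_def by (intro mult_left_mono) auto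
  then show ?thesis by simp
qed

lemma smooth_on_subset: "smooth_on S f \<Longrightarrow> S' \<subseteq> S \<Longrightarrow> smooth_on S' f"
  unfolding smooth_on_def
proof
  fix x
  assume *: "\<forall>x\<in>S. \<exists>U g. open U \<and> x \<in> U \<and> (\<forall>k. Ck_on k U g) \<and> (\<forall>y\<in>S \<inter> U. g y = f y)"
    and S': "S' \<subseteq> S" and "x \<in> S'"
  then obtain U g where "open U" "x \<in> U" "\<forall>k. Ck_on k U g" "\<forall>y\<in>S \<inter> U. g y = f y"
    by (meson subsetD)
  with S' show "\<exists>U g. open U \<and> x \<in> U \<and> (\<forall>k. Ck_on k U g) \<and> (\<forall>y\<in>S' \<inter> U. g y = f y)"
    by (intro exI[of _ U] exI[of _ g]) auto
qed

context ymh_flow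
begin

lemma restrict_time:
  assumes "b' \<le> b"
  shows "ymh_flow br act W a b' A u"
proof unfold_locales
  have sub: "smooth_on (UNIV \<times> {a..<b'}) f" if "smooth_on (UNIV \<times> {a..<b}) f"
    for f :: "(real^'n) \<times> real \<Rightarrow> 'c::real_normed_vector"
    by (rule smooth_on_subset[OF that]) (use assms in auto)
  have pair: "smooth_on (UNIV \<times> {a..<b}) (\<lambda>(x, t). A t i x)" "smooth_on (UNIV \<times> {a..<b}) (\<lambda>(x, t). u t x)" for i
    using smooth unfolding smooth_family_def by auto
  show "smooth_family a b' A u"
    unfolding smooth_family_def by (intro conjI allI sub pair)
  show "YMH_flow br act W a b' A u"
    unfolding YMH_flow_def
  proof (intro allI ballI)
    fix x t assume "t \<in> {a<..<b'}"
    then have "t \<in> {a<..<b}" using assms by auto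
    then show "(\<forall>j. vector_derivative (\<lambda>s. A s j x) (at t) =
               (\<Sum>i\<in>UNIV. nabla br (A t) i (curv br (A t) i j) x)
               - odot act (u t x) (covD act (A t) j (u t) x)) \<and>
        vector_derivative (\<lambda>s. u s x) (at t) =
          (\<Sum>i\<in>UNIV. covD act (A t) i (covD act (A t) i (u t)) x)
          - (2 * deriv W ((norm (u t x))\<^sup>2)) *\<^sub>R u t x"
      by (rule flow[unfolded YMH_flow_def, THEN spec, THEN bspec])
  qed
qed (rule W_C1 W_nonneg)+

lemma set_integrable_continuous:
  fixes f :: "(real^'n) \<times> real \<Rightarrow> real"
  assumes "continuous_on spacetime f" "a < t1" "t2 < b"
  shows "set_integrable lborel (cball X R \<times> {t1..t2}) f"
  unfolding set_integrable_def
  by (rule borel_integrable_compact)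
    (use assms in \<open>auto intro!: compact_Times continuous_on_subset[OF assms(1)] simp: spacetime_def\<close>)

lemma set_integrable_slice:
  fixes f :: "(real^'n) \<times> real \<Rightarrow> real"
  assumes "continuous_on spacetime f" "a < t" "t < b"
  shows "set_integrable lborel (cball X R) (\<lambda>x. f (x, t))"
  unfolding set_integrable_def
  by (rule borel_integrable_compact)
    (use assms in \<open>auto intro!: continuous_on_compose2[OF assms(1)] continuous_intros simp: spacetime_def\<close>)

text \<open>Struwe's monotonicity: with the weight \<open>exp \<psi>\<close> itself the term in \<open>P\<close> drops out, and the cut-off
  costs only a multiple of the space-time energy, since half of \<open>Q\<close> absorbs the mixed term.\<close>

lemma continuous_on_local_kernel: "b \<le> T \<Longrightarrow> continuous_on spacetime (local_kernel R X T)"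
  unfolding local_kernel_def[abs_def]
  by (intro continuous_intros continuous_on_compose2[OF continuous_cutoff] continuous_on_psi') auto

lemma monotonicity:
  assumes bT: "b \<le> T" and t: "a < t1" "t1 \<le> t2" "t2 < b" and R: "R > 0" and n: "CARD('n) > 4"
    and B: "\<forall>\<tau>\<in>{0<..T - t1}. \<forall>s\<ge>0. cutoff_error CARD('n) R \<tau> s \<le> B"
  shows "(LINT x:cball X R|lborel. local_kernel R X T (x, t2) * edens (x, t2))
     + (LINT z:cball X R \<times> {t1..t2}|lborel. local_kernel R X T z * Qdens X T z) / 2
    \<le> (LINT x:cball X R|lborel. local_kernel R X T (x, t1) * edens (x, t1))
     + B * (LINT z:cball X R \<times> {t1..t2}|lborel. edens z)"
proof -
  let ?n = "CARD('n)" and ?K = "cball X R \<times> {t1..t2}"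
  let ?q = "cutoff ?n R" and ?q' = "cutoff' ?n R" and ?s = "\<lambda>z. (norm (fst z - X))\<^sup>2"
  let ?x2 = "\<lambda>z. ?s z / (4 * (T - snd z)\<^sup>2)"
  let ?kQ = "\<lambda>z. local_kernel R X T z * Qdens X T z"
  let ?I = "\<lambda>z. (exp (psi X T z) - exp (psi X T z)) * ?q (?s z) * Pdens X T z
      - exp (psi X T z) * ?q (?s z) * Qdens X T z
      - 4 * (T - snd z) * exp (psi X T z) * ?q' (?s z) * radial_flux X T z"
  have supp: "exp (psi X T z) * ?q (?s z) = 0" if "z \<in> spacetime" "fst z \<notin> cball X R" for z
  proof -
    have "R \<le> norm (fst z - X)" using that(2) by (simp add: dist_norm norm_minus_commute)
    then have "R\<^sup>2 \<le> ?s z" using R by (intro power_mono) auto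
    then show ?thesis using cutoff_eq_0[OF _ R] by simp
  qed
  have expd: "(exp has_real_derivative exp s) (at s)" for s :: real by (auto intro!: derivative_eq_intros)
  have id: "(LINT z:?K|lborel. ?I z) = (LINT x:cball X R|lborel. local_kernel R X T (x, t2) * edens (x, t2))
      - (LINT x:cball X R|lborel. local_kernel R X T (x, t1) * edens (x, t1))"
    unfolding local_kernel_def fst_conv
    by (rule weighted_identity[OF bT t expd continuous_on_exp[OF continuous_on_id]
          cutoff_has_derivative continuous_cutoff' supp])
  have zT: "snd z < T" if "z \<in> spacetime" for z using that bT by (auto simp: spacetime_def)
  have K: "?K \<subseteq> spacetime" using t by (auto simp: spacetime_def)
  have ne: "T \<noteq> snd z" if "z \<in> spacetime" for z using zT[OF that] by auto
  have cQ: "continuous_on spacetime ?kQ"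
    by (intro continuous_intros continuous_on_local_kernel continuous_on_Qdens bT)
  have cL: "continuous_on spacetime ?I"
    unfolding radial_flux_def
    by (intro continuous_intros continuous_on_compose2[OF continuous_cutoff] continuous_on_compose2[OF continuous_cutoff']
        continuous_on_psi' continuous_on_Qdens continuous_on_Pdens continuous_on_xiY continuous_on_edens bT)
      (use ne in auto)
  have pointwise: "?I z \<le> B * edens z - ?kQ z / 2" if z: "z \<in> ?K" for z
  proof -
    define \<tau> where "\<tau> = T - snd z"
    define \<kappa> where "\<kappa> = max 0 (1 - (?s z / R\<^sup>2) ^ ?n)"
    define d where "d = real ?n * (?s z / R\<^sup>2) ^ (?n - 1) / R\<^sup>2"
    define E where "E = exp (psi X T z)"
    have zs: "z \<in> spacetime" using z K by blast
    have \<tau>: "\<tau> > 0" "\<tau> \<le> T - t1" using zT[OF zs] z by (auto simp: \<tau>_def mem_Times_iff)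
    have s: "0 \<le> ?s z" "?s z \<le> R\<^sup>2"
    proof -
      have "norm (fst z - X) \<le> R" using z by (auto simp: mem_Times_iff dist_norm norm_minus_commute)
      then show "?s z \<le> R\<^sup>2" by (intro power_mono) auto
    qed simp
    have sR: "0 \<le> ?s z / R\<^sup>2" "?s z / R\<^sup>2 \<le> 1" using s R by auto
    have \<kappa>: "0 \<le> \<kappa>" "\<kappa> \<le> 1" using sR by (auto simp: \<kappa>_def)
    have d: "0 \<le> d" "d \<le> real ?n / R\<^sup>2"
    proof -
      have "(?s z / R\<^sup>2) ^ (?n - 1) \<le> 1" using sR by (intro power_le_one) auto
      then show "d \<le> real ?n / R\<^sup>2" unfolding d_def using R by (intro divide_right_mono) (auto simp: mult_left_le)
      show "0 \<le> d" unfolding d_def using sR by (intro divide_nonneg_nonneg mult_nonneg_nonneg) auto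
    qed
    have q: "?q (?s z) = \<kappa>\<^sup>2" "?q' (?s z) = - 2 * \<kappa> * d"
      by (simp_all add: cutoff_def cutoff'_def \<kappa>_def d_def)
    have sd: "?s z * d = real ?n * (?s z / R\<^sup>2) ^ ?n"
      unfolding d_def using n power_eq_if[of "?s z / R\<^sup>2" ?n] by (simp add: field_simps)
    have e: "edens z \<ge> 0" by (rule edens_nonneg)
    (* The cut-off contributes the gradient term with factor 8 \<tau> \<kappa> d. Young's inequality with the
       weights \<kappa> and 8 \<tau> d spends exactly half of \<kappa>\<^sup>2 Q on it. *)
    have "\<kappa> * (8 * \<tau> * d) * \<bar>xiY X T z\<bar> \<le> \<kappa>\<^sup>2 * Qdens X T z / 2 + 128 * \<tau>\<^sup>2 * d\<^sup>2 * ?x2 z * edens z"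
      using xiY_bound[OF zT[OF zs] \<kappa>(1), of "8 * \<tau> * d" X] \<tau> d by (simp add: power_mult_distrib)
    moreover have "\<kappa> * (8 * \<tau> * d) * - xiY X T z \<le> \<kappa> * (8 * \<tau> * d) * \<bar>xiY X T z\<bar>"
      using \<kappa> \<tau> d by (intro mult_left_mono) auto
    moreover have "\<kappa> * (8 * \<tau> * d) * (?x2 z * edens z) \<le> 1 * (8 * \<tau> * d) * (?x2 z * edens z)"
      using \<kappa> \<tau> d e s by (intro mult_right_mono) auto
    moreover have "8 * \<tau> * d * (?x2 z * edens z) + 128 * \<tau>\<^sup>2 * d\<^sup>2 * ?x2 z * edens z
      \<le> real ?n * (?s z / R\<^sup>2) ^ ?n / \<tau> * (2 + 32 * real ?n * \<tau> / R\<^sup>2) * edens z"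
    proof -
      have "8 * \<tau> * d * (?x2 z * edens z) + 128 * \<tau>\<^sup>2 * d\<^sup>2 * ?x2 z * edens z
        = (?s z * d) / \<tau> * (2 + 32 * \<tau> * d) * edens z"
      proof -
        have "8 * r * d * (s / (4 * r\<^sup>2) * e) + 128 * r\<^sup>2 * d\<^sup>2 * (s / (4 * r\<^sup>2)) * e
          = (s * d) / r * (2 + 32 * r * d) * e" if "r > 0" for r s e :: real
          using that by (simp add: field_simps power2_eq_square)
        from this[OF \<tau>(1)] show ?thesis unfolding \<tau>_def .
      qed
      also have "\<dots> \<le> (?s z * d) / \<tau> * (2 + 32 * \<tau> * (real ?n / R\<^sup>2)) * edens z"
        using \<tau> d e s by (intro mult_right_mono mult_left_mono add_mono divide_nonneg_nonneg mult_nonneg_nonneg) auto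
      also have "32 * \<tau> * (real ?n / R\<^sup>2) = 32 * real ?n * \<tau> / R\<^sup>2" by simp
      finally show ?thesis unfolding sd .
    qed
    moreover have "8 * \<tau> * \<kappa> * d * radial_flux X T z
        = \<kappa> * (8 * \<tau> * d) * (?x2 z * edens z) + \<kappa> * (8 * \<tau> * d) * - xiY X T z"
      unfolding radial_flux_def by (simp only: right_diff_distrib) (simp add: mult_ac)
    ultimately have "- \<kappa>\<^sup>2 * Qdens X T z + 8 * \<tau> * \<kappa> * d * radial_flux X T z
      \<le> real ?n * (?s z / R\<^sup>2) ^ ?n / \<tau> * (2 + 32 * real ?n * \<tau> / R\<^sup>2) * edens z - \<kappa>\<^sup>2 * Qdens X T z / 2"
      by linarith
    then have "E * (- \<kappa>\<^sup>2 * Qdens X T z + 8 * \<tau> * \<kappa> * d * radial_flux X T z)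
      \<le> E * (real ?n * (?s z / R\<^sup>2) ^ ?n / \<tau> * (2 + 32 * real ?n * \<tau> / R\<^sup>2) * edens z - \<kappa>\<^sup>2 * Qdens X T z / 2)"
      by (rule mult_left_mono) (simp add: E_def)
    also have "\<dots> = (E * (real ?n * (?s z / R\<^sup>2) ^ ?n / \<tau> * (2 + 32 * real ?n * \<tau> / R\<^sup>2))) * edens z
        - E * \<kappa>\<^sup>2 * Qdens X T z / 2" by (simp add: algebra_simps)
    also have "\<dots> \<le> B * edens z - E * \<kappa>\<^sup>2 * Qdens X T z / 2"
    proof (intro diff_right_mono mult_right_mono e)
      have "cutoff_error ?n R \<tau> (?s z) \<le> B" using B \<tau> s(1) by auto
      then show "E * (real ?n * (?s z / R\<^sup>2) ^ ?n / \<tau> * (2 + 32 * real ?n * \<tau> / R\<^sup>2)) \<le> B"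
        by (simp only: cutoff_error_def E_def psi_def \<tau>_def)
    qed
    finally show ?thesis
      unfolding local_kernel_def q E_def[symmetric] \<tau>_def[symmetric] by (simp add: algebra_simps)
  qed
  have "(LINT z:?K|lborel. ?I z) \<le> (LINT z:?K|lborel. B * edens z - ?kQ z / 2)"
  proof (rule set_integral_mono)
    show "set_integrable lborel ?K (\<lambda>z. B * edens z - ?kQ z / 2)"
      by (intro set_integrable_continuous t continuous_intros continuous_on_edens cQ) simp
  qed (rule set_integrable_continuous[OF cL t(1,3)], rule pointwise)
  also have "\<dots> = (LINT z:?K|lborel. B * edens z) - (LINT z:?K|lborel. ?kQ z / 2)"
    by (intro set_integral_diff set_integrable_continuous t continuous_intros continuous_on_edens cQ) simp
  also have "\<dots> = B * (LINT z:?K|lborel. edens z) - (LINT z:?K|lborel. ?kQ z) / 2"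
    by simp
  finally show ?thesis unfolding id by linarith
qed

end

section \<open>Heat balls\<close>

lemma psi_add_ln:
  fixes x :: "real^'n::finite"
  assumes "r > 0" "t < T"
  shows "psi X T (x, t) + (real CARD('n) - 4) * ln r
    = (real CARD('n) - 4) / 2 * ln (r\<^sup>2 / (4 * pi * (T - t))) - (norm (x - X))\<^sup>2 / (4 * (T - t))"
proof -
  have "ln (r\<^sup>2 / (4 * pi * (T - t))) = 2 * ln r - ln (4 * pi * (T - t))"
    using assms by (simp add: ln_div ln_realpow)
  moreover have "- (m / 2) * B - q + m * l = m / 2 * (2 * l - B) - q" for m B q l :: real
    by (simp add: algebra_simps)
  ultimately show ?thesis unfolding psi_def fst_conv snd_conv by simp
qed

lemma mem_heat_ball_iff:
  fixes x :: "real^'n::finite"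
  assumes "r > 0"
  shows "(x, t) \<in> heat_ball X T r \<longleftrightarrow> t < T \<and> psi X T (x, t) + (real CARD('n) - 4) * ln r > 0"
proof -
  have "heat_Phi X T x t > r powr (- (real CARD('n) - 4)) \<longleftrightarrow> psi X T (x, t) + (real CARD('n) - 4) * ln r > 0"
    if "t < T"
  proof -
    have "r powr (- (real CARD('n) - 4)) = exp (- (real CARD('n) - 4) * ln r)"
      using assms by (simp add: powr_def)
    then show ?thesis unfolding heat_Phi_eq[OF that] by (simp only: exp_less_cancel_iff) linarith
  qed
  then show ?thesis unfolding heat_ball_def by auto
qed

text \<open>Heat balls have radius at most \<open>c\<^sub>n r\<close>: the slice radius \<open>2 (n - 4) \<tau> ln (r\<^sup>2 / (4 \<pi> \<tau>))\<close> is
  largest at \<open>4 \<pi> \<tau> = r\<^sup>2 / e\<close>.\<close>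

lemma heat_radius_le:
  fixes n :: nat
  assumes "r > 0" "\<tau> > 0" "n > 4"
  shows "2 * (real n - 4) * \<tau> * ln (r\<^sup>2 / (4 * pi * \<tau>)) \<le> (heat_const n * r)\<^sup>2"
proof -
  define v where "v = r\<^sup>2 / (4 * pi * \<tau>)"
  have v: "v > 0" using assms unfolding v_def by simp
  have "ln v = ln (v / exp 1) + 1" using v by (simp add: ln_div)
  also have "\<dots> \<le> v / exp 1" using ln_le_minus_one[of "v / exp 1"] v by simp
  finally have "2 * (real n - 4) * \<tau> * ln v \<le> 2 * (real n - 4) * \<tau> * (v / exp 1)"
    using assms by (intro mult_left_mono) auto
  also have "\<dots> = (heat_const n * r)\<^sup>2"
    unfolding v_def heat_const_def using assms by (simp add: power_mult_distrib field_simps)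
  finally show ?thesis unfolding v_def .
qed

lemma set_integral_mono_set:
  fixes f :: "'a \<Rightarrow> real"
  assumes "set_integrable M B f" "A \<in> sets M" "A \<subseteq> B" "\<And>x. x \<in> B \<Longrightarrow> 0 \<le> f x"
  shows "(LINT x:A|M. f x) \<le> (LINT x:B|M. f x)"
proof -
  have "set_integrable M A f" by (rule set_integrable_subset[OF assms(1-3)])
  then show ?thesis
    using assms unfolding set_integrable_def set_lebesgue_integral_def
    by (intro integral_mono) (auto simp: indicator_def)
qed

lemma set_integrable_time_exhaustion:
  fixes f :: "'a::euclidean_space \<times> real \<Rightarrow> real"
  assumes K: "K \<in> sets borel" and t: "t1 < T"
    and int: "\<And>t2. t1 \<le> t2 \<Longrightarrow> t2 < T \<Longrightarrow> set_integrable lborel (K \<times> {t1..t2}) f"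
    and bound: "\<And>t2. t1 \<le> t2 \<Longrightarrow> t2 < T \<Longrightarrow> (LINT z:K \<times> {t1..t2}|lborel. f z) \<le> C"
    and nn: "\<And>z. z \<in> K \<times> {t1..<T} \<Longrightarrow> 0 \<le> f z"
  shows "set_integrable lborel (K \<times> {t1..<T}) f"
proof -
  define s where "s k = T - (T - t1) / (real k + 1)" for k :: nat
  have s: "t1 \<le> s k" "s k < T" for k
    unfolding s_def using t by (auto simp: field_simps mult_right_mono)
  have mono: "s k \<le> s l" if "k \<le> l" for k l
    unfolding s_def using t that by (intro diff_left_mono divide_left_mono) auto
  have lim: "s \<longlonglongrightarrow> T"
    unfolding s_def using t by real_asymp
  let ?f = "\<lambda>k z. indicator (K \<times> {t1..s k}) z *\<^sub>R f z"
  have le: "?f k z \<le> ?f l z" if "k \<le> l" for k l z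
    using mono[OF that] nn[of z] s[of k] s[of l] by (auto simp: indicator_def)
  have inc: "incseq (\<lambda>k. LINT z|lborel. ?f k z)"
    by (intro monoI integral_mono) (use int[unfolded set_integrable_def] s le in auto)
  have "\<forall>k. (LINT z|lborel. ?f k z) \<le> C"
    using bound[unfolded set_lebesgue_integral_def] s by blast
  from incseq_convergent[OF inc this] obtain l where l: "(\<lambda>k. LINT z|lborel. ?f k z) \<longlonglongrightarrow> l" by blast
  have pw: "(\<lambda>k. ?f k z) \<longlonglongrightarrow> indicator (K \<times> {t1..<T}) z *\<^sub>R f z" for z
  proof (cases "z \<in> K \<times> {t1..<T}")
    case True
    then have "\<forall>\<^sub>F k in sequentially. snd z < s k"
      using order_tendstoD(1)[OF lim, of "snd z"] by auto
    then have "\<forall>\<^sub>F k in sequentially. ?f k z = indicator (K \<times> {t1..<T}) z *\<^sub>R f z"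
      by eventually_elim (use True in \<open>auto simp: indicator_def mem_Times_iff\<close>)
    then show ?thesis by (rule tendsto_eventually)
  next
    case False
    then have "?f k z = indicator (K \<times> {t1..<T}) z *\<^sub>R f z" for k
      using s[of k] by (auto simp: indicator_def mem_Times_iff)
    then show ?thesis by (simp only: tendsto_const)
  qed
  have meas: "(\<lambda>z. indicator (K \<times> {t1..<T}) z *\<^sub>R f z) \<in> borel_measurable lborel"
    by (rule borel_measurable_LIMSEQ_real[OF pw])
      (use int[OF s, unfolded set_integrable_def] in \<open>rule borel_measurable_integrable\<close>)
  show ?thesis
    unfolding set_integrable_def
    by (rule integrable_monotone_convergence[of _ ?f, OF _ _ _ l meas])
      (use int[unfolded set_integrable_def] s le pw in \<open>auto simp: mono_def\<close>)
qed

lemma nn_integral_powr_minus_three_quarters: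
  fixes K t0 T :: real
  assumes "t0 < T" "K \<ge> 0"
  shows "(\<integral>\<^sup>+ t. ennreal (K * (T - t) powr (- 3 / 4) * indicator {t0<..<T} t) \<partial>lborel) < \<infinity>"
proof -
  let ?g = "\<lambda>x::real. K * (x powr (- 3 / 4) * indicator {0..T - t0} x)"
  have "((\<lambda>x. x powr (- 3 / 4)) has_integral ((T - t0) powr (- 3 / 4 + 1) / (- 3 / 4 + 1))) {0..T - t0}"
    by (rule has_integral_powr_from_0) (use assms in auto)
  then have "((\<lambda>x. if x \<in> {0..T - t0} then x powr (- 3 / 4) else 0) has_integral
      ((T - t0) powr (- 3 / 4 + 1) / (- 3 / 4 + 1))) UNIV"
    by (simp only: has_integral_restrict_UNIV)
  also have "(\<lambda>x. if x \<in> {0..T - t0} then x powr (- 3 / 4) else 0)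
      = (\<lambda>x. x powr (- 3 / 4) * indicator {0..T - t0} x)" by (auto simp: indicator_def)
  finally have "(?g has_integral (K * ((T - t0) powr (- 3 / 4 + 1) / (- 3 / 4 + 1)))) UNIV"
    by (rule has_integral_mult_right)
  from nn_integral_has_integral_lborel[OF _ _ this] have fin: "(\<integral>\<^sup>+ x. ennreal (?g x) \<partial>lborel) < \<infinity>"
    using assms by simp
  have "(\<integral>\<^sup>+ t. ennreal (K * (T - t) powr (- 3 / 4) * indicator {t0<..<T} t) \<partial>lborel)
      \<le> (\<integral>\<^sup>+ t. ennreal (?g (T + (- 1) * t)) \<partial>lborel)"
    by (rule nn_integral_mono) (use assms in \<open>auto simp: indicator_def\<close>)
  also have "\<dots> = (\<integral>\<^sup>+ x. ennreal (?g x) \<partial>lborel)"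
    using nn_integral_real_affine[of "\<lambda>x. ennreal (?g x)" "-1" T] by simp
  finally show ?thesis using fin by simp
qed

section \<open>Integrability up to the singular time\<close>

locale ymh_finite_energy = ymh_flow br act W a T A u
  for br :: "'l::euclidean_space \<Rightarrow> 'l \<Rightarrow> 'l"
    and act :: "'l \<Rightarrow> 'v::euclidean_space \<Rightarrow> 'v"
    and W a T
    and A :: "real \<Rightarrow> ('n::finite, 'l) gauge_field"
    and u :: "real \<Rightarrow> ('n, 'v) scalar_field" +
  fixes X :: "real^'n" and r0 :: real
  assumes n4: "CARD('n) > 4"
    and r0: "r0\<^sup>2 \<le> 4 * pi * (T - a)"
    and energy_L1: "set_integrable lborel
      (ball X (2 * heat_const CARD('n) * r0) \<times> {T - r0\<^sup>2 / (4 * pi)<..<T}) edens"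

text \<open>The bound \<open>rad\<close> for the radius of the heat ball is a parameter tied by an equation, because it
  depends on the dimension only through a type.\<close>

locale ymh_heat_ball = ymh_finite_energy br act W a T A u X r0
  for br :: "'l::euclidean_space \<Rightarrow> 'l \<Rightarrow> 'l"
    and act :: "'l \<Rightarrow> 'v::euclidean_space \<Rightarrow> 'v"
    and W a T
    and A :: "real \<Rightarrow> ('n::finite, 'l) gauge_field"
    and u :: "real \<Rightarrow> ('n, 'v) scalar_field"
    and X r0 +
  fixes r rad :: real
  assumes r: "0 < r" "r < r0"
    and rad_def: "rad = heat_const CARD('n) * r"
begin

abbreviation start :: real where "start \<equiv> T - r\<^sup>2 / (4 * pi)"

text \<open>A time strictly before the heat ball and strictly after the initial time, as \<open>r\<^sup>2 < r r\<^sub>0 < r\<^sub>0\<^sup>2\<close>.\<close>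

abbreviation early :: real where "early \<equiv> T - r * r0 / (4 * pi)"

definition total :: real where
  "total = (LINT z:ball X (2 * heat_const CARD('n) * r0) \<times> {T - r0\<^sup>2 / (4 * pi)<..<T}|lborel. edens z)"

text \<open>Up to the factor \<open>2 (n - 4) (T - t)\<close>, the squared radius of the heat ball at time \<open>t\<close>.\<close>

definition logscale :: "real \<Rightarrow> real" where "logscale t = ln (r\<^sup>2 / (4 * pi * (T - t)))"

lemma rad_pos: "rad > 0"
  using n4 r by (simp add: rad_def heat_const_def)

lemma times: "a < early" "early < start" "start < T"
proof -
  have "r * r0 < r0\<^sup>2" "r\<^sup>2 < r * r0" using r by (auto simp: power2_eq_square)
  then have "r * r0 / (4 * pi) < r0\<^sup>2 / (4 * pi)" "r\<^sup>2 / (4 * pi) < r * r0 / (4 * pi)"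
    by (auto intro: divide_strict_right_mono)
  moreover have "r0\<^sup>2 / (4 * pi) \<le> T - a" using r0 by (simp add: field_simps)
  ultimately show "a < early" "early < start" "start < T" using r by auto
qed

lemma total_bound:
  assumes "early \<le> t1" "t2 < T" "R \<le> 2 * rad"
  shows "(LINT z:cball X R \<times> {t1..t2}|lborel. edens z) \<le> total"
  unfolding total_def
proof (rule set_integral_mono_set[OF energy_L1 _ _ edens_nonneg])
  have "closed (cball X R \<times> {t1..t2})" by (intro closed_Times) auto
  then show "cball X R \<times> {t1..t2} \<in> sets lborel" by simp
  have "r * r0 < r0\<^sup>2" using r by (simp add: power2_eq_square)
  then have "T - r0\<^sup>2 / (4 * pi) < early" by (auto intro: divide_strict_right_mono)
  moreover have "R < 2 * heat_const CARD('n) * r0"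
  proof -
    have "heat_const CARD('n) > 0" using n4 by (simp add: heat_const_def)
    then have "2 * rad < 2 * heat_const CARD('n) * r0" using r by (simp add: rad_def)
    with assms(3) show ?thesis by linarith
  qed
  ultimately show "cball X R \<times> {t1..t2} \<subseteq> ball X (2 * heat_const CARD('n) * r0) \<times> {T - r0\<^sup>2 / (4 * pi)<..<T}"
    using assms by auto
qed

text \<open>A Morrey bound, uniform up to the singular time: monotonicity with the centre moved to the later
  time \<open>t + \<rho>\<^sup>2\<close>, whose kernel is of size \<open>\<rho>\<^bsup>-(n-4)\<^esup>\<close> on the ball of radius \<open>\<rho>\<close> at time \<open>t\<close>. That later time
  may lie beyond the lifetime of the flow. The centre \<open>(X, T)\<close> alone would only give a bound by a
  constant near the boundary of the heat ball, and \<open>e / \<tau>\<close> would stay out of reach by a logarithm.\<close>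

lemma morrey_bound:
  obtains C where "C \<ge> 0" "\<And>t \<rho>. start \<le> t \<Longrightarrow> t < T \<Longrightarrow> 0 < \<rho> \<Longrightarrow> \<rho> \<le> rad \<Longrightarrow>
    (LINT x:cball X \<rho>|lborel. edens (x, t)) \<le> C * \<rho> ^ (CARD('n) - 4)"
proof -
  define m where "m = (real CARD('n) - 4) / 2"
  have m: "m > 0" using n4 by (simp add: m_def)
  let ?D = "cball X (2 * rad)"
  obtain B where B: "B \<ge> 0" "\<forall>\<tau>\<in>{0<..T - early + rad\<^sup>2}. \<forall>s\<ge>0. cutoff_error CARD('n) (2 * rad) \<tau> s \<le> B"
    using cutoff_error_bounded[OF n4] by blast
  define E1 where "E1 = (LINT x:?D|lborel. edens (x, early))"
  define K1 where "K1 = exp (- m * ln (4 * pi * (start - early)))"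
  define C where "C = 4 * exp (1 / 4) * exp (m * ln (4 * pi)) * (K1 * E1 + B * total)"
  have "E1 \<ge> 0" "total \<ge> 0" unfolding E1_def total_def set_lebesgue_integral_def
    by (rule integral_nonneg_AE, simp add: edens_nonneg)+
  then have C: "C \<ge> 0" unfolding C_def K1_def using B by simp
  have "(LINT x:cball X \<rho>|lborel. edens (x, t)) \<le> C * \<rho> ^ (CARD('n) - 4)"
    if t: "start \<le> t" "t < T" and \<rho>: "0 < \<rho>" "\<rho> \<le> rad" for t \<rho>
  proof -
    define T' where "T' = t + \<rho>\<^sup>2"
    interpret S: ymh_flow br act W a "min T T'" A u by (rule restrict_time) simp
    let ?k = "local_kernel (2 * rad) X T'" and ?c = "exp (- m * ln (4 * pi * \<rho>\<^sup>2) - 1 / 4) / 4"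
    have tT': "t < T'" unfolding T'_def using \<rho> by simp
    have \<rho>2: "\<rho>\<^sup>2 \<le> rad\<^sup>2" using \<rho> by (intro power_mono) auto
    have order: "a < early" "early < min T T'" "a < t" "t < min T T'" using times t tT' by auto
    have ce: "continuous_on S.spacetime edens" by (rule Ck_on_imp_continuous[OF S.Ck_on_edens])
    have ck: "continuous_on S.spacetime (\<lambda>z. ?k z * edens z)"
      by (intro continuous_intros S.continuous_on_local_kernel ce) simp
    have mon: "(LINT x:?D|lborel. ?k (x, t) * edens (x, t)) + (LINT z:?D \<times> {early..t}|lborel. ?k z * Qdens X T' z) / 2
      \<le> (LINT x:?D|lborel. ?k (x, early) * edens (x, early)) + B * (LINT z:?D \<times> {early..t}|lborel. edens z)"
    proof (rule S.monotonicity)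
      show "early \<le> t" using times t by simp
      show "2 * rad > 0" using rad_pos by simp
      show "\<forall>\<tau>\<in>{0<..T' - early}. \<forall>s\<ge>0. cutoff_error CARD('n) (2 * rad) \<tau> s \<le> B"
        using B(2) t \<rho>2 unfolding T'_def by auto
    qed (use order n4 in auto)
    have "(LINT z:?D \<times> {early..t}|lborel. ?k z * Qdens X T' z) \<ge> 0"
      unfolding set_lebesgue_integral_def
      by (rule integral_nonneg_AE, rule AE_I2)
        (use Qdens_nonneg tT' in \<open>auto simp: indicator_def local_kernel_nonneg\<close>)
    moreover have "B * (LINT z:?D \<times> {early..t}|lborel. edens z) \<le> B * total"
      by (intro mult_left_mono total_bound B) (use t in auto)
    moreover have "(LINT x:?D|lborel. ?k (x, early) * edens (x, early)) \<le> K1 * E1"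
    proof -
      have "(LINT x:?D|lborel. ?k (x, early) * edens (x, early)) \<le> (LINT x:?D|lborel. K1 * edens (x, early))"
      proof (rule set_integral_mono)
        show "set_integrable lborel ?D (\<lambda>x. ?k (x, early) * edens (x, early))"
          by (rule S.set_integrable_slice[OF ck order(1,2)])
        show "set_integrable lborel ?D (\<lambda>x. K1 * edens (x, early))"
          using S.set_integrable_slice[OF ce order(1,2)] by simp
        fix x
        have "ln (4 * pi * (start - early)) \<le> ln (4 * pi * (T' - early))"
          using times tT' t by simp
        then have "m * ln (4 * pi * (start - early)) \<le> m * ln (4 * pi * (T' - early))"
          using m by simp
        moreover have "(norm (x - X))\<^sup>2 / (4 * (T' - early)) \<ge> 0" using times tT' t by simp
        ultimately have "exp (psi X T' (x, early)) \<le> K1"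
          unfolding K1_def psi_def m_def[symmetric] fst_conv snd_conv exp_le_cancel_iff by linarith
        with local_kernel_le have "?k (x, early) \<le> K1" by (rule order_trans)
        then show "?k (x, early) * edens (x, early) \<le> K1 * edens (x, early)"
          by (intro mult_right_mono edens_nonneg)
      qed
      then show ?thesis by (simp add: E1_def)
    qed
    moreover have "?c * (LINT x:cball X \<rho>|lborel. edens (x, t)) \<le> (LINT x:?D|lborel. ?k (x, t) * edens (x, t))"
    proof -
      have sub: "cball X \<rho> \<subseteq> ?D" using \<rho> rad_pos by auto
      note i = S.set_integrable_slice[OF ck order(3,4)]
      have "?c * (LINT x:cball X \<rho>|lborel. edens (x, t)) = (LINT x:cball X \<rho>|lborel. ?c * edens (x, t))" by simp
      also have "\<dots> \<le> (LINT x:cball X \<rho>|lborel. ?k (x, t) * edens (x, t))"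
      proof (rule set_integral_mono[OF _ i])
        show "set_integrable lborel (cball X \<rho>) (\<lambda>x. ?c * edens (x, t))"
          using S.set_integrable_slice[OF ce order(3,4)] by simp
        fix x assume x: "x \<in> cball X \<rho>"
        then have "norm (x - X) \<le> \<rho>" by (simp add: dist_norm norm_minus_commute)
        then have "(norm (x - X))\<^sup>2 \<le> \<rho>\<^sup>2" by (intro power_mono) auto
        then have "(norm (x - X))\<^sup>2 / (4 * \<rho>\<^sup>2) \<le> 1 / 4" using \<rho> by (simp add: field_simps)
        then have "?c \<le> exp (psi X T' (x, t)) / 4"
          unfolding psi_def m_def[symmetric] T'_def by simp
        also have "\<dots> \<le> ?k (x, t)" by (rule local_kernel_ge) (use x \<rho> in auto)
        finally show "?c * edens (x, t) \<le> ?k (x, t) * edens (x, t)" by (intro mult_right_mono edens_nonneg)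
      qed
      also have "\<dots> \<le> (LINT x:?D|lborel. ?k (x, t) * edens (x, t))"
        by (rule set_integral_mono_set[OF i _ sub]) (auto simp: edens_nonneg local_kernel_nonneg)
      finally show ?thesis .
    qed
    ultimately have main: "?c * (LINT x:cball X \<rho>|lborel. edens (x, t)) \<le> K1 * E1 + B * total"
      using mon by linarith
    have "exp (m * ln (4 * pi * \<rho>\<^sup>2)) = exp (m * ln (4 * pi)) * \<rho> ^ (CARD('n) - 4)"
    proof -
      have "ln (4 * pi * \<rho>\<^sup>2) = ln (4 * pi) + 2 * ln \<rho>"
        using \<rho> by (subst ln_mult) (simp_all add: ln_realpow)
      moreover have "real (CARD('n) - 4) = m * 2" using n4 by (simp add: m_def of_nat_diff)
      ultimately have "m * ln (4 * pi * \<rho>\<^sup>2) = m * ln (4 * pi) + real (CARD('n) - 4) * ln \<rho>"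
        by (simp only: distrib_left mult.assoc)
      then show ?thesis using \<rho> by (simp add: exp_add exp_of_nat_mult)
    qed
    then have CC: "C * \<rho> ^ (CARD('n) - 4) = 4 * exp (1 / 4) * exp (m * ln (4 * pi * \<rho>\<^sup>2)) * (K1 * E1 + B * total)"
      by (simp add: C_def)
    have "exp (1 / 4) * exp p * exp (- p - 1 / 4) = 1" for p :: real
      by (simp add: exp_add[symmetric])
    from this[of "m * ln (4 * pi * \<rho>\<^sup>2)"] have "(LINT x:cball X \<rho>|lborel. edens (x, t))
      = 4 * exp (1 / 4) * exp (m * ln (4 * pi * \<rho>\<^sup>2)) * (?c * (LINT x:cball X \<rho>|lborel. edens (x, t)))" by simp
    also have "\<dots> \<le> C * \<rho> ^ (CARD('n) - 4)" unfolding CC using main by (intro mult_left_mono) auto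
    finally show ?thesis .
  qed
  with C that show ?thesis by blast
qed

text \<open>Monotonicity at the centre \<open>(X, T)\<close> itself bounds the weighted integral of \<open>Q\<close> over all times
  before \<open>T\<close>.\<close>

lemma weighted_Q_integrable:
  "set_integrable lborel (cball X rad \<times> {early..<T}) (\<lambda>z. exp (psi X T z) * Qdens X T z)"
proof -
  let ?D = "cball X (2 * rad)" and ?k = "local_kernel (2 * rad) X T" and ?f = "\<lambda>z. exp (psi X T z) * Qdens X T z"
  obtain B where B: "B \<ge> 0" "\<forall>\<tau>\<in>{0<..T - early}. \<forall>s\<ge>0. cutoff_error CARD('n) (2 * rad) \<tau> s \<le> B"
    using cutoff_error_bounded[OF n4] by blast
  define I1 where "I1 = (LINT x:?D|lborel. ?k (x, early) * edens (x, early))"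
  have c1: "continuous_on spacetime ?f"
    by (intro continuous_intros continuous_on_psi' continuous_on_Qdens order_refl)
  have c2: "continuous_on spacetime (\<lambda>z. ?k z * Qdens X T z)"
    by (intro continuous_intros continuous_on_local_kernel continuous_on_Qdens order_refl)
  show ?thesis
  proof (rule set_integrable_time_exhaustion[where C="8 * (I1 + B * total)"])
    show "early < T" using times by simp
    show "0 \<le> ?f z" if "z \<in> cball X rad \<times> {early..<T}" for z
      using that Qdens_nonneg[of z T X] by auto
    fix t2 assume t2: "early \<le> t2" "t2 < T"
    let ?C = "cball X rad \<times> {early..t2}"
    show f: "set_integrable lborel ?C ?f"
      by (rule set_integrable_continuous[OF c1 times(1) t2(2)])
    have sub: "?C \<subseteq> ?D \<times> {early..t2}" using rad_pos by auto
    have cl: "closed ?C" by (intro closed_Times) auto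
    have "(LINT z:?C|lborel. ?f z) \<le> (LINT z:?C|lborel. 4 * (?k z * Qdens X T z))"
    proof (rule set_integral_mono[OF f])
      show "set_integrable lborel ?C (\<lambda>z. 4 * (?k z * Qdens X T z))"
        using set_integrable_continuous[OF c2 times(1) t2(2)] by simp
      fix z assume z: "z \<in> ?C"
      then have "exp (psi X T z) \<le> 4 * ?k z" using local_kernel_ge[of "2 * rad" z X T] rad_pos by auto
      moreover have "0 \<le> Qdens X T z" using Qdens_nonneg[of z T X] z t2 by auto
      ultimately have "?f z \<le> 4 * ?k z * Qdens X T z" by (rule mult_right_mono)
      then show "?f z \<le> 4 * (?k z * Qdens X T z)" by (simp add: mult_ac)
    qed
    also have "\<dots> = 4 * (LINT z:?C|lborel. ?k z * Qdens X T z)"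
      by simp
    also have "\<dots> \<le> 4 * (LINT z:?D \<times> {early..t2}|lborel. ?k z * Qdens X T z)"
    proof (intro mult_left_mono set_integral_mono_set[OF set_integrable_continuous[OF c2 times(1) t2(2)] _ sub])
      show "0 \<le> ?k z * Qdens X T z" if "z \<in> ?D \<times> {early..t2}" for z
        using that t2 Qdens_nonneg[of z T X] by (auto simp: local_kernel_nonneg)
    qed (use cl in simp_all)
    also have "(LINT z:?D \<times> {early..t2}|lborel. ?k z * Qdens X T z) \<le> 2 * (I1 + B * total)"
    proof -
      have "(LINT x:?D|lborel. ?k (x, t2) * edens (x, t2)) + (LINT z:?D \<times> {early..t2}|lborel. ?k z * Qdens X T z) / 2
        \<le> I1 + B * (LINT z:?D \<times> {early..t2}|lborel. edens z)"
        unfolding I1_def by (rule monotonicity[OF order_refl times(1) t2 _ n4 B(2)]) (use rad_pos in simp)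
      moreover have "B * (LINT z:?D \<times> {early..t2}|lborel. edens z) \<le> B * total"
        by (intro mult_left_mono total_bound B) (use t2 in auto)
      moreover have "(LINT x:?D|lborel. ?k (x, t2) * edens (x, t2)) \<ge> 0"
        unfolding set_lebesgue_integral_def
        by (rule integral_nonneg_AE) (auto simp: edens_nonneg local_kernel_nonneg)
      ultimately show ?thesis by simp
    qed
    finally show "(LINT z:?C|lborel. ?f z) \<le> 8 * (I1 + B * total)"
      by simp
  qed simp
qed

end

lemma open_heat_ball:
  fixes X :: "real^'n::finite"
  assumes "r > 0"
  shows "open (heat_ball X T r)"
proof -
  have o: "open {z :: (real^'n) \<times> real. snd z < T}" by (intro open_Collect_less continuous_intros)
  have "heat_ball X T r = {z. snd z < T} \<inter> psi X T -` {- ((real CARD('n) - 4) * ln r)<..}"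
    using mem_heat_ball_iff[OF assms, of _ _ X T] by (force simp: split_paired_all)
  then show ?thesis using continuous_open_preimage[OF continuous_on_psi o open_greaterThan] by simp
qed

context ymh_heat_ball
begin

abbreviation E :: "((real^'n) \<times> real) set" where "E \<equiv> heat_ball X T r"

definition \<theta> :: "(real^'n) \<times> real \<Rightarrow> real" where
  "\<theta> z = psi X T z + (real CARD('n) - 4) * ln r"

lemma mem_E_iff: "z \<in> E \<longleftrightarrow> snd z < T \<and> \<theta> z > 0"
  using mem_heat_ball_iff[OF r(1), of "fst z" "snd z" X T] by (simp add: \<theta>_def)

lemma \<theta>_eq: "snd z < T \<Longrightarrow> \<theta> z = (real CARD('n) - 4) / 2 * logscale (snd z) - (norm (fst z - X))\<^sup>2 / (4 * (T - snd z))"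
  using psi_add_ln[OF r(1), of "snd z" T X "fst z"] by (simp add: \<theta>_def logscale_def)

lemma logscale_pos_iff: "t < T \<Longrightarrow> logscale t > 0 \<longleftrightarrow> start < t"
proof -
  assume t: "t < T"
  have "logscale t > 0 \<longleftrightarrow> r\<^sup>2 / (4 * pi * (T - t)) > 1"
    unfolding logscale_def using t r by (intro ln_gt_zero_iff) auto
  also have "\<dots> \<longleftrightarrow> start < t" using t by (simp add: field_simps)
  finally show ?thesis .
qed

lemma slice_radius:
  assumes "z \<in> E"
  shows "start < snd z" "snd z < T" "(norm (fst z - X))\<^sup>2 \<le> 2 * (real CARD('n) - 4) * (T - snd z) * logscale (snd z)"
    "fst z \<in> cball X rad"
proof -
  show t: "snd z < T" using assms by (simp add: mem_E_iff)
  have *: "(norm (fst z - X))\<^sup>2 / (4 * (T - snd z)) < (real CARD('n) - 4) / 2 * logscale (snd z)"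
    using assms \<theta>_eq[OF t] unfolding mem_E_iff by linarith
  have "0 \<le> (norm (fst z - X))\<^sup>2 / (4 * (T - snd z))" using t by simp
  with * have "0 < (real CARD('n) - 4) / 2 * logscale (snd z)" by linarith
  then have "logscale (snd z) > 0" using n4 by (simp add: zero_less_mult_iff)
  then show "start < snd z" using logscale_pos_iff[OF t] by simp
  show le: "(norm (fst z - X))\<^sup>2 \<le> 2 * (real CARD('n) - 4) * (T - snd z) * logscale (snd z)"
    using * t by (simp add: field_simps)
  also have "\<dots> \<le> rad\<^sup>2"
    using heat_radius_le[of r "T - snd z" "CARD('n)"] r n4 t by (simp add: logscale_def rad_def)
  finally have "norm (fst z - X) \<le> rad" using rad_pos by (simp add: power2_le_iff_abs_le)
  then show "fst z \<in> cball X rad" by (simp add: dist_norm norm_minus_commute)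
qed

lemma E_subset: "E \<subseteq> cball X rad \<times> {start<..<T}" "E \<subseteq> cball X rad \<times> {early..<T}" "E \<subseteq> spacetime"
  using slice_radius times by (fastforce simp: mem_Times_iff spacetime_def)+

lemma E_borel: "E \<in> sets borel"
  by (rule borel_open[OF open_heat_ball[OF r(1)]])

text \<open>The Morrey bound beats the logarithms: the slice radius is \<open>(\<tau> ln (1/\<tau>))\<^sup>\<onehalf>\<close>, its power is at least
  the first, and \<open>1 + ln \<Lambda> \<le> 12 \<Lambda>\<^bsup>1/12\<^esup>\<close> for \<open>\<Lambda> = r\<^sup>2 / (4 \<pi> \<tau>)\<close>.\<close>

lemma slice_energy:
  obtains K where "K \<ge> 0" "\<And>t. start < t \<Longrightarrow> t < T \<Longrightarrow> (1 + logscale t)\<^sup>2 *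
      (LINT x:cball X (sqrt (2 * (real CARD('n) - 4) * (T - t) * logscale t))|lborel. edens (x, t))
      \<le> K * (T - t) powr (1 / 4)"
proof -
  obtain C where C: "C \<ge> 0" "\<And>t \<rho>. start \<le> t \<Longrightarrow> t < T \<Longrightarrow> 0 < \<rho> \<Longrightarrow> \<rho> \<le> rad \<Longrightarrow>
    (LINT x:cball X \<rho>|lborel. edens (x, t)) \<le> C * \<rho> ^ (CARD('n) - 4)"
    using morrey_bound by blast
  let ?m = "real CARD('n) - 4"
  define K where "K = C * rad ^ (CARD('n) - 5) * sqrt (2 * ?m) * 1728 * (r\<^sup>2 / (4 * pi)) powr (1 / 4)"
  have K: "K \<ge> 0" unfolding K_def using C rad_pos n4 by simp
  have "(1 + logscale t)\<^sup>2 * (LINT x:cball X (sqrt (2 * ?m * (T - t) * logscale t))|lborel. edens (x, t))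
      \<le> K * (T - t) powr (1 / 4)" if t: "start < t" "t < T" for t
  proof -
    define \<Lambda> where "\<Lambda> = logscale t"
    define \<tau> where "\<tau> = T - t"
    define \<rho> where "\<rho> = sqrt (2 * ?m * \<tau> * \<Lambda>)"
    have \<tau>: "\<tau> > 0" using t by (simp add: \<tau>_def)
    have \<Lambda>: "\<Lambda> > 0" using logscale_pos_iff t by (simp add: \<Lambda>_def)
    have \<rho>: "\<rho> > 0" using n4 \<tau> \<Lambda> by (simp add: \<rho>_def)
    have "\<rho>\<^sup>2 \<le> rad\<^sup>2"
      using heat_radius_le[of r \<tau> "CARD('n)"] r n4 \<tau> \<Lambda>
      by (simp add: \<rho>_def \<Lambda>_def \<tau>_def logscale_def rad_def)
    then have \<rho>r: "\<rho> \<le> rad" using rad_pos by (simp add: power2_le_iff_abs_le)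
    have \<rho>s: "\<rho> \<le> sqrt (2 * ?m) * sqrt \<tau> * (1 + \<Lambda>)"
    proof -
      have "sqrt \<Lambda> \<le> sqrt ((1 + \<Lambda>)\<^sup>2)"
        unfolding real_sqrt_le_iff using \<Lambda> by (simp add: power2_eq_square algebra_simps)
      then have "sqrt \<Lambda> \<le> 1 + \<Lambda>" using \<Lambda> by simp
      then show ?thesis unfolding \<rho>_def real_sqrt_mult
        using n4 \<tau> by (intro mult_left_mono) auto
    qed
    have "(LINT x:cball X \<rho>|lborel. edens (x, t)) \<le> C * \<rho> ^ (CARD('n) - 4)"
      by (rule C(2)) (use t \<rho> \<rho>r in auto)
    also have "\<rho> ^ (CARD('n) - 4) = \<rho> ^ (CARD('n) - 5) * \<rho>"
      using n4 power_Suc2[of \<rho> "CARD('n) - 5"] by (simp add: Suc_diff_Suc numeral_eq_Suc)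
    also have "C * (\<rho> ^ (CARD('n) - 5) * \<rho>) \<le> C * (rad ^ (CARD('n) - 5) * (sqrt (2 * ?m) * sqrt \<tau> * (1 + \<Lambda>)))"
      using C \<rho> \<rho>r \<rho>s rad_pos by (intro mult_left_mono mult_mono power_mono) auto
    finally have S: "(LINT x:cball X \<rho>|lborel. edens (x, t))
        \<le> C * (rad ^ (CARD('n) - 5) * (sqrt (2 * ?m) * sqrt \<tau> * (1 + \<Lambda>)))" .
    have "(1 + \<Lambda>)\<^sup>2 * (LINT x:cball X \<rho>|lborel. edens (x, t))
        \<le> (1 + \<Lambda>)\<^sup>2 * (C * (rad ^ (CARD('n) - 5) * (sqrt (2 * ?m) * sqrt \<tau> * (1 + \<Lambda>))))"
      by (rule mult_left_mono[OF S]) simp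
    also have "\<dots> = C * rad ^ (CARD('n) - 5) * sqrt (2 * ?m) * sqrt \<tau> * (1 + \<Lambda>) ^ 3"
      by (simp add: power2_eq_square power3_eq_cube mult_ac)
    also have "\<dots> \<le> C * rad ^ (CARD('n) - 5) * sqrt (2 * ?m) * sqrt \<tau> * (1728 * exp (\<Lambda> / 4))"
    proof (rule mult_left_mono)
      have "1 + \<Lambda> \<le> 12 * exp (\<Lambda> / 12)" using exp_ge_add_one_self[of "\<Lambda> / 12"] by linarith
      then have "(1 + \<Lambda>) ^ 3 \<le> (12 * exp (\<Lambda> / 12)) ^ 3" using \<Lambda> by (intro power_mono) auto
      also have "\<dots> = 1728 * exp (\<Lambda> / 4)"
        by (simp add: power_mult_distrib exp_of_nat_mult[symmetric])
      finally show "(1 + \<Lambda>) ^ 3 \<le> 1728 * exp (\<Lambda> / 4)" .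
    qed (use C rad_pos n4 \<tau> in auto)
    also have "\<dots> = K * \<tau> powr (1 / 4)"
    proof -
      have "exp (\<Lambda> / 4) = (r\<^sup>2 / (4 * pi) / \<tau>) powr (1 / 4)"
        unfolding \<Lambda>_def logscale_def \<tau>_def[symmetric] powr_def using r \<tau> by simp
      also have "\<dots> = (r\<^sup>2 / (4 * pi)) powr (1 / 4) / \<tau> powr (1 / 4)"
        by (rule powr_divide)
      finally have e: "exp (\<Lambda> / 4) = (r\<^sup>2 / (4 * pi)) powr (1 / 4) / \<tau> powr (1 / 4)" .
      have "sqrt \<tau> = \<tau> powr (1 / 4) * \<tau> powr (1 / 4)"
        using \<tau> by (simp add: powr_half_sqrt[symmetric] powr_add[symmetric])
      then show ?thesis unfolding K_def e using \<tau> by simp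
    qed
    finally show ?thesis unfolding \<rho>_def \<Lambda>_def \<tau>_def .
  qed
  with K that show ?thesis by blast
qed

text \<open>By Fubini, since \<open>\<tau>\<^bsup>1/4\<^esup> / \<tau>\<close> is integrable at \<open>\<tau> = 0\<close>.\<close>

lemma weighted_energy_integrable:
  "set_integrable lborel E (\<lambda>z. (1 + logscale (snd z))\<^sup>2 / (T - snd z) * edens z)"
proof -
  let ?g = "\<lambda>t. (1 + logscale t)\<^sup>2 / (T - t)"
  let ?f = "\<lambda>z. indicator E z *\<^sub>R (?g (snd z) * edens z)"
  let ?\<rho> = "\<lambda>t. sqrt (2 * (real CARD('n) - 4) * (T - t) * logscale t)"
  obtain K where K: "K \<ge> 0" "\<And>t. start < t \<Longrightarrow> t < T \<Longrightarrow> (1 + logscale t)\<^sup>2 *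
      (LINT x:cball X (?\<rho> t)|lborel. edens (x, t)) \<le> K * (T - t) powr (1 / 4)"
    using slice_energy by blast
  have ne: "T \<noteq> snd z" "0 < r\<^sup>2 / (4 * pi * (T - snd z))" if "z \<in> E" for z
    using slice_radius(2)[OF that] r by auto
  have c: "continuous_on E (\<lambda>z. ?g (snd z) * edens z)"
    unfolding logscale_def
    by (intro continuous_intros continuous_on_subset[OF continuous_on_edens E_subset(3)])
      (use ne in force)+
  have meas: "?f \<in> borel_measurable lborel"
    using borel_measurable_continuous_on_indicator[OF E_borel c] by simp
  have slice: "(\<integral>\<^sup>+ x. ennreal (?f (x, t)) \<partial>lborel) \<le> ennreal (K * (T - t) powr (- 3 / 4) * indicator {start<..<T} t)" for t
  proof (cases "start < t \<and> t < T")
    case False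
    then have z0: "?f (x, t) = 0" for x using slice_radius[of "(x, t)"] by (auto simp: indicator_def)
    show ?thesis unfolding z0 by simp
  next
    case True
    then have t: "start < t" "t < T" by auto
    have g: "?g t \<ge> 0" using t by simp
    have si: "set_integrable lborel (cball X (?\<rho> t)) (\<lambda>x. edens (x, t))"
      by (rule set_integrable_slice[OF continuous_on_edens]) (use t times in auto)
    have nn: "0 \<le> ?g t * (indicator (cball X (?\<rho> t)) x *\<^sub>R edens (x, t))" for x
      using g edens_nonneg[of "(x, t)"] by (intro mult_nonneg_nonneg) auto
    have "(\<integral>\<^sup>+ x. ennreal (?f (x, t)) \<partial>lborel)
        \<le> (\<integral>\<^sup>+ x. ennreal (?g t * (indicator (cball X (?\<rho> t)) x *\<^sub>R edens (x, t))) \<partial>lborel)"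
    proof (rule nn_integral_mono, rule ennreal_leI)
      fix x
      have "x \<in> cball X (?\<rho> t)" if "(x, t) \<in> E"
        using slice_radius(3)[OF that] real_le_rsqrt by (simp add: dist_norm norm_minus_commute)
      with nn[of x] show "?f (x, t) \<le> ?g t * (indicator (cball X (?\<rho> t)) x *\<^sub>R edens (x, t))"
        by (cases "(x, t) \<in> E") (simp_all add: indicator_def)
    qed
    also have "\<dots> = ennreal (LINT x|lborel. ?g t * (indicator (cball X (?\<rho> t)) x *\<^sub>R edens (x, t)))"
    proof (rule nn_integral_eq_integral)
      show "integrable lborel (\<lambda>x. ?g t * (indicator (cball X (?\<rho> t)) x *\<^sub>R edens (x, t)))"
        using si by (simp only: set_integrable_def integrable_mult_right)
    qed (use nn in simp)
    also have "\<dots> = ennreal (?g t * (LINT x:cball X (?\<rho> t)|lborel. edens (x, t)))"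
      by (simp add: set_lebesgue_integral_def)
    also have "\<dots> \<le> ennreal (K * (T - t) powr (- 3 / 4))"
    proof (rule ennreal_leI)
      have "?g t * (LINT x:cball X (?\<rho> t)|lborel. edens (x, t)) \<le> K * (T - t) powr (1 / 4) / (T - t)"
        using K(2)[OF t] t by (simp add: divide_right_mono)
      also have "\<dots> = K * ((T - t) powr (1 / 4) / (T - t) powr 1)" using t by simp
      also have "\<dots> = K * (T - t) powr (- 3 / 4)" by (simp only: powr_diff[symmetric]) simp
      finally show "?g t * (LINT x:cball X (?\<rho> t)|lborel. edens (x, t)) \<le> K * (T - t) powr (- 3 / 4)" .
    qed
    finally show ?thesis using t by simp
  qed
  have "(\<integral>\<^sup>+ z. ennreal (?f z) \<partial>lborel) = (\<integral>\<^sup>+ t. \<integral>\<^sup>+ x. ennreal (?f (x, t)) \<partial>lborel \<partial>lborel)"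
    unfolding lborel_prod[symmetric]
    by (rule lborel_pair.nn_integral_snd[of "\<lambda>z. ennreal (?f z)", symmetric])
      (use meas in \<open>simp add: lborel_prod\<close>)
  also have "\<dots> \<le> (\<integral>\<^sup>+ t. ennreal (K * (T - t) powr (- 3 / 4) * indicator {start<..<T} t) \<partial>lborel)"
    by (rule nn_integral_mono) (rule slice)
  also have "\<dots> < \<infinity>" by (rule nn_integral_powr_minus_three_quarters) (use times K in auto)
  finally have fin: "(\<integral>\<^sup>+ z. ennreal (?f z) \<partial>lborel) < \<infinity>" .
  show ?thesis
    unfolding set_integrable_def
  proof (rule integrableI_nonneg[OF meas _ fin])
    have "0 \<le> ?f z" for z
      using slice_radius(2)[of z] edens_nonneg[of z] by (auto simp: indicator_def)
    then show "AE z in lborel. 0 \<le> ?f z" by simp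
  qed
qed

text \<open>An integrable bound for \<open>(1 + \<theta>) |P|\<close> and \<open>(1 + \<theta>) Q\<close>. The first summand takes care of \<open>Q\<close>, because
  \<open>1 + \<theta> \<le> exp \<theta>\<close>; the second takes care of the energy in \<open>P\<close>, whose factors \<open>1/\<tau>\<close>, \<open>|\<xi>|\<^sup>2\<close> and \<open>\<theta>\<close> are on the
  heat ball all controlled by \<open>\<tau>\<close> and the logarithm.\<close>

definition dominator :: "(real^'n) \<times> real \<Rightarrow> real" where
  "dominator z = exp ((real CARD('n) - 4) * ln r) * (exp (psi X T z) * Qdens X T z)
    + (real CARD('n) - 4) * (real CARD('n) - 3) * ((1 + logscale (snd z))\<^sup>2 / (T - snd z) * edens z)"

lemma dominator_integrable: "set_integrable lborel E dominator"
  unfolding dominator_def[abs_def]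
proof (intro set_integral_add set_integrable_mult_right)
  show "set_integrable lborel E (\<lambda>z. exp (psi X T z) * Qdens X T z)"
    by (rule set_integrable_subset[OF weighted_Q_integrable _ E_subset(2)]) (use E_borel in simp)
qed (rule weighted_energy_integrable)

lemma dominates:
  assumes z: "z \<in> E"
  shows "(1 + \<theta> z) * Qdens X T z \<le> dominator z" "(1 + \<theta> z) * \<bar>Pdens X T z\<bar> \<le> dominator z"
proof -
  define m where "m = real CARD('n) - 4"
  define \<Lambda> where "\<Lambda> = logscale (snd z)"
  define \<tau> where "\<tau> = T - snd z"
  have m: "m > 0" using n4 by (simp add: m_def)
  have \<tau>: "\<tau> > 0" using slice_radius(2)[OF z] by (simp add: \<tau>_def)
  have \<Lambda>: "\<Lambda> > 0" using logscale_pos_iff slice_radius(1,2)[OF z] by (simp add: \<Lambda>_def)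
  have \<theta>: "\<theta> z > 0" using z by (simp add: mem_E_iff)
  have Q: "Qdens X T z \<ge> 0" by (rule Qdens_nonneg[OF slice_radius(2)[OF z]])
  have e: "edens z \<ge> 0" by (rule edens_nonneg)
  have "1 + \<theta> z \<le> exp (\<theta> z)" by (rule exp_ge_add_one_self)
  also have "\<dots> = exp (m * ln r) * exp (psi X T z)" by (simp add: \<theta>_def exp_add m_def mult.commute)
  finally have "(1 + \<theta> z) * Qdens X T z \<le> exp (m * ln r) * exp (psi X T z) * Qdens X T z"
    using Q by (rule mult_right_mono)
  then have q: "(1 + \<theta> z) * Qdens X T z \<le> exp (m * ln r) * (exp (psi X T z) * Qdens X T z)" by (simp only: mult.assoc)
  have rest: "m * (m + 1) * ((1 + \<Lambda>)\<^sup>2 / \<tau> * edens z) \<ge> 0" using m \<tau> e by simp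
  have dom: "dominator z = exp (m * ln r) * (exp (psi X T z) * Qdens X T z) + m * (m + 1) * ((1 + \<Lambda>)\<^sup>2 / \<tau> * edens z)"
    unfolding dominator_def m_def \<Lambda>_def \<tau>_def by (simp add: algebra_simps)
  show "(1 + \<theta> z) * Qdens X T z \<le> dominator z" unfolding dom using q rest by linarith
  have y: "(norm (fst z - X))\<^sup>2 \<le> 2 * m * \<tau> * \<Lambda>" using slice_radius(3)[OF z] by (simp add: m_def \<tau>_def \<Lambda>_def)
  have "0 \<le> (norm (fst z - X))\<^sup>2 / (4 * \<tau>)" using \<tau> by simp
  then have \<theta>le: "\<theta> z \<le> m / 2 * \<Lambda>"
    unfolding \<theta>_eq[OF slice_radius(2)[OF z]] m_def \<Lambda>_def \<tau>_def by linarith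
  have c: "m / (2 * \<tau>) + (norm (fst z - X))\<^sup>2 / (2 * \<tau>\<^sup>2) \<le> m * (1 + \<Lambda>) / \<tau>"
  proof -
    have "(norm (fst z - X))\<^sup>2 / (2 * \<tau>\<^sup>2) \<le> 2 * m * \<tau> * \<Lambda> / (2 * \<tau>\<^sup>2)"
      using y by (intro divide_right_mono) auto
    also have "\<dots> = m * \<Lambda> / \<tau>" using \<tau> by (simp add: power2_eq_square)
    finally have "m / (2 * \<tau>) + (norm (fst z - X))\<^sup>2 / (2 * \<tau>\<^sup>2) \<le> m / \<tau> + m * \<Lambda> / \<tau>"
      using m \<tau> by (intro add_mono) (auto simp: field_simps)
    then show ?thesis by (simp add: distrib_left add_divide_distrib)
  qed
  have "\<bar>Pdens X T z\<bar> \<le> Qdens X T z / 2 + (m / (2 * \<tau>) + (norm (fst z - X))\<^sup>2 / (2 * \<tau>\<^sup>2)) * edens z"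
    using Pdens_bound[OF slice_radius(2)[OF z] n4, of X] by (simp add: m_def \<tau>_def)
  also have "\<dots> \<le> Qdens X T z + m * (1 + \<Lambda>) / \<tau> * edens z"
    using Q e c by (intro add_mono mult_right_mono) auto
  finally have "(1 + \<theta> z) * \<bar>Pdens X T z\<bar> \<le> (1 + \<theta> z) * (Qdens X T z + m * (1 + \<Lambda>) / \<tau> * edens z)"
    using \<theta> by (intro mult_left_mono) auto
  also have "\<dots> = (1 + \<theta> z) * Qdens X T z + (1 + \<theta> z) * (m * (1 + \<Lambda>) / \<tau> * edens z)"
    by (rule distrib_left)
  also have "(1 + \<theta> z) * (m * (1 + \<Lambda>) / \<tau> * edens z) \<le> ((m + 1) * (1 + \<Lambda>)) * (m * (1 + \<Lambda>) / \<tau> * edens z)"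
  proof (rule mult_right_mono)
    have "(m + 1) * (1 + \<Lambda>) = 1 + \<Lambda> + m + m * \<Lambda>" "m / 2 * \<Lambda> = m * \<Lambda> / 2" "m * \<Lambda> > 0"
      using m \<Lambda> by (simp_all add: algebra_simps)
    then show "1 + \<theta> z \<le> (m + 1) * (1 + \<Lambda>)" using \<theta>le m \<Lambda> by linarith
  qed (use m \<Lambda> \<tau> e in simp)
  also have "((m + 1) * (1 + \<Lambda>)) * (m * (1 + \<Lambda>) / \<tau> * edens z) = m * (m + 1) * ((1 + \<Lambda>)\<^sup>2 / \<tau> * edens z)"
    by (simp add: power2_eq_square mult_ac)
  finally show "(1 + \<theta> z) * \<bar>Pdens X T z\<bar> \<le> dominator z" unfolding dom using q by linarith
qed

lemma continuous_on_\<theta>: "continuous_on E \<theta>"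
  unfolding \<theta>_def[abs_def]
  by (intro continuous_intros continuous_on_subset[OF continuous_on_psi]) (use slice_radius(2) in auto)

lemma integrable_dominated:
  assumes "continuous_on E f" "\<And>z. z \<in> E \<Longrightarrow> \<bar>f z\<bar> \<le> 2 * dominator z"
  shows "set_integrable lborel E f"
proof (rule set_integrable_bound)
  show "set_integrable lborel E (\<lambda>z. 2 * dominator z)" using dominator_integrable by simp
  show "set_borel_measurable lborel E f"
    unfolding set_borel_measurable_def
    using borel_measurable_continuous_on_indicator[OF E_borel assms(1)] by simp
qed (use assms(2) in force)

lemma PQ_bound:
  assumes "z \<in> E" "0 \<le> w" "w \<le> 1 + \<theta> z"
  shows "\<bar>w * (Pdens X T z + Qdens X T z)\<bar> \<le> 2 * dominator z"
    "\<bar>w * Pdens X T z\<bar> \<le> dominator z" "\<bar>w * Qdens X T z\<bar> \<le> dominator z"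
proof -
  have Q: "Qdens X T z \<ge> 0" by (rule Qdens_nonneg[OF slice_radius(2)[OF assms(1)]])
  have "\<bar>w * Pdens X T z\<bar> \<le> (1 + \<theta> z) * \<bar>Pdens X T z\<bar>"
    using assms unfolding abs_mult by (intro mult_right_mono) auto
  then show P: "\<bar>w * Pdens X T z\<bar> \<le> dominator z" using dominates(2)[OF assms(1)] by linarith
  have "\<bar>w * Qdens X T z\<bar> \<le> (1 + \<theta> z) * Qdens X T z"
    using assms Q unfolding abs_mult by (intro mult_mono) auto
  then show "\<bar>w * Qdens X T z\<bar> \<le> dominator z" using dominates(1)[OF assms(1)] by linarith
  with P show "\<bar>w * (Pdens X T z + Qdens X T z)\<bar> \<le> 2 * dominator z"
    unfolding distrib_left by linarith
qed

lemmas continuous_on_E = continuous_on_subset[OF continuous_on_Pdens[OF order_refl] E_subset(3)]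
  continuous_on_subset[OF continuous_on_Qdens[OF order_refl] E_subset(3)]

lemma P_integrable: "set_integrable lborel E (Pdens X T)"
  and Q_integrable: "set_integrable lborel E (Qdens X T)"
  and \<theta>PQ_integrable: "set_integrable lborel E (\<lambda>z. \<theta> z * (Pdens X T z + Qdens X T z))"
proof -
  have b: "(0::real) \<le> 1 \<and> (1::real) \<le> 1 + \<theta> z" "0 \<le> \<theta> z \<and> \<theta> z \<le> 1 + \<theta> z" "dominator z \<ge> 0" if "z \<in> E" for z
    using that PQ_bound(2)[of z 0] by (auto simp: mem_E_iff)
  show "set_integrable lborel E (Pdens X T)"
    by (rule integrable_dominated[OF continuous_on_E(1)]) (use PQ_bound(2)[of _ 1] b in force)
  show "set_integrable lborel E (Qdens X T)"
    by (rule integrable_dominated[OF continuous_on_E(2)]) (use PQ_bound(3)[of _ 1] b in force)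
  show "set_integrable lborel E (\<lambda>z. \<theta> z * (Pdens X T z + Qdens X T z))"
    by (rule integrable_dominated, intro continuous_intros continuous_on_\<theta> continuous_on_E)
      (use PQ_bound(1) b in blast)
qed

end

section \<open>Differentiating in the radius\<close>

text \<open>The mean of the positive part over \<open>[s - d, s]\<close>: a continuously differentiable approximation whose
  derivative lies between \<open>0\<close> and \<open>1\<close>.\<close>

definition ramp :: "real \<Rightarrow> real \<Rightarrow> real" where
  "ramp d s = ((max 0 s)\<^sup>2 - (max 0 (s - d))\<^sup>2) / (2 * d)"

definition ramp' :: "real \<Rightarrow> real \<Rightarrow> real" where
  "ramp' d s = (max 0 s - max 0 (s - d)) / d"

lemma ramp_has_derivative:
  assumes "d > 0"
  shows "(ramp d has_real_derivative ramp' d s) (at s)"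
proof -
  have "((\<lambda>s. (max 0 (s - d))\<^sup>2) has_real_derivative 2 * max 0 (s - d)) (at s)"
  proof -
    have "((\<lambda>s. s - d) has_real_derivative 1) (at s)" by (auto intro!: derivative_eq_intros)
    from DERIV_chain2[OF has_derivative_max0_square this] show ?thesis by simp
  qed
  from DERIV_cdivide[OF DERIV_diff[OF has_derivative_max0_square this], of "2 * d"]
  show ?thesis unfolding ramp_def[abs_def] ramp'_def using assms by (simp add: diff_divide_distrib)
qed

lemma continuous_ramp: "d > 0 \<Longrightarrow> continuous_on UNIV (ramp d)"
  using ramp_has_derivative by (auto intro!: continuous_at_imp_continuous_on DERIV_isCont)

lemma continuous_ramp': "continuous_on UNIV (ramp' d)"
  unfolding ramp'_def[abs_def] divide_inverse by (intro continuous_intros)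

lemma ramp_nonpos: "s \<le> 0 \<Longrightarrow> d > 0 \<Longrightarrow> ramp d s = 0" "s \<le> 0 \<Longrightarrow> d > 0 \<Longrightarrow> ramp' d s = 0"
  by (simp_all add: ramp_def ramp'_def)

lemma ramp'_bounds: "d > 0 \<Longrightarrow> 0 \<le> ramp' d s \<and> ramp' d s \<le> 1"
  unfolding ramp'_def by (auto simp: max_def field_simps)

lemma ramp_bounds:
  assumes "d > 0" "s \<ge> 0"
  shows "0 \<le> ramp d s" "ramp d s \<le> s" "s - d \<le> ramp d s"
proof -
  have "0 \<le> ramp d s \<and> ramp d s \<le> s \<and> s - d \<le> ramp d s"
  proof (cases "s \<le> d")
    case True
    then have e: "ramp d s = s * s / (2 * d)" using assms by (simp add: ramp_def power2_eq_square)
    have "s * s \<le> s * d" using True assms by (intro mult_left_mono)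
    also have "\<dots> \<le> s * (2 * d)" using assms by simp
    finally have "s * s / (2 * d) \<le> s" using assms by (simp add: field_simps)
    then show ?thesis unfolding e using assms True by simp (smt (verit) divide_nonneg_pos mult_nonneg_nonneg)
  next
    case False
    then have "ramp d s = s - d / 2" using assms by (simp add: ramp_def power2_eq_square field_simps)
    then show ?thesis using False assms by simp
  qed
  then show "0 \<le> ramp d s" "ramp d s \<le> s" "s - d \<le> ramp d s" by auto
qed

lemma increasing_times:
  fixes t0 T :: real
  assumes "t0 < T"
  obtains \<sigma> :: "nat \<Rightarrow> real" where "\<And>k. t0 \<le> \<sigma> k" "\<And>k. \<sigma> k < T" "\<sigma> \<longlonglongrightarrow> T"
proof
  show "(\<lambda>k. T - (T - t0) / (real k + 1)) \<longlonglongrightarrow> T" by real_asymp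
  fix k :: nat
  have "p / (real k + 1) \<le> p" if "p \<ge> 0" for p :: real
    using that by (simp add: field_simps)
  from this[of "T - t0"] show "t0 \<le> T - (T - t0) / (real k + 1)" using assms by simp
  show "T - (T - t0) / (real k + 1) < T" using assms by simp
qed

context ymh_heat_ball
begin

lemma psi_nonpos_outside:
  assumes "z \<in> spacetime" "z \<notin> E"
  shows "\<theta> z \<le> 0"
  using assms by (auto simp: mem_E_iff spacetime_def)

definition ramp_density :: "real \<Rightarrow> (real^'n) \<times> real \<Rightarrow> real" where
  "ramp_density d z = (ramp' d (\<theta> z) - ramp d (\<theta> z)) * Pdens X T z - ramp d (\<theta> z) * Qdens X T z"

lemma ramp_density_outside: "d > 0 \<Longrightarrow> z \<in> spacetime \<Longrightarrow> z \<notin> E \<Longrightarrow> ramp_density d z = 0"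
  unfolding ramp_density_def using psi_nonpos_outside[of z] ramp_nonpos[of "\<theta> z" d] by simp

lemma ramp_density_bound:
  assumes d: "d > 0" and z: "z \<in> E"
  shows "\<bar>ramp_density d z\<bar> \<le> 4 * dominator z"
proof -
  have \<theta>: "\<theta> z > 0" using z by (simp add: mem_E_iff)
  have "\<bar>ramp' d (\<theta> z) * Pdens X T z\<bar> \<le> dominator z"
    by (rule PQ_bound(2)[OF z]) (use ramp'_bounds[OF d, of "\<theta> z"] \<theta> in auto)
  moreover have "\<bar>ramp d (\<theta> z) * (Pdens X T z + Qdens X T z)\<bar> \<le> 2 * dominator z"
    by (rule PQ_bound(1)[OF z]) (use ramp_bounds[OF d, of "\<theta> z"] \<theta> in auto)
  moreover have "ramp_density d z = ramp' d (\<theta> z) * Pdens X T z - ramp d (\<theta> z) * (Pdens X T z + Qdens X T z)"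
    by (simp add: ramp_density_def algebra_simps)
  moreover have "dominator z \<ge> 0" using PQ_bound(2)[OF z, of 0] \<theta> by simp
  ultimately show ?thesis by linarith
qed

lemma ramp_density_measurable:
  assumes d: "d > 0"
  shows "(\<lambda>z. indicator E z *\<^sub>R ramp_density d z) \<in> borel_measurable lborel"
proof -
  have "continuous_on E (ramp_density d)"
    unfolding ramp_density_def[abs_def]
    by (intro continuous_intros continuous_on_E continuous_on_compose2[OF continuous_ramp[OF d] continuous_on_\<theta>]
        continuous_on_compose2[OF continuous_ramp' continuous_on_\<theta>]) auto
  from borel_measurable_continuous_on_indicator[OF E_borel this] show ?thesis by simp
qed

lemma integrable_indicator_dominator: "integrable lborel (\<lambda>z. indicator E z *\<^sub>R (4 * dominator z))"
  using dominator_integrable set_integrable_mult_right[of 4 lborel E dominator]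
  unfolding set_integrable_def by simp

text \<open>The weighted identity with \<open>H = ramp d\<close> is integrated up to a time \<open>t < T\<close>. The weight has compact
  support in space, since \<open>\<theta>\<close> is positive only on the heat ball. The boundary term at time \<open>t\<close> vanishes as \<open>t\<close>
  tends to \<open>T\<close>: it is at most \<open>\<theta> e\<close> integrated over a slice, which the slice energy bound controls.\<close>

lemma ramp_identity:
  assumes d: "d > 0"
  shows "(LINT z:E|lborel. ramp_density d z) = 0"
proof -
  let ?s0 = "(real CARD('n) - 4) * ln r"
  let ?g = "ramp_density d"
  have H: "((\<lambda>s. ramp d (s + ?s0)) has_real_derivative ramp' d (s + ?s0)) (at s)" for s
  proof -
    have "((\<lambda>s. s + ?s0) has_real_derivative 1) (at s)" by (auto intro!: derivative_eq_intros)
    from DERIV_chain2[OF ramp_has_derivative[OF d] this] show ?thesis by simp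
  qed
  have slab: "(LINT z:cball X rad \<times> {start..t}|lborel. ?g z) = (LINT x:cball X rad|lborel. ramp d (\<theta> (x, t)) * edens (x, t))"
    if t: "start \<le> t" "t < T" for t
  proof -
    have "(LINT z:cball X rad \<times> {start..t}|lborel.
      (ramp' d (psi X T z + ?s0) - ramp d (psi X T z + ?s0)) * 1 * Pdens X T z
      - ramp d (psi X T z + ?s0) * 1 * Qdens X T z
      - 4 * (T - snd z) * ramp d (psi X T z + ?s0) * 0 * radial_flux X T z)
    = (LINT x:cball X rad|lborel. ramp d (psi X T (x, t) + ?s0) * 1 * edens (x, t))
      - (LINT x:cball X rad|lborel. ramp d (psi X T (x, start) + ?s0) * 1 * edens (x, start))"
    proof (rule weighted_identity[where q="\<lambda>_. 1" and q'="\<lambda>_. 0" and H="\<lambda>s. ramp d (s + ?s0)" and H'="\<lambda>s. ramp' d (s + ?s0)"])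
      show "continuous_on UNIV (\<lambda>s. ramp' d (s + ?s0))"
        by (intro continuous_on_compose2[OF continuous_ramp'] continuous_intros) auto
      fix z assume z: "z \<in> spacetime" "fst z \<notin> cball X rad"
      then have "z \<notin> E" using slice_radius(4) by blast
      then have "\<theta> z \<le> 0" using psi_nonpos_outside z by blast
      then show "ramp d (psi X T z + ?s0) * 1 = 0" using ramp_nonpos d by (simp add: \<theta>_def)
    next
      show "a < start" using times by linarith
      show "((\<lambda>_. 1) has_real_derivative 0) (at s)" for s :: real by simp
    qed (rule order_refl t H continuous_on_const)+
    moreover have "ramp d (psi X T (x, start) + ?s0) = 0" for x
    proof -
      have "(x, start) \<notin> E" using slice_radius(1)[of "(x, start)"] by auto
      moreover have "(x, start) \<in> spacetime" using times by (simp add: spacetime_def)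
      ultimately have "\<theta> (x, start) \<le> 0" using psi_nonpos_outside by blast
      then show ?thesis using ramp_nonpos d by (simp add: \<theta>_def)
    qed
    ultimately show ?thesis by (simp add: \<theta>_def ramp_density_def)
  qed
  obtain \<sigma> where \<sigma>: "\<And>k. start \<le> \<sigma> k" "\<And>k. \<sigma> k < T" and \<sigma>lim: "\<sigma> \<longlonglongrightarrow> T"
    using increasing_times[OF times(3)] by blast
  have eq: "indicator (cball X rad \<times> {start..\<sigma> k}) z *\<^sub>R ?g z = indicator {z. snd z \<le> \<sigma> k} z *\<^sub>R (indicator E z *\<^sub>R ?g z)" for k z
  proof (cases "z \<in> cball X rad \<times> {start..\<sigma> k}")
    case True
    then have "z \<in> spacetime" using times \<sigma>(2)[of k] by (auto simp: spacetime_def)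
    then show ?thesis using True ramp_density_outside[OF d, of z] by (cases "z \<in> E") (auto simp: indicator_def)
  next
    case False
    then have "z \<notin> E \<or> \<not> snd z \<le> \<sigma> k" using slice_radius(1,4)[of z] by (auto simp: mem_Times_iff)
    then show ?thesis using False by (auto simp: indicator_def)
  qed
  have "(\<lambda>k. LINT z|lborel. indicator {z. snd z \<le> \<sigma> k} z *\<^sub>R (indicator E z *\<^sub>R ?g z))
      \<longlonglongrightarrow> (LINT z|lborel. indicator E z *\<^sub>R ?g z)"
  proof (rule integral_dominated_convergence[where w="\<lambda>z. indicator E z *\<^sub>R (4 * dominator z)"])
    have "closed {z :: (real^'n) \<times> real. snd z \<le> \<sigma> k}" for k
      by (intro closed_Collect_le continuous_intros)
    then show "(\<lambda>z. indicator {z. snd z \<le> \<sigma> k} z *\<^sub>R (indicator E z *\<^sub>R ?g z)) \<in> borel_measurable lborel" for k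
      by (intro borel_measurable_scaleR ramp_density_measurable d borel_measurable_indicator) simp
    have "norm (indicator {z. snd z \<le> \<sigma> k} z *\<^sub>R (indicator E z *\<^sub>R ?g z)) \<le> indicator E z *\<^sub>R (4 * dominator z)" for k z
    proof (cases "z \<in> E")
      case True
      then have "\<bar>?g z\<bar> \<le> 4 * dominator z" "0 \<le> 4 * dominator z"
        using ramp_density_bound[OF d, of z] by auto
      then show ?thesis using True by (simp add: indicator_def)
    qed simp
    then show "AE z in lborel. norm (indicator {z. snd z \<le> \<sigma> k} z *\<^sub>R (indicator E z *\<^sub>R ?g z)) \<le> indicator E z *\<^sub>R (4 * dominator z)" for k
      by simp
    have "(\<lambda>k. indicator {z. snd z \<le> \<sigma> k} z *\<^sub>R (indicator E z *\<^sub>R ?g z)) \<longlonglongrightarrow> indicator E z *\<^sub>R ?g z" for z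
    proof (cases "z \<in> E")
      case True
      then have "\<forall>\<^sub>F k in sequentially. snd z < \<sigma> k"
        using order_tendstoD(1)[OF \<sigma>lim, of "snd z"] slice_radius(2) by auto
      then have "\<forall>\<^sub>F k in sequentially. indicator {z. snd z \<le> \<sigma> k} z *\<^sub>R (indicator E z *\<^sub>R ?g z) = indicator E z *\<^sub>R ?g z"
        by eventually_elim (auto simp: indicator_def)
      then show ?thesis by (rule tendsto_eventually)
    qed simp
    then show "AE z in lborel. (\<lambda>k. indicator {z. snd z \<le> \<sigma> k} z *\<^sub>R (indicator E z *\<^sub>R ?g z)) \<longlonglongrightarrow> indicator E z *\<^sub>R ?g z"
      by simp
  qed (rule ramp_density_measurable[OF d] integrable_indicator_dominator)+
  then have lim1: "(\<lambda>k. LINT x:cball X rad|lborel. ramp d (\<theta> (x, \<sigma> k)) * edens (x, \<sigma> k)) \<longlonglongrightarrow> (LINT z:E|lborel. ?g z)"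
    unfolding eq[symmetric] set_lebesgue_integral_def[symmetric] slab[OF \<sigma>] .
  obtain K where K: "K \<ge> 0" "\<And>t. start < t \<Longrightarrow> t < T \<Longrightarrow> (1 + logscale t)\<^sup>2 *
      (LINT x:cball X (sqrt (2 * (real CARD('n) - 4) * (T - t) * logscale t))|lborel. edens (x, t))
      \<le> K * (T - t) powr (1 / 4)"
    using slice_energy by blast
  let ?m = "real CARD('n) - 4"
  have bound: "(LINT x:cball X rad|lborel. ramp d (\<theta> (x, t)) * edens (x, t)) \<le> ?m * (K * (T - t) powr (1 / 4))"
    and nonneg: "0 \<le> (LINT x:cball X rad|lborel. ramp d (\<theta> (x, t)) * edens (x, t))"
    if t: "start < t" "t < T" for t
  proof -
    let ?\<rho> = "sqrt (2 * ?m * (T - t) * logscale t)"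
    have l: "logscale t > 0" using logscale_pos_iff t by blast
    have st: "(x, t) \<in> spacetime" for x using t times by (simp add: spacetime_def)
    have ramp0: "ramp d (\<theta> (x, t)) \<ge> 0" for x
      using ramp_bounds(1)[OF d, of "\<theta> (x, t)"] ramp_nonpos(1)[OF _ d, of "\<theta> (x, t)"] by (cases "\<theta> (x, t) \<ge> 0") auto
    show "0 \<le> (LINT x:cball X rad|lborel. ramp d (\<theta> (x, t)) * edens (x, t))"
      unfolding set_lebesgue_integral_def
      by (rule integral_nonneg_AE) (auto simp: edens_nonneg ramp0)
    have ce: "set_integrable lborel (cball X R) (\<lambda>x. edens (x, t))" for R
      by (rule set_integrable_slice[OF continuous_on_edens]) (use t times in auto)
    have c\<theta>: "continuous_on spacetime \<theta>"
      unfolding \<theta>_def[abs_def]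
      by (intro continuous_intros continuous_on_subset[OF continuous_on_psi]) (auto simp: spacetime_def)
    have cre: "set_integrable lborel (cball X rad) (\<lambda>x. ramp d (\<theta> (x, t)) * edens (x, t))"
      by (rule set_integrable_slice[where f="\<lambda>z. ramp d (\<theta> z) * edens z"],
          intro continuous_intros continuous_on_compose2[OF continuous_ramp[OF d] c\<theta>] continuous_on_edens)
        (use t times in auto)
    have "(LINT x:cball X rad|lborel. ramp d (\<theta> (x, t)) * edens (x, t))
        \<le> (LINT x|lborel. ?m * (1 + logscale t)\<^sup>2 * (indicator (cball X ?\<rho>) x *\<^sub>R edens (x, t)))"
      unfolding set_lebesgue_integral_def
    proof (rule integral_mono)
      show "integrable lborel (\<lambda>x. indicator (cball X rad) x *\<^sub>R (ramp d (\<theta> (x, t)) * edens (x, t)))"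
        using cre by (simp add: set_integrable_def)
      show "integrable lborel (\<lambda>x. ?m * (1 + logscale t)\<^sup>2 * (indicator (cball X ?\<rho>) x *\<^sub>R edens (x, t)))"
        using ce[of ?\<rho>] by (simp add: set_integrable_def)
      fix x
      have rhs: "0 \<le> ?m * (1 + logscale t)\<^sup>2 * (indicator (cball X ?\<rho>) x *\<^sub>R edens (x, t))"
        using n4 edens_nonneg by (intro mult_nonneg_nonneg) auto
      show "indicator (cball X rad) x *\<^sub>R (ramp d (\<theta> (x, t)) * edens (x, t))
          \<le> ?m * (1 + logscale t)\<^sup>2 * (indicator (cball X ?\<rho>) x *\<^sub>R edens (x, t))"
      proof (cases "(x, t) \<in> E")
        case False
        then have "ramp d (\<theta> (x, t)) = 0" using ramp_nonpos(1)[OF psi_nonpos_outside[OF st] d] by blast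
        then show ?thesis using rhs by simp
      next
        case True
        then have x: "x \<in> cball X ?\<rho>"
          using slice_radius(3)[OF True] real_le_rsqrt by (simp add: dist_norm norm_minus_commute)
        have "0 \<le> (norm (x - X))\<^sup>2 / (4 * (T - t))" using t by simp
        then have "\<theta> (x, t) \<le> ?m / 2 * logscale t"
          using \<theta>_eq[of "(x, t)"] t(2) by simp
        moreover have "ramp d (\<theta> (x, t)) \<le> \<theta> (x, t)"
          using True by (intro ramp_bounds d) (simp add: mem_E_iff)
        moreover have "?m / 2 * logscale t \<le> ?m * (1 + logscale t)\<^sup>2"
        proof -
          have "?m / 2 * logscale t \<le> ?m * logscale t" using n4 l by simp
          also have "\<dots> \<le> ?m * (1 + logscale t)\<^sup>2"
            using n4 l by (intro mult_left_mono) (auto simp: power2_eq_square algebra_simps)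
          finally show ?thesis .
        qed
        ultimately have "ramp d (\<theta> (x, t)) * edens (x, t) \<le> ?m * (1 + logscale t)\<^sup>2 * edens (x, t)"
          using edens_nonneg by (intro mult_right_mono) auto
        then show ?thesis using x slice_radius(4)[OF True] by (simp add: indicator_def)
      qed
    qed
    also have "\<dots> = ?m * ((1 + logscale t)\<^sup>2 * (LINT x:cball X ?\<rho>|lborel. edens (x, t)))"
      by (simp add: set_lebesgue_integral_def)
    also have "\<dots> \<le> ?m * (K * (T - t) powr (1 / 4))"
      using K(2)[OF t] n4 by (intro mult_left_mono) auto
    finally show "(LINT x:cball X rad|lborel. ramp d (\<theta> (x, t)) * edens (x, t)) \<le> ?m * (K * (T - t) powr (1 / 4))" .
  qed
  have "(\<lambda>k. LINT x:cball X rad|lborel. ramp d (\<theta> (x, \<sigma> k)) * edens (x, \<sigma> k)) \<longlonglongrightarrow> 0"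
  proof (rule tendsto_sandwich[OF _ _ tendsto_const])
    have ev: "\<forall>\<^sub>F k in sequentially. start < \<sigma> k" by (rule order_tendstoD(1)[OF \<sigma>lim times(3)])
    show "\<forall>\<^sub>F k in sequentially. 0 \<le> (LINT x:cball X rad|lborel. ramp d (\<theta> (x, \<sigma> k)) * edens (x, \<sigma> k))"
      using ev by eventually_elim (rule nonneg[OF _ \<sigma>(2)])
    show "\<forall>\<^sub>F k in sequentially. (LINT x:cball X rad|lborel. ramp d (\<theta> (x, \<sigma> k)) * edens (x, \<sigma> k))
        \<le> ?m * (K * (T - \<sigma> k) powr (1 / 4))"
      using ev by eventually_elim (rule bound[OF _ \<sigma>(2)])
    have "(\<lambda>k. (T - \<sigma> k) powr (1 / 4)) \<longlonglongrightarrow> 0 powr (1 / 4)"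
      by (rule tendsto_powr2) (use tendsto_diff[OF tendsto_const[of T] \<sigma>lim] \<sigma> in \<open>auto simp: less_imp_le\<close>)
    from tendsto_mult[OF tendsto_const tendsto_mult[OF tendsto_const this], of ?m K]
    show "(\<lambda>k. ?m * (K * (T - \<sigma> k) powr (1 / 4))) \<longlonglongrightarrow> 0"
      by simp
  qed
  with lim1 show ?thesis by (rule LIMSEQ_unique)
qed

text \<open>The heat ball integral of \<open>P\<close> as a layer-cake integral of its own derivative: the limit of sharp
  ramps. In it the radius enters only through \<open>\<theta>\<close>.\<close>

lemma heat_ball_identity:
  "(LINT z:E|lborel. Pdens X T z) = (LINT z:E|lborel. \<theta> z * (Pdens X T z + Qdens X T z))"
proof -
  define h where "h k = 1 / (real k + 1)" for k :: nat
  have h: "h k > 0" for k by (simp add: h_def)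
  have hl: "h \<longlonglongrightarrow> 0" unfolding h_def by real_asymp
  let ?l = "\<lambda>z. (1 - \<theta> z) * Pdens X T z - \<theta> z * Qdens X T z"
  have "(\<lambda>k. LINT z|lborel. indicator E z *\<^sub>R ramp_density (h k) z) \<longlonglongrightarrow> (LINT z|lborel. indicator E z *\<^sub>R ?l z)"
  proof (rule integral_dominated_convergence[where w="\<lambda>z. indicator E z *\<^sub>R (4 * dominator z)"])
    have "continuous_on E ?l" by (intro continuous_intros continuous_on_E continuous_on_\<theta>)
    from borel_measurable_continuous_on_indicator[OF E_borel this]
    show "(\<lambda>z. indicator E z *\<^sub>R ?l z) \<in> borel_measurable lborel" by simp
    have "norm (indicator E z *\<^sub>R ramp_density (h k) z) \<le> indicator E z *\<^sub>R (4 * dominator z)" for k z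
      using ramp_density_bound[OF h, of z k] by (cases "z \<in> E") auto
    then show "AE z in lborel. norm (indicator E z *\<^sub>R ramp_density (h k) z) \<le> indicator E z *\<^sub>R (4 * dominator z)" for k
      by simp
    have "(\<lambda>k. indicator E z *\<^sub>R ramp_density (h k) z) \<longlonglongrightarrow> indicator E z *\<^sub>R ?l z" for z
    proof (cases "z \<in> E")
      case z: True
      have \<theta>: "\<theta> z > 0" using z by (simp add: mem_E_iff)
      have "\<forall>\<^sub>F k in sequentially. h k < \<theta> z" by (rule order_tendstoD(2)[OF hl \<theta>])
      then have "\<forall>\<^sub>F k in sequentially. ramp' (h k) (\<theta> z) = 1"
        by eventually_elim (use h \<theta> in \<open>auto simp: ramp'_def less_imp_neq[symmetric]\<close>)
      then have l1: "(\<lambda>k. ramp' (h k) (\<theta> z)) \<longlonglongrightarrow> 1" by (rule tendsto_eventually)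
      have l2: "(\<lambda>k. ramp (h k) (\<theta> z)) \<longlonglongrightarrow> \<theta> z"
      proof (rule tendsto_sandwich[OF _ _ _ tendsto_const])
        show "(\<lambda>k. \<theta> z - h k) \<longlonglongrightarrow> \<theta> z" using tendsto_diff[OF tendsto_const hl, of "\<theta> z"] by simp
      qed (use ramp_bounds[OF h, of "\<theta> z"] \<theta> in auto)
      show ?thesis unfolding ramp_density_def by (intro tendsto_intros l1 l2)
    qed simp
    then show "AE z in lborel. (\<lambda>k. indicator E z *\<^sub>R ramp_density (h k) z) \<longlonglongrightarrow> indicator E z *\<^sub>R ?l z" by simp
  qed (rule ramp_density_measurable[OF h] integrable_indicator_dominator)+
  then have "(\<lambda>k. 0) \<longlonglongrightarrow> (LINT z:E|lborel. ?l z)"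
    unfolding set_lebesgue_integral_def[symmetric] ramp_identity[OF h] .
  then have "(LINT z:E|lborel. ?l z) = 0" by (simp add: LIMSEQ_const_iff)
  moreover have "(LINT z:E|lborel. ?l z) = (LINT z:E|lborel. Pdens X T z - \<theta> z * (Pdens X T z + Qdens X T z))"
    by (simp add: algebra_simps)
  moreover have "\<dots> = (LINT z:E|lborel. Pdens X T z) - (LINT z:E|lborel. \<theta> z * (Pdens X T z + Qdens X T z))"
    by (rule set_integral_diff[OF P_integrable \<theta>PQ_integrable])
  ultimately show ?thesis by simp
qed

end

text \<open>The difference quotients of \<open>s \<mapsto> max 0 (f + s)\<close> are at most \<open>1\<close> and converge to the indicator of
  \<open>f + s > 0\<close> off the level set.\<close>

lemma has_real_derivative_integral_positive_part:
  fixes f G :: "'a \<Rightarrow> real"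
  assumes f: "f \<in> borel_measurable M" and G: "integrable M G"
    and int: "integrable M (\<lambda>z. max 0 (f z + s0) * G z)"
    and level: "AE z in M. G z \<noteq> 0 \<longrightarrow> f z \<noteq> - s0"
  shows "((\<lambda>s. LINT z|M. max 0 (f z + s) * G z) has_real_derivative
    (LINT z|M. (if f z + s0 > 0 then G z else 0))) (at s0)"
  unfolding DERIV_def tendsto_at_iff_sequentially comp_def
proof (intro allI impI)
  fix h :: "nat \<Rightarrow> real" assume h0: "\<forall>i. h i \<in> UNIV - {0}" and hl: "h \<longlonglongrightarrow> 0"
  have Gm: "G \<in> borel_measurable M" using G by simp
  let ?q = "\<lambda>k z. (max 0 (f z + (s0 + h k)) - max 0 (f z + s0)) / h k * G z"
  have lip: "\<bar>max 0 (x + y) - max 0 x\<bar> \<le> \<bar>y\<bar>" for x y :: real by (auto simp: max_def)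
  have qb: "\<bar>?q k z\<bar> \<le> \<bar>G z\<bar>" for k z
  proof -
    have "\<bar>max 0 (f z + (s0 + h k)) - max 0 (f z + s0)\<bar> \<le> \<bar>h k\<bar>"
      using lip[of "f z + s0" "h k"] by (simp add: add.assoc)
    then have "\<bar>(max 0 (f z + (s0 + h k)) - max 0 (f z + s0)) / h k\<bar> \<le> 1"
      using h0 by (simp add: divide_le_eq_1)
    then show ?thesis unfolding abs_mult by (rule mult_left_le_one_le[rotated 2]) auto
  qed
  have qm: "?q k \<in> borel_measurable M" for k using f Gm by measurable
  have qi: "integrable M (?q k)" for k
    by (rule Bochner_Integration.integrable_bound[OF G qm]) (use qb in auto)
  have quot: "((LINT z|M. max 0 (f z + (s0 + h k)) * G z) - (LINT z|M. max 0 (f z + s0) * G z)) / h k = (LINT z|M. ?q k z)" for k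
  proof -
    have hk: "h k \<noteq> 0" using h0 by auto
    have e: "max 0 (f z + (s0 + h k)) * G z = h k * ?q k z + max 0 (f z + s0) * G z" for z
      using hk by (simp add: field_simps)
    have "(LINT z|M. max 0 (f z + (s0 + h k)) * G z) = (LINT z|M. h k * ?q k z) + (LINT z|M. max 0 (f z + s0) * G z)"
      unfolding e by (rule Bochner_Integration.integral_add[OF integrable_mult_right[OF qi] int])
    then show ?thesis using hk by simp
  qed
  have "(\<lambda>k. LINT z|M. ?q k z) \<longlonglongrightarrow> (LINT z|M. (if f z + s0 > 0 then G z else 0))"
  proof (rule integral_dominated_convergence[where w="\<lambda>z. \<bar>G z\<bar>"])
    show "(\<lambda>z. if f z + s0 > 0 then G z else 0) \<in> borel_measurable M" using f Gm by measurable
    show "AE z in M. norm (?q k z) \<le> \<bar>G z\<bar>" for k using qb by simp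
    show "AE z in M. (\<lambda>k. ?q k z) \<longlonglongrightarrow> (if f z + s0 > 0 then G z else 0)"
      using level
    proof eventually_elim
      fix z assume lv: "G z \<noteq> 0 \<longrightarrow> f z \<noteq> - s0"
      consider "G z = 0" | "f z + s0 > 0" | "f z + s0 < 0" using lv by fastforce
      then show "(\<lambda>k. ?q k z) \<longlonglongrightarrow> (if f z + s0 > 0 then G z else 0)"
      proof cases
        case 1
        then show ?thesis by simp
      next
        case 2
        have "(\<lambda>k. f z + s0 + h k) \<longlonglongrightarrow> f z + s0" using tendsto_add[OF tendsto_const hl] by simp
        from order_tendstoD(1)[OF this 2] have "\<forall>\<^sub>F k in sequentially. ?q k z = G z"
          by eventually_elim (use 2 h0 in \<open>simp add: max_def add.assoc\<close>)
        then show ?thesis using 2 by (simp add: tendsto_eventually)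
      next
        case 3
        have "(\<lambda>k. f z + s0 + h k) \<longlonglongrightarrow> f z + s0" using tendsto_add[OF tendsto_const hl] by simp
        from order_tendstoD(2)[OF this 3] have "\<forall>\<^sub>F k in sequentially. ?q k z = 0"
          by eventually_elim (use 3 in \<open>simp add: max_def add.assoc\<close>)
        then show ?thesis using 3 by (simp add: tendsto_eventually)
      qed
    qed
  qed (use qm G in auto)
  then show "(\<lambda>k. ((LINT z|M. max 0 (f z + (s0 + h k)) * G z) - (LINT z|M. max 0 (f z + s0) * G z)) / h k)
      \<longlonglongrightarrow> (LINT z|M. (if f z + s0 > 0 then G z else 0))"
    by (simp add: quot)
qed

lemma borel_measurable_psi:
  fixes X :: "real^'n::finite"
  shows "psi X T \<in> borel_measurable borel"
proof -
  have [measurable]: "(\<lambda>z :: (real^'n) \<times> real. 4 * pi * (T - snd z)) \<in> borel_measurable borel"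
    "(\<lambda>z :: (real^'n) \<times> real. (norm (fst z - X))\<^sup>2) \<in> borel_measurable borel"
    "(\<lambda>z :: (real^'n) \<times> real. 4 * (T - snd z)) \<in> borel_measurable borel"
    by (intro borel_measurable_continuous_onI continuous_intros)+
  show ?thesis unfolding psi_def[abs_def] by measurable
qed

text \<open>The time slices of a level set of \<open>\<psi>\<close> are contained in spheres.\<close>

lemma AE_psi_neq:
  fixes X :: "real^'n::finite"
  shows "AE z in lborel. snd z < T \<longrightarrow> psi X T z \<noteq> s"
proof -
  let ?N = "{z. snd z < T \<and> psi X T z = s}"
  have N: "?N \<in> sets borel"
  proof -
    have "{z :: (real^'n) \<times> real. snd z < T} \<in> sets borel"
      by (intro borel_open open_Collect_less continuous_intros)
    moreover have "{z. psi X T z = s} \<in> sets borel"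
      using borel_measurable_psi[of X T] by measurable
    ultimately show ?thesis using sets.Int[of "{z. snd z < T}" borel "{z. psi X T z = s}"] by (simp add: Collect_conj_eq)
  qed
  have slice: "emeasure lborel ((\<lambda>x. (x, t)) -` ?N) = 0" for t
  proof -
    define c where "c = sqrt ((- ((real CARD('n) - 4) / 2) * ln (4 * pi * (T - t)) - s) * (4 * (T - t)))"
    have "(\<lambda>x. (x, t)) -` ?N \<subseteq> sphere X c"
    proof
      fix x assume "x \<in> (\<lambda>x. (x, t)) -` ?N"
      then have "t < T" "psi X T (x, t) = s" by auto
      then have "(norm (x - X))\<^sup>2 = (- ((real CARD('n) - 4) / 2) * ln (4 * pi * (T - t)) - s) * (4 * (T - t))"
        unfolding psi_def by (simp add: field_simps)
      then have "c = norm (x - X)" unfolding c_def by (metis norm_ge_zero real_sqrt_unique)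
      then show "x \<in> sphere X c" by (simp add: dist_norm norm_minus_commute)
    qed
    moreover have "emeasure lborel (sphere X c) = 0"
    proof -
      have "sphere X c \<in> null_sets lebesgue" using negligible_sphere negligible_iff_null_sets by blast
      then have "emeasure lebesgue (sphere X c) = 0" by auto
      moreover have "sphere X c \<in> sets lborel" by simp
      ultimately show ?thesis by simp
    qed
    ultimately show ?thesis
      using emeasure_mono[of "(\<lambda>x. (x, t)) -` ?N" "sphere X c" lborel] by simp
  qed
  have "emeasure lborel ?N = (\<integral>\<^sup>+ t. emeasure lborel ((\<lambda>x. (x, t)) -` ?N) \<partial>lborel)"
    unfolding lborel_prod[symmetric]
    by (rule lborel_pair.emeasure_pair_measure_alt2) (use N in \<open>simp only: lborel_prod sets_lborel\<close>)
  also have "\<dots> = 0" by (simp only: slice) simp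
  finally have "?N \<in> null_sets lborel" using N by (auto intro: null_setsI)
  then show ?thesis by (rule AE_I') auto
qed

context ymh_finite_energy
begin

lemma heat_ball_data:
  assumes "0 < \<sigma>" "\<sigma> < r0"
  shows "ymh_heat_ball br act W a T A u X r0 \<sigma> (heat_const CARD('n) * \<sigma>)"
  by unfold_locales (use assms in auto)

text \<open>All integrals for radii up to some \<open>\<rho>\<close> between \<open>r\<close> and \<open>r\<^sub>0\<close> are integrals over the heat ball of radius \<open>\<rho>\<close>,
  on which the identity for \<open>P\<close> says that its integral, as a function of \<open>s = (n - 4) ln r\<close>, has the
  derivative \<open>P + Q\<close> integrated over the heat ball. The factor \<open>r\<^bsup>-(n-4)\<^esup> = exp (- s)\<close> removes the part \<open>P\<close>.\<close>

lemma heat_ball_derivative: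
  assumes r: "0 < r" "r < r0"
  shows "((\<lambda>r. 1 / r ^ (CARD('n) - 4) * (LINT z:heat_ball X T r|lborel. Pdens X T z)) has_real_derivative
    (real CARD('n) - 4) / r ^ (CARD('n) - 3) * (LINT z:heat_ball X T r|lborel. Qdens X T z)) (at r)"
proof -
  define m where "m = real CARD('n) - 4"
  define \<rho> where "\<rho> = (r + r0) / 2"
  have m: "m > 0" using n4 by (simp add: m_def)
  have \<rho>: "0 < \<rho>" "\<rho> < r0" "r < \<rho>" using r by (auto simp: \<rho>_def)
  interpret B: ymh_heat_ball br act W a T A u X r0 \<rho> "heat_const CARD('n) * \<rho>"
    by (rule heat_ball_data[OF \<rho>(1,2)])
  let ?E = "\<lambda>\<sigma>. heat_ball X T \<sigma>"
  define G where "G z = indicator (?E \<rho>) z *\<^sub>R (Pdens X T z + Qdens X T z)" for z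
  have mem: "z \<in> ?E \<sigma> \<longleftrightarrow> snd z < T \<and> psi X T z + m * ln \<sigma> > 0" if "\<sigma> > 0" for \<sigma> z
    using mem_heat_ball_iff[OF that, of "fst z" "snd z" X T] by (simp add: m_def)
  have layer: "indicator (?E \<sigma>) z *\<^sub>R ((psi X T z + m * ln \<sigma>) * (Pdens X T z + Qdens X T z)) = max 0 (psi X T z + m * ln \<sigma>) * G z"
    "indicator (?E \<sigma>) z *\<^sub>R (Pdens X T z + Qdens X T z) = (if psi X T z + m * ln \<sigma> > 0 then G z else 0)"
    if "0 < \<sigma>" "\<sigma> \<le> \<rho>" for \<sigma> z
  proof -
    have "m * ln \<sigma> \<le> m * ln \<rho>" using m that by simp
    then have "z \<in> ?E \<sigma> \<longleftrightarrow> z \<in> ?E \<rho> \<and> psi X T z + m * ln \<sigma> > 0"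
      unfolding mem[OF that(1)] mem[OF \<rho>(1)] by linarith
    then show "indicator (?E \<sigma>) z *\<^sub>R ((psi X T z + m * ln \<sigma>) * (Pdens X T z + Qdens X T z)) = max 0 (psi X T z + m * ln \<sigma>) * G z"
      "indicator (?E \<sigma>) z *\<^sub>R (Pdens X T z + Qdens X T z) = (if psi X T z + m * ln \<sigma> > 0 then G z else 0)"
      by (auto simp: G_def indicator_def)
  qed
  let ?L = "\<lambda>s. LINT z|lborel. max 0 (psi X T z + s) * G z"
  have IP: "(LINT z:?E \<sigma>|lborel. Pdens X T z) = ?L (m * ln \<sigma>)"
    and int: "integrable lborel (\<lambda>z. max 0 (psi X T z + m * ln \<sigma>) * G z)"
    if \<sigma>: "0 < \<sigma>" "\<sigma> \<le> \<rho>" for \<sigma>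
  proof -
    interpret S: ymh_heat_ball br act W a T A u X r0 \<sigma> "heat_const CARD('n) * \<sigma>"
      by (rule heat_ball_data) (use \<sigma> \<rho> in auto)
    have \<theta>: "S.\<theta> z = psi X T z + m * ln \<sigma>" for z by (simp add: S.\<theta>_def m_def)
    show "(LINT z:?E \<sigma>|lborel. Pdens X T z) = ?L (m * ln \<sigma>)"
      using S.heat_ball_identity unfolding \<theta> set_lebesgue_integral_def layer(1)[OF \<sigma>] .
    show "integrable lborel (\<lambda>z. max 0 (psi X T z + m * ln \<sigma>) * G z)"
      using S.\<theta>PQ_integrable unfolding \<theta> set_integrable_def layer(1)[OF \<sigma>] .
  qed
  interpret S: ymh_heat_ball br act W a T A u X r0 r "heat_const CARD('n) * r"
    by (rule heat_ball_data[OF r])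
  let ?IP = "LINT z:?E r|lborel. Pdens X T z" and ?IQ = "LINT z:?E r|lborel. Qdens X T z"
  have "(?L has_real_derivative (LINT z|lborel. (if psi X T z + m * ln r > 0 then G z else 0))) (at (m * ln r))"
  proof (rule has_real_derivative_integral_positive_part)
    show "psi X T \<in> borel_measurable lborel" using borel_measurable_psi by simp
    show "integrable lborel G"
      using set_integral_add(1)[OF B.P_integrable B.Q_integrable] by (simp add: set_integrable_def G_def[abs_def])
    show "integrable lborel (\<lambda>z. max 0 (psi X T z + m * ln r) * G z)" by (rule int) (use r \<rho> in auto)
    show "AE z in lborel. G z \<noteq> 0 \<longrightarrow> psi X T z \<noteq> - (m * ln r)"
      using AE_psi_neq[of T X "- (m * ln r)"]
      by eventually_elim (auto simp: G_def indicator_def mem[OF \<rho>(1)])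
  qed
  also have "(LINT z|lborel. (if psi X T z + m * ln r > 0 then G z else 0)) = (LINT z:?E r|lborel. Pdens X T z + Qdens X T z)"
    unfolding set_lebesgue_integral_def by (subst layer(2)) (use r \<rho> in auto)
  also have "\<dots> = ?IP + ?IQ" by (rule set_integral_add(2)[OF S.P_integrable S.Q_integrable])
  finally have L: "(?L has_real_derivative (?IP + ?IQ)) (at (m * ln r))" .
  have "((\<lambda>\<sigma>. m * ln \<sigma>) has_real_derivative m / r) (at r)"
    using r by (auto intro!: derivative_eq_intros)
  from DERIV_chain2[OF L this] have "((\<lambda>\<sigma>. ?L (m * ln \<sigma>)) has_real_derivative (?IP + ?IQ) * (m / r)) (at r)" .
  then have dIP: "((\<lambda>\<sigma>. LINT z:?E \<sigma>|lborel. Pdens X T z) has_real_derivative (?IP + ?IQ) * (m / r)) (at r)"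
    by (rule has_field_derivative_transform_within_open[of _ _ _ "{0<..<\<rho>}"]) (use r \<rho> IP in auto)
  define k where "k = CARD('n) - 4"
  have k: "real k = m" "CARD('n) - 3 = Suc k" "k > 0" using n4 by (auto simp: k_def m_def)
  have pw: "((\<lambda>\<sigma>. 1 / \<sigma> ^ k) has_real_derivative - m / r ^ Suc k) (at r)"
  proof -
    have "((\<lambda>\<sigma>. \<sigma> ^ k) has_real_derivative m * r ^ (k - 1)) (at r)"
      using DERIV_pow[of k r UNIV] k by simp
    from DERIV_divide[OF DERIV_const this, of 1] have "((\<lambda>\<sigma>. 1 / \<sigma> ^ k) has_real_derivative
        - (m * r ^ (k - 1)) / (r ^ k * r ^ k)) (at r)" using r by simp
    moreover have "r ^ k = r * r ^ (k - 1)" using k(3) by (cases k) auto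
    ultimately show ?thesis using r by (simp add: field_simps)
  qed
  have "((\<lambda>\<sigma>. 1 / \<sigma> ^ k * (LINT z:?E \<sigma>|lborel. Pdens X T z)) has_real_derivative
      - m / r ^ Suc k * ?IP + (?IP + ?IQ) * (m / r) * (1 / r ^ k)) (at r)"
    by (rule DERIV_mult[OF pw dIP])
  also have "- m / r ^ Suc k * ?IP + (?IP + ?IQ) * (m / r) * (1 / r ^ k) = m / r ^ Suc k * ?IQ"
    using r by (simp add: field_simps)
  finally show ?thesis unfolding k(2) k_def[symmetric] m_def[symmetric] .
qed

end

section \<open>The local monotonicity formula\<close>

lemma sum_greaterThan_symmetric:
  fixes f :: "'n::{finite,linorder} \<Rightarrow> 'n \<Rightarrow> real"
  assumes "\<And>i j. f i j = f j i" "\<And>i. f i i = 0"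
  shows "(\<Sum>i\<in>UNIV. \<Sum>j\<in>{i<..}. f i j) = (\<Sum>i\<in>UNIV. \<Sum>j\<in>UNIV. f i j) / 2"
proof -
  let ?g = "\<lambda>i j. if i < j then f i j else 0"
  have "f i j = ?g i j + ?g j i" for i j
    using assms by (cases i j rule: linorder_cases) auto
  then have "(\<Sum>i\<in>UNIV. \<Sum>j\<in>UNIV. f i j) = (\<Sum>i\<in>UNIV. \<Sum>j\<in>UNIV. ?g i j) + (\<Sum>i\<in>UNIV. \<Sum>j\<in>UNIV. ?g j i)"
    by (simp only: sum.distrib[symmetric])
  also have "(\<Sum>i\<in>UNIV. \<Sum>j\<in>UNIV. ?g j i) = (\<Sum>i\<in>UNIV. \<Sum>j\<in>UNIV. ?g i j)"
    by (rule sum.swap)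
  also have "(\<Sum>i\<in>UNIV. \<Sum>j\<in>UNIV. ?g i j) = (\<Sum>i\<in>UNIV. \<Sum>j\<in>{i<..}. f i j)"
    using sum.inter_filter[of UNIV "f _" "\<lambda>j. _ < j"] by (simp add: greaterThan_def)
  finally show ?thesis by simp
qed

theorem theorem3p3:
  fixes gmult :: "'g::{t2_space,second_countable_topology} \<Rightarrow> 'g \<Rightarrow> 'g"
    and gunit :: 'g and ginv :: "'g \<Rightarrow> 'g"
    and \<A> :: "('g, 'm::euclidean_space) chart set"
    and L :: "'l::euclidean_space \<Rightarrow> ('g \<Rightarrow> real) \<Rightarrow> 'g \<Rightarrow> real"
    and br :: "'l \<Rightarrow> 'l \<Rightarrow> 'l"
    and \<rho> :: "'g \<Rightarrow> 'v::euclidean_space \<Rightarrow>\<^sub>L 'v"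
    and act :: "'l \<Rightarrow> 'v \<Rightarrow> 'v"
    and W :: "real \<Rightarrow> real"
    and A :: "real \<Rightarrow> ('n::{finite,linorder}, 'l) gauge_field"
    and u :: "real \<Rightarrow> ('n, 'v) scalar_field"
    and X :: "(real, 'n) vec" and a T r\<^sub>0 :: real and n :: nat
  assumes G: "lie_group gmult gunit ginv \<A>"
    and G_compact: "compact (UNIV :: 'g set)"
    and G_connected: "connected (UNIV :: 'g set)"
    and lie_algebra: "is_lie_algebra_of gmult \<A> L br"
    and semisimple: "semisimple br"
    and inner_product: "\<And>Y Z. Y \<bullet> Z = - killing_form br Y Z"
    and representation: "orthogonal_representation gmult gunit \<A> \<rho>"
    and action: "act = derived_action L gunit \<rho>"
    and W_C1: "W C1_differentiable_on UNIV"
    and W_nonneg: "\<And>s. W s \<ge> 0"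
    and n_def: "n = CARD('n)"
    and n_gt_4: "n > 4"
    and a_less_T: "a < T"
    and smooth: "smooth_family a T A u"
    and flow: "YMH_flow br act W a T A u"
    and r0: "0 < r\<^sub>0" "r\<^sub>0 \<le> sqrt (4 * pi * (T - a))"
    and energy_L1: "set_integrable lborel
          (ball X (2 * heat_const n * r\<^sub>0) \<times> {T - r\<^sub>0\<^sup>2 / (4 * pi)<..<T})
          (\<lambda>(x, t). energy_density br act W (A t) (u t) x)"
  shows "\<forall>r\<in>{0<..<r\<^sub>0}.
    let P = (\<lambda>(x, t). energy_density br act W (A t) (u t) x * ((real n - 4) / (2 * (T - t)))
               - (\<Sum>j\<in>UNIV. contr_F br X T A j x t \<bullet> S_A br X T A j x t)
               - contr_D act X T A u x t \<bullet> J_u act X T A u x t);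
        Q = (\<lambda>(x, t). ((\<Sum>i\<in>UNIV. (norm (covD act (A t) i (u t) x))\<^sup>2) + 4 * W ((norm (u t x))\<^sup>2))
                 / (2 * (T - t))
               + (\<Sum>j\<in>UNIV. (norm (S_A br X T A j x t))\<^sup>2)
               + (norm (J_u act X T A u x t))\<^sup>2)
    in set_integrable lborel (heat_ball X T r) P \<and>
       set_integrable lborel (heat_ball X T r) Q \<and>
       ((\<lambda>r. 1 / r ^ (n - 4) * set_lebesgue_integral lborel (heat_ball X T r) P)
          has_real_derivative
        (real n - 4) / r ^ (n - 3) * set_lebesgue_integral lborel (heat_ball X T r) Q) (at r)"
proof -
  have Lie: "lie_action br act"
    unfolding action by (rule derived_action_lie_action[OF lie_algebra G representation inner_product])
  interpret Y: ymh_flow br act W a T A u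
    by (intro ymh_flow.intro Lie ymh_flow_axioms.intro smooth flow W_C1 W_nonneg)
  have N2: "(norm (v :: 'c::real_inner))\<^sup>2 = v \<bullet> v" for v by (rule power2_norm_eq_inner)
  have ed: "energy_density br act W (A t) (u t) x = Y.edens (x, t)" if xt: "(x, t) \<in> Y.spacetime" for x t
  proof -
    have "(\<Sum>i\<in>UNIV. \<Sum>j\<in>{i<..}. (norm (curv br (A t) i j x))\<^sup>2)
        = (\<Sum>i\<in>UNIV. \<Sum>j\<in>UNIV. (norm (curv br (A t) i j x))\<^sup>2) / 2"
    proof (rule sum_greaterThan_symmetric)
      fix i j
      show "(norm (curv br (A t) i j x))\<^sup>2 = (norm (curv br (A t) j i x))\<^sup>2"
        using Y.F_antisym[of "Some i" "Some j" "(x, t)"] by (simp add: Y.curv_eq[OF xt])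
      have "Y.F (Some i) (Some i) (x, t) = 0"
        using Y.F_antisym[of "Some i" "Some i" "(x, t)"]
        by (simp add: eq_neg_iff_add_eq_0 scaleR_2[symmetric])
      then show "(norm (curv br (A t) i i x))\<^sup>2 = 0" by (simp add: Y.curv_eq[OF xt])
    qed
    then show ?thesis
      by (simp add: energy_density_def Y.edens_def Y.curv_eq[OF xt] Y.covD_eq[OF xt] N2 Y.field_def)
  qed
  have cF: "contr_F br X T A j x t = Y.xiF X T j (x, t)" if xt: "(x, t) \<in> Y.spacetime" for j x t
    by (simp add: contr_F_def Y.xiF_def Y.xi_def Y.curv_eq[OF xt])
  have cD: "contr_D act X T A u x t = Y.xiD X T (x, t)" if xt: "(x, t) \<in> Y.spacetime" for x t
    by (simp add: contr_D_def Y.xiD_def Y.xi_def Y.covD_eq[OF xt])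
  have S: "S_A br X T A j x t = Y.SA X T j (x, t)" if xt: "(x, t) \<in> Y.spacetime" for j x t
    by (simp add: S_A_def Y.SA_def cF[OF xt] Y.dt_A_eq[OF xt])
  have J: "J_u act X T A u x t = Y.Ju X T (x, t)" if xt: "(x, t) \<in> Y.spacetime" for x t
    by (simp add: J_u_def Y.Ju_def cD[OF xt] Y.dt_u_eq[OF xt])
  have r0sq: "r\<^sub>0\<^sup>2 \<le> 4 * pi * (T - a)"
  proof -
    have "r\<^sub>0\<^sup>2 \<le> (sqrt (4 * pi * (T - a)))\<^sup>2" using r0 by (intro power_mono) auto
    then show ?thesis using a_less_T by simp
  qed
  let ?C = "ball X (2 * heat_const CARD('n) * r\<^sub>0) \<times> {T - r\<^sub>0\<^sup>2 / (4 * pi)<..<T}"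
  have "T - r\<^sub>0\<^sup>2 / (4 * pi) \<ge> a" using r0sq by (simp add: field_simps)
  then have C: "?C \<subseteq> Y.spacetime" by (auto simp: Y.spacetime_def)
  have "set_integrable lborel ?C (\<lambda>(x, t). energy_density br act W (A t) (u t) x)
      \<longleftrightarrow> set_integrable lborel ?C Y.edens"
    by (rule set_integrable_cong) (use C ed in auto)
  then have L1: "set_integrable lborel ?C Y.edens" using energy_L1 n_def by simp
  interpret Y: ymh_finite_energy br act W a T A u X r\<^sub>0
    by unfold_locales (use n_gt_4 n_def r0sq L1 in auto)
  define P where "P = (\<lambda>(x, t). energy_density br act W (A t) (u t) x * ((real n - 4) / (2 * (T - t)))
               - (\<Sum>j\<in>UNIV. contr_F br X T A j x t \<bullet> S_A br X T A j x t)
               - contr_D act X T A u x t \<bullet> J_u act X T A u x t)"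
  define Q where "Q = (\<lambda>(x, t). ((\<Sum>i\<in>UNIV. (norm (covD act (A t) i (u t) x))\<^sup>2) + 4 * W ((norm (u t x))\<^sup>2))
                 / (2 * (T - t))
               + (\<Sum>j\<in>UNIV. (norm (S_A br X T A j x t))\<^sup>2)
               + (norm (J_u act X T A u x t))\<^sup>2)"
  have PQ: "P z = Y.Pdens X T z" "Q z = Y.Qdens X T z" if "z \<in> Y.spacetime" for z
  proof -
    obtain x t where z: "z = (x, t)" by (cases z)
    have xt: "(x, t) \<in> Y.spacetime" using that z by simp
    show "P z = Y.Pdens X T z"
      by (simp add: P_def z ed[OF xt] cF[OF xt] S[OF xt] cD[OF xt] J[OF xt] Y.Pdens_def Y.xiY_def n_def)
    show "Q z = Y.Qdens X T z"
      by (simp add: Q_def z Y.covD_eq[OF xt] S[OF xt] J[OF xt] Y.Qdens_def N2 Y.field_def)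
  qed
  have main: "set_integrable lborel (heat_ball X T r) P \<and> set_integrable lborel (heat_ball X T r) Q \<and>
       ((\<lambda>r. 1 / r ^ (n - 4) * set_lebesgue_integral lborel (heat_ball X T r) P)
          has_real_derivative
        (real n - 4) / r ^ (n - 3) * set_lebesgue_integral lborel (heat_ball X T r) Q) (at r)"
    if r: "r \<in> {0<..<r\<^sub>0}" for r
  proof -
    have sub: "heat_ball X T \<sigma> \<subseteq> Y.spacetime" "heat_ball X T \<sigma> \<in> sets lborel" if "0 < \<sigma>" "\<sigma> < r\<^sub>0" for \<sigma>
      using ymh_heat_ball.E_subset(3)[OF Y.heat_ball_data[OF that]] borel_open[OF open_heat_ball[OF that(1), of X T]] by simp_all
    have eq: "set_lebesgue_integral lborel (heat_ball X T \<sigma>) P = (LINT z:heat_ball X T \<sigma>|lborel. Y.Pdens X T z)"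
      "set_lebesgue_integral lborel (heat_ball X T \<sigma>) Q = (LINT z:heat_ball X T \<sigma>|lborel. Y.Qdens X T z)"
      if "0 < \<sigma>" "\<sigma> < r\<^sub>0" for \<sigma>
      by (rule set_lebesgue_integral_cong[OF sub(2)[OF that]], use sub(1)[OF that] PQ in blast)+
    have r': "0 < r" "r < r\<^sub>0" using r by auto
    have "set_integrable lborel (heat_ball X T r) P \<longleftrightarrow> set_integrable lborel (heat_ball X T r) (Y.Pdens X T)"
      "set_integrable lborel (heat_ball X T r) Q \<longleftrightarrow> set_integrable lborel (heat_ball X T r) (Y.Qdens X T)"
      by (rule set_integrable_cong[OF refl refl], use sub(1)[OF r'] PQ in blast)+
    then have i: "set_integrable lborel (heat_ball X T r) P" "set_integrable lborel (heat_ball X T r) Q"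
      using ymh_heat_ball.P_integrable[OF Y.heat_ball_data[OF r']] ymh_heat_ball.Q_integrable[OF Y.heat_ball_data[OF r']]
      by blast+
    have "((\<lambda>r. 1 / r ^ (n - 4) * set_lebesgue_integral lborel (heat_ball X T r) P)
          has_real_derivative
        (real n - 4) / r ^ (n - 3) * (LINT z:heat_ball X T r|lborel. Y.Qdens X T z)) (at r)"
      by (rule has_field_derivative_transform_within_open[OF Y.heat_ball_derivative[OF r', folded n_def],
            of "{0<..<r\<^sub>0}"]) (use r' eq in auto)
    then show ?thesis using i eq(2)[OF r'] by simp
  qed
  then show ?thesis unfolding Let_def P_def[symmetric] Q_def[symmetric] by blast
qed


end
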